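(* A regular $I$-partial multiplier Hopf algebra $(A,\Delta)$ is (forgetting the grading and viewing $\Delta$ as a map $A\to M(A\otimes A)$) a regular weak multiplier Hopf algebra.
   Context: Conventions. Algebras are associative over $\mathbb C$, not necessarily unital; for subspaces, $VW$ is the span of products. $M(A)$ is the multiplier algebra of $A$: pairs $m=(\lambda,\rho)$ of linear maps on $A$, written $ma=\lambda(a)$, $am=\rho(a)$, with $a(mb)=(am)b$; strict convergence $m_\alpha\to m$ means that for each $a\in A$ eventually $m_\alpha a=ma$ and $am_\alpha=am$. An algebra $B$ is left (right) non-degenerate if $bB=0$ (resp. $Bb=0$) implies $b=0$, non-degenerate if both, and idempotent if $BB=B$. Partial algebras. For a set $J$, a $J$-partial algebra is an algebra $A=\bigoplus_{r,s\in J}A(r,s)$ with $A(r,s)A(s',t)=0$ for $s\neq s'$ and $A(r,s)A(s,t)\subseteq A(r,t)$. Its base units $\mathbf 1(r)\in M(A)$ are given by $\mathbf 1(r)a=\delta_{r,r'}a$, $a\mathbf 1(s)=\delta_{s,s'}a$ for $a\in A(r',s')$. It is non-degenerate if all algebras $A\mathbf 1(r)$ are left non-degenerate and all $\mathbf 1(r)A$ are right non-degenerate; idempotent if all $A\mathbf 1(r)$ and $\mathbf 1(r)A$ are idempotent. A morphism $A\to B$ of non-degenerate idempotent $J$-partial algebras is a homomorphism $f:A\to M(B)$ with $B\mathbf 1(r)\cdot f(A\mathbf 1(r))=B\mathbf 1(r)$ and $f(\mathbf 1(r)A)\cdot\mathbf 1(r)B=\mathbf 1(r)B$ for all $r$;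 it extends uniquely to a unital homomorphism $M(A)\to M(B)$. Partial multiplier Hopf algebras. Fix a set $I$. In an $I^2$-partial algebra ($J=I\times I$, indices written as columns) the base units are $\mathbf 1\binom rt$ and the components are ${}^r_tA^s_u=\mathbf 1\binom rtA\mathbf 1\binom su$. Put $\mathbf 1^r=\sum_t\mathbf 1\binom rt$, $\mathbf 1_t=\sum_r\mathbf 1\binom rt$ (strict sums in $M(A)$). Omitted indices are summed over: $A^s=A\mathbf 1^s$, $A_u=A\mathbf 1_u$, ${}^rA=\mathbf 1^rA$, ${}_tA=\mathbf 1_tA$, $A^s_u=A\mathbf 1\binom su$, etc. $A\otimes^IB=\bigoplus\,{}^r_tA^s_u\otimes{}^t_vB^u_w\subseteq A\otimes B$ is an $I^2$-partial algebra with ${}^r_v(A\otimes^IB)^s_w=\bigoplus_{t,u}{}^r_tA^s_u\otimes{}^t_vB^u_w$; it equals $E_0(A\otimes B)E_0$ with $E_0=\sum_t\mathbf 1_t\otimes\mathbf 1^t$, and one identifies $M(A\otimes^IB)=E_0\,M(A\otimes B)E_0\subseteq M(A\otimes B)$. For a non-degenerate idempotent $I^2$-partial algebra $A$, a regular comultiplication is a morphism $\Delta$ from $A$ to $A\otimes^IA$ such that $\Delta(a)(b\otimes1),\Delta(a)(1\otimes b),(b\otimes1)\Delta(a),(1\otimes b)\Delta(a)\in A\otimes A$ for all $a,b\in A$ and $(\Delta\otimes\mathrm{id})\Delta=(\mathrm{id}\otimes\Delta)\Delta$. For a functional $\omega$, $(\mathrm{id}\otimes\omega)\Delta(a)\in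 M(A)$ is the multiplier $b\mapsto(\mathrm{id}\otimes\omega)(\Delta(a)(b\otimes1))$, $b\mapsto(\mathrm{id}\otimes\omega)((b\otimes1)\Delta(a))$; similarly $(\omega\otimes\mathrm{id})\Delta(a)$. $(A,\Delta)$ is a regular $I$-partial multiplier bialgebra if there is a functional $\varepsilon:A\to\mathbb C$ with: $\varepsilon({}^r_tA^s_u)=0$ if $r\ne t$ or $s\neq u$; $\varepsilon(A_r)\neq0\neq\varepsilon({}_rA)$ for all $r$; $\varepsilon(ab)=\varepsilon(a)\varepsilon(b)$ for $a\in A^s_t$, $b\in{}^s_tA$; $(\mathrm{id}\otimes\varepsilon)\Delta(a)=a=(\varepsilon\otimes\mathrm{id})\Delta(a)$. It is a regular $I$-partial multiplier Hopf algebra if the following maps are bijective, with $\Delta^{\mathrm{op}}$ the flipped coproduct: $\bigoplus_r A_r\otimes{}_rA\to\bigoplus_r{}_rA\otimes{}^rA$, $a\otimes b\mapsto\Delta(a)(1\otimes b)$; $\bigoplus_rA^r\otimes{}^rA\to\bigoplus_rA_r\otimes A^r$, $a\otimes b\mapsto(a\otimes1)\Delta(b)$; $\bigoplus_rA^r\otimes{}^rA\to\bigoplus_r{}^rA\otimes{}_rA$, $a\otimes b\mapsto\Delta^{\mathrm{op}}(a)(1\otimes b)$; $\bigoplus_rA_r\otimes{}_rA\to\bigoplus_rA^r\otimes A_r$, $a\otimes b\mapsto(a\otimes1)\Delta^{\mathrm{op}}(b)$. Regular weak multiplier bialgebra. Let $A$ be an idempotent non-degenerate algebra with multiplication $\mu$,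 and $\Delta:A\to M(A\otimes A)$ a multiplicative linear map. $(A,\Delta)$ is a regular weak multiplier bialgebra if there exist an idempotent $E\in M(A\otimes A)$ and a linear map $\varepsilon:A\to\mathbb C$ such that: (i) $T_1(a\otimes b)=\Delta(a)(1\otimes b)$, $T_2(a\otimes b)=(a\otimes1)\Delta(b)$, $T_3(a\otimes b)=(1\otimes b)\Delta(a)$, $T_4(a\otimes b)=\Delta(b)(a\otimes1)$ define maps $A\otimes A\to A\otimes A$; (ii) $(T_2\otimes\mathrm{id})(\mathrm{id}\otimes T_1)=(\mathrm{id}\otimes T_1)(T_2\otimes\mathrm{id})$ (equivalently $(T_4\otimes\mathrm{id})(\mathrm{id}\otimes T_3)=(\mathrm{id}\otimes T_3)(T_4\otimes\mathrm{id})$); (iii) $(\varepsilon\otimes\mathrm{id})T_1=\mu=(\mathrm{id}\otimes\varepsilon)T_2$ (equivalently $(\varepsilon\otimes\mathrm{id})T_3=\mu^{\mathrm{op}}=(\mathrm{id}\otimes\varepsilon)T_4$); (iv) $\mathrm{Span}\{\Delta(a)(b\otimes c)\}=\mathrm{Span}\{E(b\otimes c)\}$ and $\mathrm{Span}\{(a\otimes b)\Delta(c)\}=\mathrm{Span}\{(a\otimes b)E\}$; (v) $(E\otimes1)(1\otimes E)=(1\otimes E)(E\otimes1)=(\Delta\otimes\mathrm{id})(E)=(\mathrm{id}\otimes\Delta)(E)$ in $M(A\otimes A\otimes A)$, where $\Delta\otimes\mathrm{id}$ and $\mathrm{id}\otimes\Delta$ are extended canonically to $M(A\otimes A)$ (sending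 $1$ to $E\otimes1$, resp. $1\otimes E$); (vi) for all $a,b,c\in A$: $(\varepsilon\otimes\mathrm{id})((1\otimes a)E(b\otimes c))=(\varepsilon\otimes\mathrm{id})(\Delta(a)(b\otimes c))$ and $(\varepsilon\otimes\mathrm{id})((a\otimes b)E(1\otimes c))=(\varepsilon\otimes\mathrm{id})((a\otimes b)\Delta(c))$. Fullness. $\Delta$ is full if $A$ is the smallest subspace $V$ with $\Delta(A)(1\otimes A)\subseteq V\otimes A$ and the smallest subspace $W$ with $(A\otimes1)\Delta(A)\subseteq A\otimes W$. Regular weak multiplier Hopf algebra. A regular weak multiplier bialgebra with $\Delta$ and $\Delta^{\mathrm{op}}$ full is a regular weak multiplier Hopf algebra if: (1) $T_1,T_4$ have image $E(A\otimes A)$ and $T_2,T_3$ have image $(A\otimes A)E$; (2) $\mathrm{Ker}(T_i)=(\mathrm{id}-G_i)(A\otimes A)$ for $i=1,\dots,4$, where the linear maps $G_i:A\otimes A\to A\otimes A$ are characterized by, for all $a,b,c\in A$, $(G_1\otimes\mathrm{id})(\Delta_{13}(a)(1\otimes b\otimes c))=\Delta_{13}(a)(1\otimes E)(1\otimes b\otimes c)$, $(\mathrm{id}\otimes G_2)((a\otimes b\otimes1)\Delta_{13}(c))=(a\otimes b\otimes1)(E\otimes1)\Delta_{13}(c)$, $(G_3\otimes\mathrm{id})((1\otimes b\otimes c)\Delta_{13}(a))=(1\otimes b\otimes c)(1\otimes E)\Delta_{13}(a)$, $(\mathrm{id}\otimes G_4)(\Delta_{13}(c)(a\otimes b\otimes1))=\Delta_{13}(c)(E\otimes1)(a\otimes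 b\otimes1)$ (leg numbering: $\Delta_{13}(a)$ is $\Delta(a)$ placed in tensor legs 1 and 3). *)

theory Defs
  imports Complex_Main
begin

section \<open>Complex vector spaces and (not necessarily unital) complex algebras\<close>

class complex_vector = ab_group_add +
  fixes scaleC :: "complex \<Rightarrow> 'a \<Rightarrow> 'a"  (infixr \<open>*\<^sub>C\<close> 75)
  assumes scaleC_add_right: "c *\<^sub>C (x + y) = c *\<^sub>C x + c *\<^sub>C y"
    and scaleC_add_left: "(c + d) *\<^sub>C x = c *\<^sub>C x + d *\<^sub>C x"
    and scaleC_scaleC: "c *\<^sub>C d *\<^sub>C x = (c * d) *\<^sub>C x"
    and scaleC_one: "1 *\<^sub>C x = x"

class complex_algebra = complex_vector + ring +
  assumes mult_scaleC_left: "(c *\<^sub>C x) * y = c *\<^sub>C (x * y)"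
    and mult_scaleC_right: "x * (c *\<^sub>C y) = c *\<^sub>C (x * y)"

instantiation complex :: complex_algebra
begin
definition scaleC_complex :: "complex \<Rightarrow> complex \<Rightarrow> complex" where
  "scaleC_complex c x = c * x"
instance
  by standard (simp_all add: scaleC_complex_def algebra_simps)
end

interpretation cvec: vector_space "scaleC :: complex \<Rightarrow> 'a \<Rightarrow> 'a::complex_vector"
  by unfold_locales (simp_all add: scaleC_add_right scaleC_add_left scaleC_scaleC scaleC_one)

interpretation cvec_pair: vector_space_pair
  "scaleC :: complex \<Rightarrow> 'a \<Rightarrow> 'a::complex_vector"
  "scaleC :: complex \<Rightarrow> 'b \<Rightarrow> 'b::complex_vector"
  by unfold_locales

abbreviation clinear :: "('a::complex_vector \<Rightarrow> 'b::complex_vector) \<Rightarrow> bool" where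
  "clinear \<equiv> Vector_Spaces.linear scaleC scaleC"

abbreviation csubspace :: "'a::complex_vector set \<Rightarrow> bool" where
  "csubspace \<equiv> module.subspace scaleC"

abbreviation cspan :: "'a::complex_vector set \<Rightarrow> 'a set" where
  "cspan \<equiv> module.span scaleC"

lemma clinear_iff:
  "clinear f \<longleftrightarrow> (\<forall>x y. f (x + y) = f x + f y) \<and> (\<forall>c x. f (c *\<^sub>C x) = c *\<^sub>C f x)"
  by (simp add: Vector_Spaces.linear_iff cvec.vector_space_axioms)

lemma clinear_add: "clinear f \<Longrightarrow> f (x + y) = f x + f y"
  and clinear_scaleC: "clinear f \<Longrightarrow> f (c *\<^sub>C x) = c *\<^sub>C f x"
  by (simp_all add: clinear_iff)

lemma clinear_0: "clinear f \<Longrightarrow> f 0 = 0"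
  by (rule cvec_pair.linear_0)

lemma clinear_minus: "clinear f \<Longrightarrow> f (- x) = - f x"
  by (rule cvec_pair.linear_neg)

definition cbilinear :: "('a::complex_vector \<Rightarrow> 'b::complex_vector \<Rightarrow> 'c::complex_vector) \<Rightarrow> bool" where
  "cbilinear f \<longleftrightarrow> (\<forall>b. clinear (\<lambda>a. f a b)) \<and> (\<forall>a. clinear (f a))"

lemma clinear_functionals_separate:
  fixes v :: "'a::complex_vector"
  assumes "\<And>\<psi> :: 'a \<Rightarrow> complex. clinear \<psi> \<Longrightarrow> \<psi> v = \<psi> w"
  shows "v = w"
proof (rule ccontr)
  assume "v \<noteq> w"
  hence "\<not> cvec.dependent {v - w}" by simp
  then obtain g :: "'a \<Rightarrow> complex" where g: "clinear g" "\<forall>x\<in>{v - w}. g x = 1"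
    using cvec_pair.linear_independent_extend[of "{v - w}" "\<lambda>_. 1 :: complex"] by auto
  have "g (v - w) = g v - g w" using cvec_pair.linear_diff[OF g(1)] .
  thus False using g assms[OF g(1)] by simp
qed


section \<open>Tensor products\<close>

text \<open>
  The tensor product of two vector spaces, realised as the space of all functionals on bilinear
  forms that are finite sums of evaluations. The universal property is proved below.
\<close>

definition eval_form :: "'a::complex_vector \<Rightarrow> 'b::complex_vector \<Rightarrow> ('a \<Rightarrow> 'b \<Rightarrow> complex) \<Rightarrow> complex" where
  "eval_form a b \<phi> = (if cbilinear \<phi> then \<phi> a b else 0)"

typedef (overloaded) ('a, 'b) tensor =
  "{t :: ('a::complex_vector \<Rightarrow> 'b::complex_vector \<Rightarrow> complex) \<Rightarrow> complex.
      \<exists>xs. t = (\<lambda>\<phi>. \<Sum>(a, b)\<leftarrow>xs. eval_form a b \<phi>)}"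
  by auto

setup_lifting type_definition_tensor

lift_definition pure_tensor :: "'a::complex_vector \<Rightarrow> 'b::complex_vector \<Rightarrow> ('a, 'b) tensor"
  (infixr \<open>\<otimes>\<close> 72) is "\<lambda>a b. eval_form a b"
proof -
  fix a :: 'a and b :: 'b
  show "\<exists>xs. eval_form a b = (\<lambda>\<phi>. \<Sum>(a, b)\<leftarrow>xs. eval_form a b \<phi>)"
    by (rule exI[of _ "[(a, b)]"]) simp
qed

lemma eval_form_scaleC: "eval_form (c *\<^sub>C a) b \<phi> = c * eval_form a b \<phi>"
  by (auto simp: eval_form_def cbilinear_def clinear_iff scaleC_complex_def)

instantiation tensor :: (complex_vector, complex_vector) complex_vector
begin

lift_definition zero_tensor :: "('a, 'b) tensor" is "\<lambda>_. 0"
  by (rule exI[of _ "[]"]) simp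

lift_definition plus_tensor :: "('a, 'b) tensor \<Rightarrow> ('a, 'b) tensor \<Rightarrow> ('a, 'b) tensor"
  is "\<lambda>s t \<phi>. s \<phi> + t \<phi>"
proof -
  fix s t :: "('a \<Rightarrow> 'b \<Rightarrow> complex) \<Rightarrow> complex"
  assume "\<exists>xs. s = (\<lambda>\<phi>. \<Sum>(a, b)\<leftarrow>xs. eval_form a b \<phi>)"
    "\<exists>xs. t = (\<lambda>\<phi>. \<Sum>(a, b)\<leftarrow>xs. eval_form a b \<phi>)"
  then obtain xs ys where "s = (\<lambda>\<phi>. \<Sum>(a, b)\<leftarrow>xs. eval_form a b \<phi>)"
    "t = (\<lambda>\<phi>. \<Sum>(a, b)\<leftarrow>ys. eval_form a b \<phi>)" by blast
  thus "\<exists>xs. (\<lambda>\<phi>. s \<phi> + t \<phi>) = (\<lambda>\<phi>. \<Sum>(a, b)\<leftarrow>xs. eval_form a b \<phi>)"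
    by (intro exI[of _ "xs @ ys"]) simp
qed

lemma scale_sum_eval_form:
  "(\<lambda>\<phi>. c * (\<Sum>(a, b)\<leftarrow>xs. eval_form a b \<phi>)) =
    (\<lambda>\<phi>. \<Sum>(a, b)\<leftarrow>map (\<lambda>(a, b). (c *\<^sub>C a, b)) xs. eval_form a b \<phi>)"
  by (induction xs) (auto simp: eval_form_scaleC fun_eq_iff distrib_left)

lift_definition scaleC_tensor :: "complex \<Rightarrow> ('a, 'b) tensor \<Rightarrow> ('a, 'b) tensor"
  is "\<lambda>c t \<phi>. c * t \<phi>"
  using scale_sum_eval_form by metis

lift_definition uminus_tensor :: "('a, 'b) tensor \<Rightarrow> ('a, 'b) tensor" is "\<lambda>t \<phi>. - t \<phi>"
proof -
  fix t :: "('a \<Rightarrow> 'b \<Rightarrow> complex) \<Rightarrow> complex"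
  assume "\<exists>xs. t = (\<lambda>\<phi>. \<Sum>(a, b)\<leftarrow>xs. eval_form a b \<phi>)"
  then obtain xs where t: "t = (\<lambda>\<phi>. \<Sum>(a, b)\<leftarrow>xs. eval_form a b \<phi>)" by blast
  have "(\<lambda>\<phi>. - t \<phi>) = (\<lambda>\<phi>. (-1) * (\<Sum>(a, b)\<leftarrow>xs. eval_form a b \<phi>))"
    unfolding t by (simp only: mult_minus1)
  also note scale_sum_eval_form
  finally show "\<exists>xs. (\<lambda>\<phi>. - t \<phi>) = (\<lambda>\<phi>. \<Sum>(a, b)\<leftarrow>xs. eval_form a b \<phi>)"
    by (rule exI)
qed

definition minus_tensor :: "('a, 'b) tensor \<Rightarrow> ('a, 'b) tensor \<Rightarrow> ('a, 'b) tensor" where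
  "minus_tensor s t = s + - t"

instance
proof
  fix a b c :: "('a, 'b) tensor" and x y :: complex
  show "a + b + c = a + (b + c)" by transfer (simp add: add.assoc)
  show "a + b = b + a" by transfer (simp add: add.commute)
  show "0 + a = a" by transfer simp
  show "- a + a = 0" by transfer simp
  show "a - b = a + - b" by (simp add: minus_tensor_def)
  show "x *\<^sub>C (a + b) = x *\<^sub>C a + x *\<^sub>C b" by transfer (simp add: distrib_left)
  show "(x + y) *\<^sub>C a = x *\<^sub>C a + y *\<^sub>C a" by transfer (simp add: distrib_right)
  show "x *\<^sub>C y *\<^sub>C a = (x * y) *\<^sub>C a" by transfer (simp add: mult.assoc)
  show "1 *\<^sub>C a = a" by transfer simp
qed

end

lemma cbilinear_pure_tensor: "cbilinear (\<otimes>)"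
  unfolding cbilinear_def clinear_iff
  by (intro conjI allI; transfer)
     (auto simp: eval_form_def fun_eq_iff cbilinear_def clinear_iff scaleC_complex_def)

lemma pure_tensor_bilinear:
  "(a + a') \<otimes> b = a \<otimes> b + a' \<otimes> b" "a \<otimes> (b + b') = a \<otimes> b + a \<otimes> b'"
  "(c *\<^sub>C a) \<otimes> b = c *\<^sub>C (a \<otimes> b)" "a \<otimes> (c *\<^sub>C b) = c *\<^sub>C (a \<otimes> b)"
  using cbilinear_pure_tensor unfolding cbilinear_def clinear_iff by blast+

lemma Rep_tensor_sum_list:
  "Rep_tensor (\<Sum>(a, b)\<leftarrow>xs. a \<otimes> b) = (\<lambda>\<phi>. \<Sum>(a, b)\<leftarrow>xs. eval_form a b \<phi>)"
  by (induction xs) (auto simp: zero_tensor.rep_eq plus_tensor.rep_eq pure_tensor.rep_eq)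

lemma tensor_is_sum: "\<exists>xs. t = (\<Sum>(a, b)\<leftarrow>xs. a \<otimes> b)"
proof -
  obtain xs where "Rep_tensor t = (\<lambda>\<phi>. \<Sum>(a, b)\<leftarrow>xs. eval_form a b \<phi>)"
    using Rep_tensor[of t] by auto
  hence "Rep_tensor t = Rep_tensor (\<Sum>(a, b)\<leftarrow>xs. a \<otimes> b)" by (simp only: Rep_tensor_sum_list)
  hence "t = (\<Sum>(a, b)\<leftarrow>xs. a \<otimes> b)" by (simp only: Rep_tensor_inject)
  thus ?thesis ..
qed

lemma tensor_induct [case_names pure add]:
  assumes "\<And>a b. P (a \<otimes> b)" "\<And>x y. P x \<Longrightarrow> P y \<Longrightarrow> P (x + y)"
  shows "P t"
proof -
  obtain xs where t: "t = (\<Sum>(a, b)\<leftarrow>xs. a \<otimes> b)" using tensor_is_sum by blast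
  have 0: "(0::('a,'b) tensor) = 0 \<otimes> 0"
    using pure_tensor_bilinear(3)[of 0 "0::'a" "0::'b"] by simp
  have "P (\<Sum>(a, b)\<leftarrow>xs. a \<otimes> b)"
    by (induction xs) (use assms in \<open>auto simp: 0\<close>)
  thus ?thesis by (simp add: t)
qed

lemma clinear_sum_list: "clinear g \<Longrightarrow> g (\<Sum>x\<leftarrow>xs. h x) = (\<Sum>x\<leftarrow>xs. g (h x))"
  by (induction xs) (simp_all add: clinear_0 clinear_add)

lemma clinear_tensor_eqI:
  assumes "clinear f" "clinear g" "\<And>a b. f (a \<otimes> b) = g (a \<otimes> b)"
  shows "f = g"
proof
  fix t show "f t = g t"
    by (induction t rule: tensor_induct) (use assms in \<open>auto simp: clinear_add\<close>)
qed

theorem tensor_universal: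
  assumes f: "cbilinear f"
  shows "\<exists>!g. clinear g \<and> (\<forall>a b. g (a \<otimes> b) = f a b)"
proof -
  have wd: "(\<Sum>(a, b)\<leftarrow>xs. f a b) = (\<Sum>(a, b)\<leftarrow>ys. f a b)"
    if eq: "(\<Sum>(a, b)\<leftarrow>xs. a \<otimes> b) = (\<Sum>(a, b)\<leftarrow>ys. a \<otimes> b)" for xs ys
  proof (rule clinear_functionals_separate)
    fix \<psi> :: "'c \<Rightarrow> complex" assume \<psi>: "clinear \<psi>"
    define \<phi> where "\<phi> = (\<lambda>a b. \<psi> (f a b))"
    have "cbilinear \<phi>"
      using f \<psi> unfolding cbilinear_def clinear_iff \<phi>_def by auto
    hence *: "\<psi> (\<Sum>(a, b)\<leftarrow>zs. f a b) = Rep_tensor (\<Sum>(a, b)\<leftarrow>zs. a \<otimes> b) \<phi>" for zs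
      unfolding Rep_tensor_sum_list
      by (induction zs) (auto simp: clinear_0[OF \<psi>] clinear_add[OF \<psi>] eval_form_def \<phi>_def)
    show "\<psi> (\<Sum>(a, b)\<leftarrow>xs. f a b) = \<psi> (\<Sum>(a, b)\<leftarrow>ys. f a b)"
      unfolding * eq ..
  qed
  define r where "r t = (SOME xs. t = (\<Sum>(a, b)\<leftarrow>xs. a \<otimes> b))" for t :: "('a, 'b) tensor"
  have r: "(\<Sum>(a, b)\<leftarrow>r t. a \<otimes> b) = t" for t
    unfolding r_def using someI_ex[OF tensor_is_sum[of t]] by simp
  define g where "g t = (\<Sum>(a, b)\<leftarrow>r t. f a b)" for t
  have g: "g (\<Sum>(a, b)\<leftarrow>xs. a \<otimes> b) = (\<Sum>(a, b)\<leftarrow>xs. f a b)" for xs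
    unfolding g_def by (rule wd) (rule r)
  have scal: "(\<Sum>(a, b)\<leftarrow>map (\<lambda>(a, b). (c *\<^sub>C a, b)) xs. h a b) = c *\<^sub>C (\<Sum>(a, b)\<leftarrow>xs. h a b)"
    if "cbilinear h" for h :: "'a \<Rightarrow> 'b \<Rightarrow> 'd::complex_vector" and c xs
    using that by (induction xs) (auto simp: cbilinear_def clinear_iff scaleC_add_right)
  have "clinear g"
    unfolding clinear_iff
  proof (intro conjI allI)
    fix s t
    have "s + t = (\<Sum>(a, b)\<leftarrow>r s @ r t. a \<otimes> b)" by (simp add: r)
    hence "g (s + t) = (\<Sum>(a, b)\<leftarrow>r s @ r t. f a b)" by (simp only: g)
    thus "g (s + t) = g s + g t" by (simp add: g_def)
  next
    fix c t
    have "c *\<^sub>C t = (\<Sum>(a, b)\<leftarrow>map (\<lambda>(a, b). (c *\<^sub>C a, b)) (r t). a \<otimes> b)"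
      by (subst scal[OF cbilinear_pure_tensor]) (simp add: r)
    hence "g (c *\<^sub>C t) = (\<Sum>(a, b)\<leftarrow>map (\<lambda>(a, b). (c *\<^sub>C a, b)) (r t). f a b)" by (simp only: g)
    also have "\<dots> = c *\<^sub>C g t" unfolding g_def by (rule scal[OF f])
    finally show "g (c *\<^sub>C t) = c *\<^sub>C g t" .
  qed
  moreover have "g (a \<otimes> b) = f a b" for a b
    using g[of "[(a, b)]"] by simp
  ultimately show ?thesis
    by (intro ex1I[of _ g]) (auto intro!: clinear_tensor_eqI)
qed

definition tensor_lift ::
  "('a::complex_vector \<Rightarrow> 'b::complex_vector \<Rightarrow> 'c::complex_vector) \<Rightarrow> ('a, 'b) tensor \<Rightarrow> 'c" where
  "tensor_lift f = (THE g. clinear g \<and> (\<forall>a b. g (a \<otimes> b) = f a b))"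

lemma
  assumes "cbilinear f"
  shows clinear_tensor_lift: "clinear (tensor_lift f)"
    and tensor_lift_pure: "tensor_lift f (a \<otimes> b) = f a b"
  using theI'[OF tensor_universal[OF assms]] unfolding tensor_lift_def by blast+

definition tensor_map :: "('a::complex_vector \<Rightarrow> 'c::complex_vector) \<Rightarrow>
    ('b::complex_vector \<Rightarrow> 'd::complex_vector) \<Rightarrow> ('a, 'b) tensor \<Rightarrow> ('c, 'd) tensor" where
  "tensor_map f g = tensor_lift (\<lambda>a b. f a \<otimes> g b)"

lemma
  assumes "clinear f" "clinear g"
  shows clinear_tensor_map: "clinear (tensor_map f g)"
    and tensor_map_pure: "tensor_map f g (a \<otimes> b) = f a \<otimes> g b"
proof -
  have "cbilinear (\<lambda>a b. f a \<otimes> g b)"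
    using assms by (simp add: cbilinear_def clinear_iff pure_tensor_bilinear)
  thus "clinear (tensor_map f g)" "tensor_map f g (a \<otimes> b) = f a \<otimes> g b"
    unfolding tensor_map_def by (simp_all add: clinear_tensor_lift tensor_lift_pure)
qed

definition tensor_subspace :: "'a::complex_vector set \<Rightarrow> 'b::complex_vector set \<Rightarrow> ('a, 'b) tensor set" where
  "tensor_subspace V W = cspan {v \<otimes> w | v w. v \<in> V \<and> w \<in> W}"

definition tensor_flip :: "('a::complex_vector, 'b::complex_vector) tensor \<Rightarrow> ('b, 'a) tensor" where
  "tensor_flip = tensor_lift (\<lambda>a b. b \<otimes> a)"

definition tensor_assoc :: "(('a::complex_vector, 'b::complex_vector) tensor, 'c::complex_vector) tensor
    \<Rightarrow> ('a, ('b, 'c) tensor) tensor" where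
  "tensor_assoc = tensor_lift (\<lambda>x c. tensor_lift (\<lambda>a b. a \<otimes> b \<otimes> c) x)"

definition tensor_swap23 :: "(('a::complex_vector, 'c::complex_vector) tensor, 'b::complex_vector) tensor
    \<Rightarrow> ('a, ('b, 'c) tensor) tensor" where
  "tensor_swap23 = tensor_map id tensor_flip \<circ> tensor_assoc"

text \<open>Slice maps: id \<open>\<otimes>\<close> \<open>\<omega>\<close> and \<open>\<omega>\<close> \<open>\<otimes>\<close> id.\<close>

definition slice_right :: "('b::complex_vector \<Rightarrow> complex) \<Rightarrow> ('a::complex_vector, 'b) tensor \<Rightarrow> 'a" where
  "slice_right \<omega> = tensor_lift (\<lambda>a b. \<omega> b *\<^sub>C a)"

definition slice_left :: "('a::complex_vector \<Rightarrow> complex) \<Rightarrow> ('a, 'b::complex_vector) tensor \<Rightarrow> 'b" where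
  "slice_left \<omega> = tensor_lift (\<lambda>a b. \<omega> a *\<^sub>C b)"

instantiation tensor :: (complex_algebra, complex_algebra) complex_algebra
begin

definition times_tensor :: "('a, 'b) tensor \<Rightarrow> ('a, 'b) tensor \<Rightarrow> ('a, 'b) tensor" where
  "x * y = tensor_lift (\<lambda>a b. tensor_map ((*) a) ((*) b) y) x"

lemma clinear_mult_left: "clinear ((*) (a :: 'c::complex_algebra))"
  and clinear_mult_right: "clinear (\<lambda>b :: 'c. b * a)"
  by (simp_all add: clinear_iff algebra_simps mult_scaleC_left mult_scaleC_right)

lemmas mult_map_linear = clinear_tensor_map[OF clinear_mult_left clinear_mult_left]
lemmas mult_map_pure = tensor_map_pure[OF clinear_mult_left clinear_mult_left]
lemmas mult_map_add = clinear_add[OF mult_map_linear]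
lemmas mult_map_scaleC = clinear_scaleC[OF mult_map_linear]

lemma tensor_map_times_bilinear:
  "tensor_map ((*) (a + a')) ((*) b) y = tensor_map ((*) a) ((*) b) y + tensor_map ((*) a') ((*) b) y"
  "tensor_map ((*) a) ((*) (b + b')) y = tensor_map ((*) a) ((*) b) y + tensor_map ((*) a) ((*) b') y"
  "tensor_map ((*) (c *\<^sub>C a)) ((*) b) y = c *\<^sub>C tensor_map ((*) a) ((*) b) y"
  "tensor_map ((*) a) ((*) (c *\<^sub>C b)) y = c *\<^sub>C tensor_map ((*) a) ((*) b) y"
  for a a' :: "'c::complex_algebra" and b b' :: "'d::complex_algebra"
  by (induction y rule: tensor_induct)
     ((simp only: mult_map_pure, simp add: distrib_right mult_scaleC_left pure_tensor_bilinear)+,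
      (simp only: mult_map_add scaleC_add_right add_ac)+)

lemma cbilinear_tensor_map_times:
  "cbilinear (\<lambda>(a :: 'c::complex_algebra) (b :: 'd::complex_algebra). tensor_map ((*) a) ((*) b) y)"
  by (simp add: cbilinear_def clinear_iff tensor_map_times_bilinear)

lemma clinear_times_tensor_left: "clinear (\<lambda>x :: ('a, 'b) tensor. x * y)"
  unfolding times_tensor_def by (rule clinear_tensor_lift[OF cbilinear_tensor_map_times])

lemma pure_times_tensor: "(a \<otimes> b) * (y :: ('a, 'b) tensor) = tensor_map ((*) a) ((*) b) y"
  unfolding times_tensor_def by (rule tensor_lift_pure[OF cbilinear_tensor_map_times])

lemma clinear_times_tensor_right: "clinear ((*) (x :: ('a, 'b) tensor))"
  unfolding clinear_iff
  by (induction x rule: tensor_induct)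
     (simp_all add: pure_times_tensor mult_map_add mult_map_scaleC
       clinear_add[OF clinear_times_tensor_left] add_ac scaleC_add_right)

lemma pure_times_pure: "(a \<otimes> b) * (c \<otimes> d :: ('a, 'b) tensor) = (a * c) \<otimes> (b * d)"
  by (simp only: pure_times_tensor mult_map_pure)

instance
proof
  fix x y z :: "('a, 'b) tensor" and c :: complex
  note lin = clinear_add[OF clinear_times_tensor_left] clinear_add[OF clinear_times_tensor_right]
  show "(x + y) * z = x * z + y * z" "x * (y + z) = x * y + x * z"
    by (simp_all add: lin)
  show "(c *\<^sub>C x) * y = c *\<^sub>C (x * y)" "x * (c *\<^sub>C y) = c *\<^sub>C (x * y)"
    by (simp_all add: clinear_scaleC[OF clinear_times_tensor_left]
        clinear_scaleC[OF clinear_times_tensor_right])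
  show "x * y * z = x * (y * z)"
  proof (induction x rule: tensor_induct)
    case (pure a b)
    show ?case
    proof (induction y rule: tensor_induct)
      case (pure a' b')
      show ?case
        by (induction z rule: tensor_induct) (simp_all add: pure_times_pure mult.assoc lin)
    qed (simp add: lin)
  qed (simp add: lin)
qed

end


section \<open>Multiplier algebras\<close>

typedef (overloaded) 'a multiplier =
  "{(l, r). clinear l \<and> clinear r \<and> (\<forall>a b :: 'a::complex_algebra. a * l b = r a * b)}"
  by (rule exI[of _ "(id, id)"]) (simp add: clinear_iff)

setup_lifting type_definition_multiplier

text \<open>\<open>m \<rhd> a\<close> is \<open>ma\<close> and \<open>a \<lhd> m\<close> is \<open>am\<close>.\<close>

lift_definition mult_left :: "'a::complex_algebra multiplier \<Rightarrow> 'a \<Rightarrow> 'a"  (infixr \<open>\<rhd>\<close> 71) is fst .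

lift_definition mult_right :: "'a::complex_algebra \<Rightarrow> 'a multiplier \<Rightarrow> 'a"  (infixl \<open>\<lhd>\<close> 71)
  is "\<lambda>a m. snd m a" .

lemma multiplier_eqI: "(\<And>a. m \<rhd> a = n \<rhd> a) \<Longrightarrow> (\<And>a. a \<lhd> m = a \<lhd> n) \<Longrightarrow> m = n"
  by transfer (auto simp: prod_eq_iff fun_eq_iff)

lemma multiplier_props:
  "clinear (mult_left m)" "clinear (\<lambda>a. a \<lhd> m)" "a * (m \<rhd> b) = (a \<lhd> m) * b"
  by (transfer, auto simp: case_prod_unfold)+

instantiation multiplier :: (complex_algebra) "{complex_algebra, monoid_mult}"
begin

lift_definition zero_multiplier :: "'a multiplier" is "(\<lambda>_. 0, \<lambda>_. 0)"
  by (auto simp: clinear_iff)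

lift_definition one_multiplier :: "'a multiplier" is "(id, id)"
  by (auto simp: clinear_iff)

lift_definition plus_multiplier :: "'a multiplier \<Rightarrow> 'a multiplier \<Rightarrow> 'a multiplier"
  is "\<lambda>(l, r) (l', r'). (\<lambda>a. l a + l' a, \<lambda>a. r a + r' a)"
  by (auto simp: clinear_iff algebra_simps scaleC_add_right)

lift_definition uminus_multiplier :: "'a multiplier \<Rightarrow> 'a multiplier"
  is "\<lambda>(l, r). (\<lambda>a. - l a, \<lambda>a. - r a)"
  by (auto simp: clinear_iff)

lift_definition minus_multiplier :: "'a multiplier \<Rightarrow> 'a multiplier \<Rightarrow> 'a multiplier"
  is "\<lambda>(l, r) (l', r'). (\<lambda>a. l a - l' a, \<lambda>a. r a - r' a)"
  by (auto simp: clinear_iff algebra_simps cvec.scale_right_diff_distrib)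

lift_definition scaleC_multiplier :: "complex \<Rightarrow> 'a multiplier \<Rightarrow> 'a multiplier"
  is "\<lambda>c (l, r). (\<lambda>a. c *\<^sub>C l a, \<lambda>a. c *\<^sub>C r a)"
  by (auto simp: clinear_iff scaleC_add_right mult_scaleC_left mult_scaleC_right
      scaleC_scaleC mult.commute)

lift_definition times_multiplier :: "'a multiplier \<Rightarrow> 'a multiplier \<Rightarrow> 'a multiplier"
  is "\<lambda>(l, r) (l', r'). (l \<circ> l', r' \<circ> r)"
  by (auto simp: clinear_iff)

instance
  by standard
    (transfer; auto simp: clinear_iff algebra_simps scaleC_add_right scaleC_add_left
      scaleC_scaleC scaleC_one fun_eq_iff)+

end

lift_definition of_alg :: "'a::complex_algebra \<Rightarrow> 'a multiplier" is "\<lambda>a. ((*) a, \<lambda>b. b * a)"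
  by (auto simp: clinear_iff algebra_simps mult_scaleC_left mult_scaleC_right)

text \<open>
  The canonical map \<open>of_alg\<close> is injective on non-degenerate algebras, which are thus viewed as
  subsets of their multiplier algebras; \<open>to_alg\<close> is only meaningful on the range of \<open>of_alg\<close>.
\<close>

definition to_alg :: "'a::complex_algebra multiplier \<Rightarrow> 'a" where
  "to_alg m = (THE a. of_alg a = m)"

lift_definition mult_tensor ::
  "'a::complex_algebra multiplier \<Rightarrow> 'b::complex_algebra multiplier \<Rightarrow> ('a, 'b) tensor multiplier"
  (infixr \<open>\<otimes>\<^sub>m\<close> 72)
  is "\<lambda>(l, r) (l', r'). (tensor_map l l', tensor_map r r')"
proof -
  fix p :: "('a \<Rightarrow> 'a) \<times> ('a \<Rightarrow> 'a)" and q :: "('b \<Rightarrow> 'b) \<times> ('b \<Rightarrow> 'b)"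
  assume "p \<in> {(l, r). clinear l \<and> clinear r \<and> (\<forall>a b. a * l b = r a * b)}"
    "q \<in> {(l, r). clinear l \<and> clinear r \<and> (\<forall>a b. a * l b = r a * b)}"
  then obtain l r l' r' where pq: "p = (l, r)" "q = (l', r')"
    and lin: "clinear l" "clinear r" "clinear l'" "clinear r'"
    and eq: "\<And>a b. a * l b = r a * b" "\<And>a b. a * l' b = r' a * b" by blast
  note L = clinear_tensor_map[OF lin(1,3)] and R = clinear_tensor_map[OF lin(2,4)]
  have "x * tensor_map l l' y = tensor_map r r' x * y" for x y
  proof (induction x rule: tensor_induct)
    case (pure a b)
    show ?case
      by (induction y rule: tensor_induct)
         (simp_all only: tensor_map_pure[OF lin(1,3)] tensor_map_pure[OF lin(2,4)]
           pure_times_pure eq clinear_add[OF L] distrib_left)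
  qed (simp only: clinear_add[OF R] distrib_right)
  thus "(case p of (l, r) \<Rightarrow> \<lambda>(l', r'). (tensor_map l l', tensor_map r r')) q
      \<in> {(l, r). clinear l \<and> clinear r \<and> (\<forall>a b. a * l b = r a * b)}"
    using L R by (simp add: pq)
qed

lemma mult_tensor_actions:
  "(m \<otimes>\<^sub>m n) \<rhd> x = tensor_map (mult_left m) (mult_left n) x"
  "x \<lhd> (m \<otimes>\<^sub>m n) = tensor_map (\<lambda>a. a \<lhd> m) (\<lambda>b. b \<lhd> n) x"
  by (simp_all add: mult_left.rep_eq mult_right.rep_eq mult_tensor.rep_eq case_prod_unfold)

lemma mult_tensor_pure:
  "(m \<otimes>\<^sub>m n) \<rhd> (a \<otimes> b) = (m \<rhd> a) \<otimes> (n \<rhd> b)" "(a \<otimes> b) \<lhd> (m \<otimes>\<^sub>m n) = (a \<lhd> m) \<otimes> (b \<lhd> n)"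
  by (simp_all only: mult_tensor_actions tensor_map_pure[OF multiplier_props(1) multiplier_props(1)]
      tensor_map_pure[OF multiplier_props(2) multiplier_props(2)])

definition mult_transport :: "('a \<Rightarrow> 'b) \<Rightarrow> 'a::complex_algebra multiplier \<Rightarrow> 'b::complex_algebra multiplier" where
  "mult_transport \<phi> m = Abs_multiplier (\<lambda>b. \<phi> (m \<rhd> inv \<phi> b), \<lambda>b. \<phi> (inv \<phi> b \<lhd> m))"

definition algebra_iso :: "('a::complex_algebra \<Rightarrow> 'b::complex_algebra) \<Rightarrow> bool" where
  "algebra_iso \<phi> \<longleftrightarrow> bij \<phi> \<and> clinear \<phi> \<and> (\<forall>a b. \<phi> (a * b) = \<phi> a * \<phi> b)"

lemma mult_transport_actions:
  assumes "algebra_iso \<phi>"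
  shows "mult_transport \<phi> m \<rhd> \<phi> a = \<phi> (m \<rhd> a)" "\<phi> a \<lhd> mult_transport \<phi> m = \<phi> (a \<lhd> m)"
proof -
  have inj: "inv \<phi> (\<phi> a) = a" and surj: "\<phi> (inv \<phi> b) = b" for a b
    using assms unfolding algebra_iso_def by (simp_all add: bij_is_inj bij_is_surj surj_f_inv_f)
  have lin: "clinear \<phi>" and mul: "\<And>a b. \<phi> (a * b) = \<phi> a * \<phi> b"
    using assms unfolding algebra_iso_def by simp_all
  have "clinear (inv \<phi>)"
    unfolding clinear_iff
  proof (intro conjI allI)
    fix x y c
    have "inv \<phi> (\<phi> (inv \<phi> x + inv \<phi> y)) = inv \<phi> x + inv \<phi> y"
      "inv \<phi> (\<phi> (c *\<^sub>C inv \<phi> x)) = c *\<^sub>C inv \<phi> x" by (rule inj)+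
    thus "inv \<phi> (x + y) = inv \<phi> x + inv \<phi> y" "inv \<phi> (c *\<^sub>C x) = c *\<^sub>C inv \<phi> x"
      by (simp_all only: clinear_add[OF lin] clinear_scaleC[OF lin] surj)
  qed
  hence "clinear (\<lambda>b. \<phi> (m \<rhd> inv \<phi> b))" "clinear (\<lambda>b. \<phi> (inv \<phi> b \<lhd> m))"
    using lin multiplier_props(1,2)[of m] by (simp_all add: clinear_iff)
  moreover have "a * \<phi> (m \<rhd> inv \<phi> b) = \<phi> (inv \<phi> a \<lhd> m) * b" for a b
  proof -
    have "\<phi> (inv \<phi> a * (m \<rhd> inv \<phi> b)) = \<phi> ((inv \<phi> a \<lhd> m) * inv \<phi> b)"
      by (simp only: multiplier_props(3))
    thus ?thesis by (simp only: mul surj)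
  qed
  ultimately have "Rep_multiplier (mult_transport \<phi> m) =
      (\<lambda>b. \<phi> (m \<rhd> inv \<phi> b), \<lambda>b. \<phi> (inv \<phi> b \<lhd> m))"
    unfolding mult_transport_def by (subst Abs_multiplier_inverse) auto
  thus "mult_transport \<phi> m \<rhd> \<phi> a = \<phi> (m \<rhd> a)" "\<phi> a \<lhd> mult_transport \<phi> m = \<phi> (a \<lhd> m)"
    by (simp_all add: mult_left.rep_eq mult_right.rep_eq inj)
qed

lemma
  fixes a :: "'a::complex_vector" and b :: "'b::complex_vector"
  shows tensor_flip_pure: "tensor_flip (a \<otimes> b) = b \<otimes> a"
    and clinear_tensor_flip: "clinear (tensor_flip :: ('a, 'b) tensor \<Rightarrow> _)"
proof -
  have "cbilinear (\<lambda>(a :: 'a) (b :: 'b). b \<otimes> a)"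
    by (simp add: cbilinear_def clinear_iff pure_tensor_bilinear)
  thus "tensor_flip (a \<otimes> b) = b \<otimes> a" "clinear (tensor_flip :: ('a, 'b) tensor \<Rightarrow> _)"
    unfolding tensor_flip_def by (simp_all add: clinear_tensor_lift tensor_lift_pure)
qed

lemma
  fixes a :: "'a::complex_vector" and b :: "'b::complex_vector" and c :: "'c::complex_vector"
  shows tensor_assoc_pure: "tensor_assoc ((a \<otimes> b) \<otimes> c) = a \<otimes> b \<otimes> c"
    and clinear_tensor_assoc: "clinear (tensor_assoc :: (('a, 'b) tensor, 'c) tensor \<Rightarrow> _)"
proof -
  have *: "cbilinear (\<lambda>(a :: 'a) (b :: 'b). a \<otimes> b \<otimes> c)" for c :: 'c
    by (simp add: cbilinear_def clinear_iff pure_tensor_bilinear)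
  have "tensor_lift (\<lambda>a b. a \<otimes> b \<otimes> (c + c')) x =
      tensor_lift (\<lambda>a b. a \<otimes> b \<otimes> c) x + tensor_lift (\<lambda>a b. a \<otimes> b \<otimes> c') x"
    and "tensor_lift (\<lambda>a b. a \<otimes> b \<otimes> (k *\<^sub>C c)) x = k *\<^sub>C tensor_lift (\<lambda>a b. a \<otimes> b \<otimes> c) x"
    for x :: "('a, 'b) tensor" and c c' :: 'c and k
    by (induction x rule: tensor_induct)
       ((simp only: tensor_lift_pure[OF *], simp only: pure_tensor_bilinear)+,
        (simp only: clinear_add[OF clinear_tensor_lift[OF *]] scaleC_add_right add_ac)+)
  hence "cbilinear (\<lambda>x (c :: 'c). tensor_lift (\<lambda>(a :: 'a) (b :: 'b). a \<otimes> b \<otimes> c) x)"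
    using clinear_tensor_lift[OF *] by (simp add: cbilinear_def clinear_iff)
  thus "tensor_assoc ((a \<otimes> b) \<otimes> c) = a \<otimes> b \<otimes> c"
    "clinear (tensor_assoc :: (('a, 'b) tensor, 'c) tensor \<Rightarrow> _)"
    unfolding tensor_assoc_def by (simp_all add: clinear_tensor_lift tensor_lift_pure *)
qed

lemma tensor_flip_flip: "tensor_flip (tensor_flip x) = x"
  by (induction x rule: tensor_induct)
     (simp_all add: tensor_flip_pure clinear_add[OF clinear_tensor_flip])

lemma clinear_id: "clinear id"
  by (simp add: clinear_iff)

lemma map_id_flip_pure: "tensor_map id tensor_flip (a \<otimes> b) = a \<otimes> tensor_flip b"
  using tensor_map_pure[OF clinear_id clinear_tensor_flip, of a b] by simp

lemmas map_id_flip_add = clinear_add[OF clinear_tensor_map[OF clinear_id clinear_tensor_flip]]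

lemma tensor_map_flip_flip: "tensor_map id tensor_flip (tensor_map id tensor_flip x) = x"
  by (induction x rule: tensor_induct)
     (simp_all only: map_id_flip_pure map_id_flip_add tensor_flip_flip)

lemma algebra_iso_comp:
  assumes "algebra_iso \<phi>" "algebra_iso \<psi>"
  shows "algebra_iso (\<psi> \<circ> \<phi>)"
  using assms unfolding algebra_iso_def by (auto simp: clinear_iff intro: bij_comp)

lemma algebra_iso_flip: "algebra_iso (tensor_flip :: ('a::complex_algebra, 'b::complex_algebra) tensor \<Rightarrow> _)"
proof -
  note lin = clinear_add[OF clinear_tensor_flip]
  have "bij (tensor_flip :: ('a, 'b) tensor \<Rightarrow> _)"
    by (intro o_bij[of tensor_flip]) (simp_all add: fun_eq_iff tensor_flip_flip)
  moreover have "tensor_flip (x * y) = tensor_flip x * tensor_flip y" for x y :: "('a, 'b) tensor"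
  proof (induction x rule: tensor_induct)
    case (pure a b)
    show ?case
      by (induction y rule: tensor_induct)
         (simp_all add: tensor_flip_pure pure_times_pure lin distrib_left)
  qed (simp add: lin distrib_right)
  ultimately show ?thesis by (simp add: algebra_iso_def clinear_tensor_flip)
qed

lemma tensor_flip_times: "tensor_flip (x * y) = tensor_flip x * tensor_flip y"
  using algebra_iso_flip unfolding algebra_iso_def by blast

lemma algebra_iso_assoc:
  "algebra_iso (tensor_assoc ::
    (('a::complex_algebra, 'b::complex_algebra) tensor, 'c::complex_algebra) tensor \<Rightarrow> _)"
proof -
  note lin = clinear_add[OF clinear_tensor_assoc] clinear_add[OF clinear_tensor_flip]
  define \<beta> :: "('a, ('b, 'c) tensor) tensor \<Rightarrow> (('a, 'b) tensor, 'c) tensor" where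
    "\<beta> x = tensor_flip (tensor_map id tensor_flip (tensor_assoc
       (tensor_flip (tensor_map id tensor_flip x))))" for x
  note map = map_id_flip_pure map_id_flip_add
  have \<beta>_lin: "\<beta> (x + y) = \<beta> x + \<beta> y" for x y
    by (simp only: \<beta>_def lin map)
  have \<beta>_pure: "\<beta> (a \<otimes> b \<otimes> c) = (a \<otimes> b) \<otimes> c" for a b c
    by (simp only: \<beta>_def map tensor_flip_pure tensor_assoc_pure)
  have "\<beta> (tensor_assoc x) = x" for x
  proof (induction x rule: tensor_induct)
    case (pure y c)
    show ?case
      by (induction y rule: tensor_induct)
         (simp_all add: tensor_assoc_pure \<beta>_pure pure_tensor_bilinear lin \<beta>_lin)
  qed (simp add: lin \<beta>_lin)
  moreover have "tensor_assoc (\<beta> x) = x" for x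
  proof (induction x rule: tensor_induct)
    case (pure a y)
    show ?case
      by (induction y rule: tensor_induct)
         (simp_all add: tensor_assoc_pure \<beta>_pure pure_tensor_bilinear lin \<beta>_lin)
  qed (simp add: lin \<beta>_lin)
  ultimately have "bij (tensor_assoc :: (('a, 'b) tensor, 'c) tensor \<Rightarrow> _)"
    by (intro o_bij[of \<beta>]) (simp_all add: fun_eq_iff)
  moreover have "tensor_assoc (x * y) = tensor_assoc x * tensor_assoc y"
    for x y :: "(('a, 'b) tensor, 'c) tensor"
  proof (induction x rule: tensor_induct)
    case x: (pure x' c)
    show ?case
    proof (induction y rule: tensor_induct)
      case y: (pure y' c')
      show ?case
      proof (induction x' rule: tensor_induct)
        case (pure a b)
        show ?case
          by (induction y' rule: tensor_induct)
             (simp_all add: tensor_assoc_pure pure_times_pure lin distrib_left pure_tensor_bilinear)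
      qed (simp add: lin distrib_right pure_tensor_bilinear)
    qed (simp add: lin distrib_left)
  qed (simp add: lin distrib_right)
  ultimately show ?thesis by (simp add: algebra_iso_def clinear_tensor_assoc)
qed

lemma tensor_swap23_pure: "tensor_swap23 ((a \<otimes> c) \<otimes> b) = a \<otimes> b \<otimes> c"
  by (simp add: tensor_swap23_def tensor_assoc_pure map_id_flip_pure tensor_flip_pure)

lemma algebra_iso_swap23:
  "algebra_iso (tensor_swap23 ::
    (('a::complex_algebra, 'c::complex_algebra) tensor, 'b::complex_algebra) tensor \<Rightarrow> _)"
proof -
  note map = map_id_flip_pure map_id_flip_add
  have "bij (tensor_map id tensor_flip :: ('a, ('c, 'b) tensor) tensor \<Rightarrow> _)"
    by (intro o_bij[of "tensor_map id tensor_flip"]) (simp_all add: fun_eq_iff tensor_map_flip_flip)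
  moreover have "tensor_map id tensor_flip (x * y) = tensor_map id tensor_flip x * tensor_map id tensor_flip y"
    for x y :: "('a, ('c, 'b) tensor) tensor"
  proof (induction x rule: tensor_induct)
    case (pure a b)
    show ?case
      by (induction y rule: tensor_induct)
         (simp_all only: map pure_times_pure distrib_left tensor_flip_times)
  qed (simp only: map distrib_right)
  ultimately have "algebra_iso (tensor_map id tensor_flip :: ('a, ('c, 'b) tensor) tensor \<Rightarrow> _)"
    unfolding algebra_iso_def by (blast intro: clinear_tensor_map clinear_id clinear_tensor_flip)
  thus ?thesis
    unfolding tensor_swap23_def by (rule algebra_iso_comp[OF algebra_iso_assoc])
qed

text \<open>Leg numbering in the multiplier algebra of \<open>A \<otimes> (A \<otimes> A)\<close>.\<close>

definition leg12 :: "('a::complex_algebra, 'a) tensor multiplier \<Rightarrow> ('a, ('a, 'a) tensor) tensor multiplier" where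
  "leg12 m = mult_transport tensor_assoc (m \<otimes>\<^sub>m 1)"

definition leg23 :: "('a::complex_algebra, 'a) tensor multiplier \<Rightarrow> ('a, ('a, 'a) tensor) tensor multiplier" where
  "leg23 m = 1 \<otimes>\<^sub>m m"

definition leg13 :: "('a::complex_algebra, 'a) tensor multiplier \<Rightarrow> ('a, ('a, 'a) tensor) tensor multiplier" where
  "leg13 m = mult_transport tensor_swap23 (m \<otimes>\<^sub>m 1)"

text \<open>\<open>T\<close> \<open>\<otimes>\<close> id and id \<open>\<otimes>\<close> \<open>T\<close> on \<open>A \<otimes> (A \<otimes> A)\<close>.\<close>

definition on_legs12 :: "(('a::complex_algebra, 'a) tensor \<Rightarrow> ('a, 'a) tensor) \<Rightarrow>
    ('a, ('a, 'a) tensor) tensor \<Rightarrow> ('a, ('a, 'a) tensor) tensor" where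
  "on_legs12 T x = tensor_assoc (tensor_map T id (inv tensor_assoc x))"

definition on_legs23 :: "(('a::complex_algebra, 'a) tensor \<Rightarrow> ('a, 'a) tensor) \<Rightarrow>
    ('a, ('a, 'a) tensor) tensor \<Rightarrow> ('a, ('a, 'a) tensor) tensor" where
  "on_legs23 T = tensor_map id T"

definition strictly_tendsto :: "('x \<Rightarrow> 'a::complex_algebra multiplier) \<Rightarrow> 'a multiplier \<Rightarrow> 'x filter \<Rightarrow> bool" where
  "strictly_tendsto f m F \<longleftrightarrow> (\<forall>a. \<forall>\<^sub>F x in F. f x \<rhd> a = m \<rhd> a \<and> a \<lhd> f x = a \<lhd> m)"

definition strict_sum :: "('x \<Rightarrow> 'a::complex_algebra multiplier) \<Rightarrow> 'x set \<Rightarrow> 'a multiplier" where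
  "strict_sum f S = (THE m. strictly_tendsto (sum f) m (finite_subsets_at_top S))"

text \<open>
  The value at \<open>m\<close> of the extension to multipliers of a homomorphism \<open>f\<close> from an algebra \<open>C\<close> into
  \<open>M(D)\<close> whose products with \<open>D\<close> span \<open>eD\<close> and \<open>De\<close>. The extension sends the unit to the idempotent
  \<open>e\<close>, so that its values lie in \<open>eM(D)e\<close>; together with \<open>F(m) f(c) = F(mc)\<close> and
  \<open>f(c) F(m) = F(cm)\<close> for \<open>c\<close> in \<open>C\<close>, where \<open>F = f\<close> on \<open>C\<close>, this determines \<open>F(m)\<close>.
  \<open>C\<close> may be a proper subalgebra of the ambient algebra.
\<close>

definition multiplier_extension :: "'c::complex_algebra set \<Rightarrow> ('c \<Rightarrow> 'd::complex_algebra multiplier) \<Rightarrow>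
    'd multiplier \<Rightarrow> 'c multiplier \<Rightarrow> 'd multiplier" where
  "multiplier_extension C f e m =
    (THE n. e * n = n \<and> n * e = n \<and> (\<forall>c\<in>C. n * f c = f (m \<rhd> c) \<and> f c * n = f (c \<lhd> m)))"

definition set_product :: "'a::complex_algebra set \<Rightarrow> 'a set \<Rightarrow> 'a set" where
  "set_product V W = cspan {v * w | v w. v \<in> V \<and> w \<in> W}"

definition left_nondegenerate :: "'a::complex_algebra set \<Rightarrow> bool" where
  "left_nondegenerate B \<longleftrightarrow> (\<forall>b\<in>B. (\<forall>c\<in>B. b * c = 0) \<longrightarrow> b = 0)"

definition right_nondegenerate :: "'a::complex_algebra set \<Rightarrow> bool" where
  "right_nondegenerate B \<longleftrightarrow> (\<forall>b\<in>B. (\<forall>c\<in>B. c * b = 0) \<longrightarrow> b = 0)"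

definition idempotent_algebra :: "'a::complex_algebra set \<Rightarrow> bool" where
  "idempotent_algebra B \<longleftrightarrow> set_product B B = B"


section \<open>The canonical maps of a comultiplication\<close>

text \<open>Below, \<open>of_alg a \<otimes>\<^sub>m 1\<close> is \<open>a \<otimes> 1\<close> as a multiplier of \<open>A \<otimes> A\<close>.\<close>

type_synonym 'a comult = "'a \<Rightarrow> ('a, 'a) tensor multiplier"

definition canon1 :: "'a::complex_algebra comult \<Rightarrow> ('a, 'a) tensor \<Rightarrow> ('a, 'a) tensor" where
  "canon1 \<Delta> = tensor_lift (\<lambda>a b. to_alg (\<Delta> a * (1 \<otimes>\<^sub>m of_alg b)))"

definition canon2 :: "'a::complex_algebra comult \<Rightarrow> ('a, 'a) tensor \<Rightarrow> ('a, 'a) tensor" where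
  "canon2 \<Delta> = tensor_lift (\<lambda>a b. to_alg ((of_alg a \<otimes>\<^sub>m 1) * \<Delta> b))"

definition canon3 :: "'a::complex_algebra comult \<Rightarrow> ('a, 'a) tensor \<Rightarrow> ('a, 'a) tensor" where
  "canon3 \<Delta> = tensor_lift (\<lambda>a b. to_alg ((1 \<otimes>\<^sub>m of_alg b) * \<Delta> a))"

definition canon4 :: "'a::complex_algebra comult \<Rightarrow> ('a, 'a) tensor \<Rightarrow> ('a, 'a) tensor" where
  "canon4 \<Delta> = tensor_lift (\<lambda>a b. to_alg (\<Delta> b * (of_alg a \<otimes>\<^sub>m 1)))"

definition canon_well_defined :: "'a::complex_algebra comult \<Rightarrow> bool" where
  "canon_well_defined \<Delta> \<longleftrightarrow> (\<forall>a b.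
      \<Delta> a * (1 \<otimes>\<^sub>m of_alg b) \<in> range of_alg \<and>
      (of_alg a \<otimes>\<^sub>m 1) * \<Delta> b \<in> range of_alg \<and>
      (1 \<otimes>\<^sub>m of_alg b) * \<Delta> a \<in> range of_alg \<and>
      \<Delta> b * (of_alg a \<otimes>\<^sub>m 1) \<in> range of_alg)"

definition opposite_comult :: "'a::complex_algebra comult \<Rightarrow> 'a comult" where
  "opposite_comult \<Delta> a = mult_transport tensor_flip (\<Delta> a)"

definition comult_id :: "'a::complex_algebra comult \<Rightarrow> ('a, 'a) tensor \<Rightarrow> ('a, ('a, 'a) tensor) tensor multiplier" where
  "comult_id \<Delta> = tensor_lift (\<lambda>a b. mult_transport tensor_assoc (\<Delta> a \<otimes>\<^sub>m of_alg b))"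

definition id_comult :: "'a::complex_algebra comult \<Rightarrow> ('a, 'a) tensor \<Rightarrow> ('a, ('a, 'a) tensor) tensor multiplier" where
  "id_comult \<Delta> = tensor_lift (\<lambda>a b. of_alg a \<otimes>\<^sub>m \<Delta> b)"


section \<open>Partial algebras\<close>

definition internal_direct_sum :: "'k set \<Rightarrow> ('k \<Rightarrow> 'a::complex_vector set) \<Rightarrow> bool" where
  "internal_direct_sum K V \<longleftrightarrow>
    (\<forall>k\<in>K. csubspace (V k)) \<and>
    (\<forall>a. \<exists>!f. (\<forall>k\<in>K. f k \<in> V k) \<and> (\<forall>k. k \<notin> K \<longrightarrow> f k = 0) \<and>
       finite {k. f k \<noteq> 0} \<and> a = (\<Sum>k | f k \<noteq> 0. f k))"

definition partial_algebra :: "'j set \<Rightarrow> ('j \<Rightarrow> 'j \<Rightarrow> 'a::complex_algebra set) \<Rightarrow> bool" where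
  "partial_algebra J A \<longleftrightarrow>
    internal_direct_sum (J \<times> J) (\<lambda>(r, s). A r s) \<and>
    (\<forall>r\<in>J. \<forall>s\<in>J. \<forall>s'\<in>J. \<forall>t\<in>J. \<forall>a\<in>A r s. \<forall>b\<in>A s' t. s \<noteq> s' \<longrightarrow> a * b = 0) \<and>
    (\<forall>r\<in>J. \<forall>s\<in>J. \<forall>t\<in>J. \<forall>a\<in>A r s. \<forall>b\<in>A s t. a * b \<in> A r t)"

definition base_unit :: "'j set \<Rightarrow> ('j \<Rightarrow> 'j \<Rightarrow> 'a::complex_algebra set) \<Rightarrow> 'j \<Rightarrow> 'a multiplier" where
  "base_unit J A r = (THE m. \<forall>p\<in>J. \<forall>q\<in>J. \<forall>a\<in>A p q.
      m \<rhd> a = (if p = r then a else 0) \<and> a \<lhd> m = (if q = r then a else 0))"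

text \<open>
  The subspaces \<open>1(r)A\<close> and \<open>A1(s)\<close>, in terms of the components. This also makes sense for
  a partial algebra that is a proper subalgebra of the ambient type, such as
  \<open>partial_tensor\<close> below.
\<close>

definition row :: "'j set \<Rightarrow> ('j \<Rightarrow> 'j \<Rightarrow> 'a::complex_algebra set) \<Rightarrow> 'j \<Rightarrow> 'a set" where
  "row J A r = cspan (\<Union>s\<in>J. A r s)"

definition col :: "'j set \<Rightarrow> ('j \<Rightarrow> 'j \<Rightarrow> 'a::complex_algebra set) \<Rightarrow> 'j \<Rightarrow> 'a set" where
  "col J A s = cspan (\<Union>r\<in>J. A r s)"

definition nondegenerate_partial_algebra :: "'j set \<Rightarrow> ('j \<Rightarrow> 'j \<Rightarrow> 'a::complex_algebra set) \<Rightarrow> bool" where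
  "nondegenerate_partial_algebra J A \<longleftrightarrow>
    (\<forall>r\<in>J. left_nondegenerate (col J A r) \<and> right_nondegenerate (row J A r))"

definition idempotent_partial_algebra :: "'j set \<Rightarrow> ('j \<Rightarrow> 'j \<Rightarrow> 'a::complex_algebra set) \<Rightarrow> bool" where
  "idempotent_partial_algebra J A \<longleftrightarrow>
    (\<forall>r\<in>J. idempotent_algebra (col J A r) \<and> idempotent_algebra (row J A r))"

text \<open>
  Morphisms from a partial algebra \<open>A\<close> to a partial algebra \<open>B\<close> that is a subalgebra of an
  ambient algebra \<open>D\<close> with \<open>M(B)\<close> identified with \<open>eM(D)e\<close>, \<open>e\<close> being the unit of \<open>M(B)\<close>.
\<close>

definition partial_morphism :: "'j set \<Rightarrow> ('j \<Rightarrow> 'j \<Rightarrow> 'a::complex_algebra set) \<Rightarrow>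
    ('j \<Rightarrow> 'j \<Rightarrow> 'd::complex_algebra set) \<Rightarrow> 'd multiplier \<Rightarrow> ('a \<Rightarrow> 'd multiplier) \<Rightarrow> bool" where
  "partial_morphism J A B e f \<longleftrightarrow>
    clinear f \<and> (\<forall>a b. f (a * b) = f a * f b) \<and> (\<forall>a. e * f a = f a \<and> f a * e = f a) \<and>
    (\<forall>r\<in>J. cspan {b \<lhd> f a | a b. a \<in> col J A r \<and> b \<in> col J B r} = col J B r \<and>
            cspan {f a \<rhd> b | a b. a \<in> row J A r \<and> b \<in> row J B r} = row J B r)"


section \<open>Partial multiplier Hopf algebras\<close>

text \<open>
  In an \<open>I\<^sup>2\<close>-partial algebra, the pair \<open>(r, t)\<close> is the column with upper entry \<open>r\<close> and lower
  entry \<open>t\<close>.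
\<close>

type_synonym ('i, 'a) bigrading = "'i \<times> 'i \<Rightarrow> 'i \<times> 'i \<Rightarrow> 'a set"

definition upper_unit :: "'i set \<Rightarrow> ('i, 'a::complex_algebra) bigrading \<Rightarrow> 'i \<Rightarrow> 'a multiplier" where
  "upper_unit I A r = strict_sum (\<lambda>t. base_unit (I \<times> I) A (r, t)) I"

definition lower_unit :: "'i set \<Rightarrow> ('i, 'a::complex_algebra) bigrading \<Rightarrow> 'i \<Rightarrow> 'a multiplier" where
  "lower_unit I A t = strict_sum (\<lambda>r. base_unit (I \<times> I) A (r, t)) I"

text \<open>\<open>A\<^sup>s\<close>, \<open>A\<^sub>u\<close>, and the same with the index on the left.\<close>

definition right_upper :: "'i set \<Rightarrow> ('i, 'a::complex_algebra) bigrading \<Rightarrow> 'i \<Rightarrow> 'a set" where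
  "right_upper I A s = range (\<lambda>a. a \<lhd> upper_unit I A s)"

definition right_lower :: "'i set \<Rightarrow> ('i, 'a::complex_algebra) bigrading \<Rightarrow> 'i \<Rightarrow> 'a set" where
  "right_lower I A u = range (\<lambda>a. a \<lhd> lower_unit I A u)"

definition left_upper :: "'i set \<Rightarrow> ('i, 'a::complex_algebra) bigrading \<Rightarrow> 'i \<Rightarrow> 'a set" where
  "left_upper I A r = range (\<lambda>a. upper_unit I A r \<rhd> a)"

definition left_lower :: "'i set \<Rightarrow> ('i, 'a::complex_algebra) bigrading \<Rightarrow> 'i \<Rightarrow> 'a set" where
  "left_lower I A t = range (\<lambda>a. lower_unit I A t \<rhd> a)"

definition partial_tensor :: "'i set \<Rightarrow> ('i, 'a::complex_algebra) bigrading \<Rightarrow>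
    ('i, 'b::complex_algebra) bigrading \<Rightarrow> ('i, ('a, 'b) tensor) bigrading" where
  "partial_tensor I A B = (\<lambda>(r, v) (s, w).
     cspan {a \<otimes> b | a b t u. t \<in> I \<and> u \<in> I \<and> a \<in> A (r, t) (s, u) \<and> b \<in> B (t, v) (u, w)})"

definition partial_tensor_carrier :: "'i set \<Rightarrow> ('i, 'a::complex_algebra) bigrading \<Rightarrow>
    ('i, 'b::complex_algebra) bigrading \<Rightarrow> ('a, 'b) tensor set" where
  "partial_tensor_carrier I A B = cspan (\<Union>p\<in>I \<times> I. \<Union>q\<in>I \<times> I. partial_tensor I A B p q)"

text \<open>The unit \<open>E\<^sub>0\<close> of \<open>M(A \<otimes>\<^sup>I B)\<close>.\<close>

definition canonical_idempotent :: "'i set \<Rightarrow> ('i, 'a::complex_algebra) bigrading \<Rightarrow>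
    ('i, 'b::complex_algebra) bigrading \<Rightarrow> ('a, 'b) tensor multiplier" where
  "canonical_idempotent I A B = strict_sum (\<lambda>t. lower_unit I A t \<otimes>\<^sub>m upper_unit I B t) I"

text \<open>
  Coassociativity is an equation in \<open>M(A \<otimes>\<^sup>I A \<otimes>\<^sup>I A)\<close>, whose unit as a multiplier of
  \<open>A \<otimes> A \<otimes> A\<close> is \<open>(E\<^sub>0 \<otimes> 1)(1 \<otimes> E\<^sub>0)\<close>.
\<close>

definition regular_partial_comultiplication ::
    "'i set \<Rightarrow> ('i, 'a::complex_algebra) bigrading \<Rightarrow> 'a comult \<Rightarrow> bool" where
  "regular_partial_comultiplication I A \<Delta> \<longleftrightarrow>
    partial_morphism (I \<times> I) A (partial_tensor I A A) (canonical_idempotent I A A) \<Delta> \<and>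
    (\<forall>a b. \<Delta> a * (of_alg b \<otimes>\<^sub>m 1) \<in> range of_alg \<and> \<Delta> a * (1 \<otimes>\<^sub>m of_alg b) \<in> range of_alg \<and>
           (of_alg b \<otimes>\<^sub>m 1) * \<Delta> a \<in> range of_alg \<and> (1 \<otimes>\<^sub>m of_alg b) * \<Delta> a \<in> range of_alg) \<and>
    (let E\<^sub>0 = canonical_idempotent I A A;
         e = leg12 E\<^sub>0 * leg23 E\<^sub>0;
         C = partial_tensor_carrier I A A
     in \<forall>a. multiplier_extension C (comult_id \<Delta>) e (\<Delta> a) =
            multiplier_extension C (id_comult \<Delta>) e (\<Delta> a))"

text \<open>
  The last four equations below are
  \<open>(id \<otimes> \<epsilon>)\<Delta>(a) = a = (\<epsilon> \<otimes> id)\<Delta>(a)\<close> in \<open>M(A)\<close>, unfolded.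
\<close>

definition partial_counit ::
    "'i set \<Rightarrow> ('i, 'a::complex_algebra) bigrading \<Rightarrow> 'a comult \<Rightarrow> ('a \<Rightarrow> complex) \<Rightarrow> bool" where
  "partial_counit I A \<Delta> \<epsilon> \<longleftrightarrow>
    clinear \<epsilon> \<and>
    (\<forall>r\<in>I. \<forall>t\<in>I. \<forall>s\<in>I. \<forall>u\<in>I. r \<noteq> t \<or> s \<noteq> u \<longrightarrow> (\<forall>a\<in>A (r, t) (s, u). \<epsilon> a = 0)) \<and>
    (\<forall>r\<in>I. (\<exists>a\<in>right_lower I A r. \<epsilon> a \<noteq> 0) \<and> (\<exists>a\<in>left_lower I A r. \<epsilon> a \<noteq> 0)) \<and>
    (\<forall>s\<in>I. \<forall>t\<in>I. \<forall>a\<in>col (I \<times> I) A (s, t). \<forall>b\<in>row (I \<times> I) A (s, t). \<epsilon> (a * b) = \<epsilon> a * \<epsilon> b) \<and>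
    (\<forall>a b. slice_right \<epsilon> (to_alg (\<Delta> a * (of_alg b \<otimes>\<^sub>m 1))) = a * b \<and>
           slice_right \<epsilon> (to_alg ((of_alg b \<otimes>\<^sub>m 1) * \<Delta> a)) = b * a \<and>
           slice_left \<epsilon> (to_alg (\<Delta> a * (1 \<otimes>\<^sub>m of_alg b))) = a * b \<and>
           slice_left \<epsilon> (to_alg ((1 \<otimes>\<^sub>m of_alg b) * \<Delta> a)) = b * a)"

definition regular_partial_multiplier_bialgebra ::
    "'i set \<Rightarrow> ('i, 'a::complex_algebra) bigrading \<Rightarrow> 'a comult \<Rightarrow> bool" where
  "regular_partial_multiplier_bialgebra I A \<Delta> \<longleftrightarrow>
    partial_algebra (I \<times> I) A \<and> nondegenerate_partial_algebra (I \<times> I) A \<and>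
    idempotent_partial_algebra (I \<times> I) A \<and> regular_partial_comultiplication I A \<Delta> \<and>
    (\<exists>\<epsilon>. partial_counit I A \<Delta> \<epsilon>)"

definition diagonal_tensor :: "'i set \<Rightarrow> ('i \<Rightarrow> 'a::complex_vector set) \<Rightarrow>
    ('i \<Rightarrow> 'b::complex_vector set) \<Rightarrow> ('a, 'b) tensor set" where
  "diagonal_tensor I V W = cspan (\<Union>r\<in>I. tensor_subspace (V r) (W r))"

definition regular_partial_multiplier_Hopf_algebra ::
    "'i set \<Rightarrow> ('i, 'a::complex_algebra) bigrading \<Rightarrow> 'a comult \<Rightarrow> bool" where
  "regular_partial_multiplier_Hopf_algebra I A \<Delta> \<longleftrightarrow>
    regular_partial_multiplier_bialgebra I A \<Delta> \<and>
    bij_betw (canon1 \<Delta>)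
      (diagonal_tensor I (right_lower I A) (left_lower I A))
      (diagonal_tensor I (left_lower I A) (left_upper I A)) \<and>
    bij_betw (canon2 \<Delta>)
      (diagonal_tensor I (right_upper I A) (left_upper I A))
      (diagonal_tensor I (right_lower I A) (right_upper I A)) \<and>
    bij_betw (canon1 (opposite_comult \<Delta>))
      (diagonal_tensor I (right_upper I A) (left_upper I A))
      (diagonal_tensor I (left_upper I A) (left_lower I A)) \<and>
    bij_betw (canon2 (opposite_comult \<Delta>))
      (diagonal_tensor I (right_lower I A) (left_lower I A))
      (diagonal_tensor I (right_upper I A) (right_lower I A))"


section \<open>Weak multiplier Hopf algebras\<close>

text \<open>
  The idempotent \<open>E\<close> and the counit \<open>\<epsilon>\<close>, whose existence is required, are kept as parameters,
  because \<open>E\<close> enters the definition of a weak multiplier Hopf algebra.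
\<close>

definition regular_weak_multiplier_bialgebra ::
    "'a::complex_algebra comult \<Rightarrow> ('a, 'a) tensor multiplier \<Rightarrow> ('a \<Rightarrow> complex) \<Rightarrow> bool" where
  "regular_weak_multiplier_bialgebra \<Delta> E \<epsilon> \<longleftrightarrow>
    idempotent_algebra (UNIV :: 'a set) \<and>
    left_nondegenerate (UNIV :: 'a set) \<and> right_nondegenerate (UNIV :: 'a set) \<and>
    clinear \<Delta> \<and> (\<forall>a b. \<Delta> (a * b) = \<Delta> a * \<Delta> b) \<and> E * E = E \<and> clinear \<epsilon> \<and>
    canon_well_defined \<Delta> \<and>
    on_legs12 (canon2 \<Delta>) \<circ> on_legs23 (canon1 \<Delta>) = on_legs23 (canon1 \<Delta>) \<circ> on_legs12 (canon2 \<Delta>) \<and>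
    (\<forall>a b. slice_left \<epsilon> (canon1 \<Delta> (a \<otimes> b)) = a * b \<and> slice_right \<epsilon> (canon2 \<Delta> (a \<otimes> b)) = a * b) \<and>
    cspan {\<Delta> a \<rhd> (b \<otimes> c) | a b c. True} = cspan {E \<rhd> (b \<otimes> c) | b c. True} \<and>
    cspan {(a \<otimes> b) \<lhd> \<Delta> c | a b c. True} = cspan {(a \<otimes> b) \<lhd> E | a b. True} \<and>
    leg12 E * leg23 E = leg23 E * leg12 E \<and>
    leg23 E * leg12 E = multiplier_extension UNIV (comult_id \<Delta>) (leg12 E) E \<and>
    multiplier_extension UNIV (comult_id \<Delta>) (leg12 E) E =
      multiplier_extension UNIV (id_comult \<Delta>) (leg23 E) E \<and>
    (\<forall>a b c. slice_left \<epsilon> ((1 \<otimes>\<^sub>m of_alg a) \<rhd> (E \<rhd> (b \<otimes> c))) = slice_left \<epsilon> (\<Delta> a \<rhd> (b \<otimes> c))) \<and>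
    (\<forall>a b c. slice_left \<epsilon> (((a \<otimes> b) \<lhd> E) \<lhd> (1 \<otimes>\<^sub>m of_alg c)) = slice_left \<epsilon> ((a \<otimes> b) \<lhd> \<Delta> c))"

text \<open>
  The whole space is one of the subspaces under consideration as soon as the canonical maps are
  well-defined, so that it is the smallest one iff it is the only one.
\<close>

definition full_comult :: "'a::complex_algebra comult \<Rightarrow> bool" where
  "full_comult \<Delta> \<longleftrightarrow>
    (\<forall>V. csubspace V \<and> (\<forall>a b. \<Delta> a * (1 \<otimes>\<^sub>m of_alg b) \<in> of_alg ` tensor_subspace V UNIV) \<longrightarrow> V = UNIV) \<and>
    (\<forall>W. csubspace W \<and> (\<forall>a b. (of_alg a \<otimes>\<^sub>m 1) * \<Delta> b \<in> of_alg ` tensor_subspace UNIV W) \<longrightarrow> W = UNIV)"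

definition kernel :: "('a::complex_vector \<Rightarrow> 'b::complex_vector) \<Rightarrow> 'a set" where
  "kernel T = {x. T x = 0}"

text \<open>
  The defining equations of the maps \<open>G\<^sub>1, \<dots>, G\<^sub>4\<close>. Both sides are elements of \<open>A \<otimes> A \<otimes> A\<close>,
  written as multipliers; \<open>leg12 (of_alg (a \<otimes> b))\<close> is \<open>a \<otimes> b \<otimes> 1\<close>. By fullness, each
  equation has at most one linear solution.
\<close>

definition is_G1 :: "'a::complex_algebra comult \<Rightarrow> ('a, 'a) tensor multiplier \<Rightarrow>
    (('a, 'a) tensor \<Rightarrow> ('a, 'a) tensor) \<Rightarrow> bool" where
  "is_G1 \<Delta> E G \<longleftrightarrow> clinear G \<and> (\<forall>a b c.
     of_alg (on_legs12 G (to_alg (leg13 (\<Delta> a) * leg23 (of_alg (b \<otimes> c))))) =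
     leg13 (\<Delta> a) * leg23 E * leg23 (of_alg (b \<otimes> c)))"

definition is_G2 :: "'a::complex_algebra comult \<Rightarrow> ('a, 'a) tensor multiplier \<Rightarrow>
    (('a, 'a) tensor \<Rightarrow> ('a, 'a) tensor) \<Rightarrow> bool" where
  "is_G2 \<Delta> E G \<longleftrightarrow> clinear G \<and> (\<forall>a b c.
     of_alg (on_legs23 G (to_alg (leg12 (of_alg (a \<otimes> b)) * leg13 (\<Delta> c)))) =
     leg12 (of_alg (a \<otimes> b)) * leg12 E * leg13 (\<Delta> c))"

definition is_G3 :: "'a::complex_algebra comult \<Rightarrow> ('a, 'a) tensor multiplier \<Rightarrow>
    (('a, 'a) tensor \<Rightarrow> ('a, 'a) tensor) \<Rightarrow> bool" where
  "is_G3 \<Delta> E G \<longleftrightarrow> clinear G \<and> (\<forall>a b c.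
     of_alg (on_legs12 G (to_alg (leg23 (of_alg (b \<otimes> c)) * leg13 (\<Delta> a)))) =
     leg23 (of_alg (b \<otimes> c)) * leg23 E * leg13 (\<Delta> a))"

definition is_G4 :: "'a::complex_algebra comult \<Rightarrow> ('a, 'a) tensor multiplier \<Rightarrow>
    (('a, 'a) tensor \<Rightarrow> ('a, 'a) tensor) \<Rightarrow> bool" where
  "is_G4 \<Delta> E G \<longleftrightarrow> clinear G \<and> (\<forall>a b c.
     of_alg (on_legs23 G (to_alg (leg13 (\<Delta> c) * leg12 (of_alg (a \<otimes> b))))) =
     leg13 (\<Delta> c) * leg12 E * leg12 (of_alg (a \<otimes> b)))"

definition regular_weak_multiplier_Hopf_algebra :: "'a::complex_algebra comult \<Rightarrow> bool" where
  "regular_weak_multiplier_Hopf_algebra \<Delta> \<longleftrightarrow>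
    full_comult \<Delta> \<and> full_comult (opposite_comult \<Delta>) \<and>
    (\<exists>E \<epsilon>. regular_weak_multiplier_bialgebra \<Delta> E \<epsilon> \<and>
      range (canon1 \<Delta>) = range (\<lambda>x. E \<rhd> x) \<and> range (canon4 \<Delta>) = range (\<lambda>x. E \<rhd> x) \<and>
      range (canon2 \<Delta>) = range (\<lambda>x. x \<lhd> E) \<and> range (canon3 \<Delta>) = range (\<lambda>x. x \<lhd> E) \<and>
      (\<exists>G. is_G1 \<Delta> E G \<and> kernel (canon1 \<Delta>) = range (\<lambda>x. x - G x)) \<and>
      (\<exists>G. is_G2 \<Delta> E G \<and> kernel (canon2 \<Delta>) = range (\<lambda>x. x - G x)) \<and>
      (\<exists>G. is_G3 \<Delta> E G \<and> kernel (canon3 \<Delta>) = range (\<lambda>x. x - G x)) \<and>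
      (\<exists>G. is_G4 \<Delta> E G \<and> kernel (canon4 \<Delta>) = range (\<lambda>x. x - G x)))"

end

theory Submission
  imports Defs
begin

text \<open>
  The idempotent of the weak multiplier Hopf algebra is the canonical idempotent \<open>E\<close>, the sum of the
  \<open>1\<^sub>t \<otimes> 1\<^sup>t\<close>, and the counit is the given one. All axioms rest on the rules
  \<open>\<Delta>(1\<^sup>r a) = (1\<^sup>r \<otimes> 1) \<Delta>(a)\<close>, \<open>\<Delta>(1\<^sub>r a) = (1 \<otimes> 1\<^sub>r) \<Delta>(a)\<close> and \<open>E (1\<^sub>r \<otimes> 1) = E (1 \<otimes> 1\<^sup>r) = 1\<^sub>r \<otimes> 1\<^sup>r\<close>
  and their mirror images: an identity linear in \<open>b\<close> may be tested on the elements \<open>1\<^sub>r b\<close>, where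
  \<open>E\<close> is a single term of its defining sum. The maps \<open>G\<^sub>i\<close> are the projections onto the domains of the four
  bijections; for instance \<open>G\<^sub>1(a \<otimes> b)\<close> is the sum of the \<open>a 1\<^sub>r \<otimes> 1\<^sub>r b\<close>. Fullness follows from
  \<open>(id \<otimes> \<epsilon>)(\<Delta>(a)(1 \<otimes> 1\<^sup>r b)) = \<epsilon>(1\<^sup>r b) a 1\<^sub>r\<close>, a consequence of the multiplicativity of the counit.
\<close>

section \<open>Linear maps\<close>

text \<open>Three obstacles shape the argument. Elements of tensor powers enter the definitions as
  multipliers, through \<open>to_alg\<close> and definite descriptions, so non-degeneracy of the
  tensor powers and the existence of each described multiplier have to be established before an
  equation can be used. The rules for \<open>\<Delta>\<close> and the units are not assumed: the
  morphism condition says that values of \<open>\<Delta>\<close> span the rows and columns of the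
  balanced tensor product, and since homogeneous factors with unequal inner indices multiply to
  zero, \<open>\<Delta> a\<close> must be supported at the indices of \<open>a\<close>. Finally,
  coassociativity is an equality of two extensions on \<open>E (A \<otimes> A) E\<close>, while the
  weak axiom needs it against arbitrary elements. Idempotence of rows and columns bridges this gap:
  every component is spanned by products whose outer factor lies in a diagonal component
  \<open>A p p\<close>, and such outer factors combine to elements of
  \<open>E (A \<otimes> A) E\<close>. The algebra is done for two abstract families of units
  \<open>U\<close>, \<open>L\<close> with a list of properties; the grading serves only to verify
  this list.\<close>

lemma clinearI:
  "(\<And>x y. f (x + y) = f x + f y) \<Longrightarrow> (\<And>c x. f (c *\<^sub>C x) = c *\<^sub>C f x) \<Longrightarrow> clinear f"
  by (simp add: clinear_iff)

lemma clinear_compose: "clinear f \<Longrightarrow> clinear g \<Longrightarrow> clinear (\<lambda>x. f (g x))"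
  by (simp add: clinear_iff)

lemma clinear_ident: "clinear (\<lambda>x. x)"
  by (simp add: clinear_iff)

lemma clinear_diff: "clinear f \<Longrightarrow> f (x - y) = f x - f y"
  by (rule cvec_pair.linear_diff)

lemma clinear_sum: "clinear f \<Longrightarrow> f (sum g S) = (\<Sum>x\<in>S. f (g x))"
  by (rule cvec_pair.linear_sum)

lemma clinear_eq_on_span:
  assumes "clinear f" "clinear g" "\<And>x. x \<in> S \<Longrightarrow> f x = g x" "x \<in> cspan S"
  shows "f x = g x"
  using assms(4)
  by (induction rule: cvec.span_induct_alt)
    (simp_all add: clinear_0[OF assms(1)] clinear_0[OF assms(2)] clinear_add[OF assms(1)]
      clinear_add[OF assms(2)] clinear_scaleC[OF assms(1)] clinear_scaleC[OF assms(2)] assms(3))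

lemma clinear_span_into:
  assumes "clinear f" "csubspace V" "\<And>x. x \<in> S \<Longrightarrow> f x \<in> V" "x \<in> cspan S"
  shows "f x \<in> V"
  using assms(4)
  by (induction rule: cvec.span_induct_alt)
    (simp_all add: clinear_0[OF assms(1)] clinear_add[OF assms(1)] clinear_scaleC[OF assms(1)]
      cvec.subspace_0[OF assms(2)] cvec.subspace_add[OF assms(2)] cvec.subspace_scale[OF assms(2)]
          assms(3))

lemma csubspace_range: "clinear f \<Longrightarrow> csubspace (range f)"
  using cvec_pair.linear_subspace_image[of f UNIV] by simp

lemma cbilinearI:
  assumes "\<And>a a' b. f (a + a') b = f a b + f a' b" "\<And>c a b. f (c *\<^sub>C a) b = c *\<^sub>C f a b"
    and "\<And>a b b'. f a (b + b') = f a b + f a b'" "\<And>c a b. f a (c *\<^sub>C b) = c *\<^sub>C f a b"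
  shows "cbilinear f"
  using assms by (simp add: cbilinear_def clinear_iff)

section \<open>Slices\<close>

lemma
  assumes "clinear \<omega>"
  shows clinear_slice_right: "clinear (slice_right \<omega>)"
    and slice_right_pure: "slice_right \<omega> (a \<otimes> b) = \<omega> b *\<^sub>C a"
    and clinear_slice_left: "clinear (slice_left \<omega>)"
    and slice_left_pure: "slice_left \<omega> (b \<otimes> a) = \<omega> b *\<^sub>C a"
proof -
  have *: "cbilinear (\<lambda>a b. \<omega> b *\<^sub>C a)" "cbilinear (\<lambda>b a. \<omega> b *\<^sub>C a)"
    by (simp_all add: cbilinear_def clinear_iff clinear_add[OF assms] clinear_scaleC[OF assms]
        scaleC_add_right scaleC_add_left scaleC_scaleC scaleC_complex_def mult.commute)
  show "clinear (slice_right \<omega>)" "slice_right \<omega> (a \<otimes> b) = \<omega> b *\<^sub>C a"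
    "clinear (slice_left \<omega>)" "slice_left \<omega> (b \<otimes> a) = \<omega> b *\<^sub>C a"
    unfolding slice_right_def slice_left_def
    using clinear_tensor_lift[OF *(1)] tensor_lift_pure[OF *(1)]
      clinear_tensor_lift[OF *(2)] tensor_lift_pure[OF *(2)] by auto
qed

text \<open>Expand the first leg in a basis \<open>B\<close>: with \<open>\<omega> \<beta>\<close>
  the coordinate functional of \<open>\<beta>\<close>, every tensor \<open>y\<close> is a finite sum
  of terms \<open>\<beta> \<otimes> slice_left (\<omega> \<beta>) y\<close>. If all slices are zero,
  so is every term.\<close>

lemma slices_separate:
  fixes x :: "('a::complex_vector, 'b::complex_vector) tensor"
  assumes "\<And>\<omega>. clinear \<omega> \<Longrightarrow> slice_left \<omega> x = 0"
  shows "x = 0"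
proof -
  define B where "B = cvec.extend_basis ({} :: 'a set)"
  have B: "cvec.independent B" "cspan B = UNIV"
    unfolding B_def
    using cvec.independent_extend_basis[OF cvec.independent_empty]
      cvec.span_extend_basis[OF cvec.independent_empty] by auto
  define \<omega> where "\<omega> \<beta> a = cvec.representation B a \<beta>" for \<beta> a
  have \<omega>: "clinear (\<omega> \<beta>)" for \<beta>
    unfolding \<omega>_def using B
    by (simp add: clinear_iff cvec.representation_add cvec.representation_scale scaleC_complex_def)
  \<comment> \<open>The expansion is claimed for all finite supersets of \<open>F\<close>, so that
    the expansions of two summands can be added over the union of their index sets.\<close>
  have "\<exists>F. finite F \<and> (\<forall>F'. finite F' \<longrightarrow> F \<subseteq> F' \<longrightarrow> y = (\<Sum>\<beta>\<in>F'. \<beta> \<otimes> slice_left (\<omega> \<beta>) y))"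
    for y :: "('a, 'b) tensor"
  proof (induction y rule: tensor_induct)
    case (pure a b)
    define F where "F = {\<beta>. cvec.representation B a \<beta> \<noteq> 0}"
    have fin: "finite F" unfolding F_def by (rule cvec.finite_representation)
    have rep: "(\<Sum>\<beta>\<in>F. \<omega> \<beta> a *\<^sub>C \<beta>) = a"
      unfolding F_def \<omega>_def using B by (intro cvec.sum_nonzero_representation_eq) auto
    have "a \<otimes> b = (\<Sum>\<beta>\<in>F'. \<beta> \<otimes> slice_left (\<omega> \<beta>) (a \<otimes> b))" if "finite F'" "F \<subseteq> F'" for F'
    proof -
      have "(\<Sum>\<beta>\<in>F'. \<omega> \<beta> a *\<^sub>C \<beta>) = (\<Sum>\<beta>\<in>F. \<omega> \<beta> a *\<^sub>C \<beta>)"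
        using that by (intro sum.mono_neutral_right) (auto simp: F_def \<omega>_def)
      hence "a \<otimes> b = (\<Sum>\<beta>\<in>F'. \<omega> \<beta> a *\<^sub>C \<beta>) \<otimes> b" by (simp add: rep)
      also have "\<dots> = (\<Sum>\<beta>\<in>F'. (\<omega> \<beta> a *\<^sub>C \<beta>) \<otimes> b)"
        by (rule clinear_sum) (simp add: clinear_iff pure_tensor_bilinear)
      finally show ?thesis
        unfolding slice_left_pure[OF \<omega>] pure_tensor_bilinear .
    qed
    thus ?case using fin by blast
  next
    case (add x y)
    then obtain F G where *: "finite F" "finite G"
      "\<And>F'. finite F' \<Longrightarrow> F \<subseteq> F' \<Longrightarrow> x = (\<Sum>\<beta>\<in>F'. \<beta> \<otimes> slice_left (\<omega> \<beta>) x)"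
      "\<And>F'. finite F' \<Longrightarrow> G \<subseteq> F' \<Longrightarrow> y = (\<Sum>\<beta>\<in>F'. \<beta> \<otimes> slice_left (\<omega> \<beta>) y)"
      by blast
    have "x + y = (\<Sum>\<beta>\<in>F'. \<beta> \<otimes> slice_left (\<omega> \<beta>) (x + y))" if "finite F'" "F \<union> G \<subseteq> F'" for F'
      using *(3)[of F'] *(4)[of F'] that
      by (simp add: clinear_add[OF clinear_slice_left[OF \<omega>]] pure_tensor_bilinear sum.distrib)
    thus ?case using *(1,2) by (intro exI[of _ "F \<union> G"]) auto
  qed
  then obtain F where "finite F" "x = (\<Sum>\<beta>\<in>F. \<beta> \<otimes> slice_left (\<omega> \<beta>) x)" by blast
  moreover have "\<beta> \<otimes> (0 :: 'b) = 0" for \<beta> :: 'a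
    using pure_tensor_bilinear(4)[of \<beta> 0 "0 :: 'b"] by simp
  ultimately show ?thesis by (simp add: assms[OF \<omega>])
qed

lemma pure_tensor_zero [simp]: "(0::'a::complex_vector) \<otimes> b = 0" "a \<otimes> (0::'b::complex_vector) = 0"
  using pure_tensor_bilinear(3)[of 0 "0 :: 'a" b] pure_tensor_bilinear(4)[of a 0 "0 :: 'b"] by simp_all

lemma clinear_pure_tensor: "clinear (\<lambda>a. a \<otimes> b)" "clinear ((\<otimes>) a)"
  by (simp_all add: clinear_iff pure_tensor_bilinear)

lemma tensor_subspace_span:
  assumes "v \<in> cspan S" "w \<in> cspan T"
  shows "v \<otimes> w \<in> cspan {a \<otimes> b | a b. a \<in> S \<and> b \<in> T}"
proof -
  let ?X = "{a \<otimes> b | a b. a \<in> S \<and> b \<in> T}"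
  have "a \<otimes> w \<in> cspan ?X" if "a \<in> S" for a
    using assms(2)
    by (rule clinear_span_into[OF clinear_pure_tensor(2) cvec.subspace_span, rotated])
      (use that in \<open>auto intro: cvec.span_base\<close>)
  thus ?thesis
    using clinear_span_into[OF clinear_pure_tensor(1) cvec.subspace_span _ assms(1)] by blast
qed

section \<open>Multipliers of non-degenerate algebras\<close>

text \<open>A factor in the sliced leg is absorbed into the functional: \<open>\<eta>\<close> stands
  for \<open>\<omega>\<close> composed with multiplication by \<open>d\<close>.\<close>

lemma slice_times:
  fixes y :: "('a::complex_algebra, 'b::complex_algebra) tensor"
  assumes \<omega>: "clinear \<omega>" and \<eta>: "clinear \<eta>"
  shows slice_right_times_right:
      "(\<And>b. \<eta> b = \<omega> (b * d)) \<Longrightarrow> slice_right \<omega> (y * (c \<otimes> d)) = slice_right \<eta> y * c"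
    and slice_right_times_left:
      "(\<And>b. \<eta> b = \<omega> (d * b)) \<Longrightarrow> slice_right \<omega> ((c \<otimes> d) * y) = c * slice_right \<eta> y"
proof -
  note [simp] = slice_right_pure[OF \<omega>] slice_right_pure[OF \<eta>] pure_times_pure distrib_left distrib_right
    clinear_add[OF clinear_slice_right[OF \<omega>]] clinear_add[OF clinear_slice_right[OF \<eta>]]
    mult_scaleC_right mult_scaleC_left
  show "slice_right \<omega> (y * (c \<otimes> d)) = slice_right \<eta> y * c" if "\<And>b. \<eta> b = \<omega> (b * d)"
    by (induction y rule: tensor_induct) (simp_all add: that[symmetric])
  show "slice_right \<omega> ((c \<otimes> d) * y) = c * slice_right \<eta> y" if "\<And>b. \<eta> b = \<omega> (d * b)"
    by (induction y rule: tensor_induct) (simp_all add: that[symmetric])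
qed

lemma slice_slice:
  assumes "clinear \<phi>" "clinear \<eta>"
  shows "\<eta> (slice_left \<phi> y) = \<phi> (slice_right \<eta> y)"
  by (induction y rule: tensor_induct)
    (simp_all add: slice_right_pure slice_left_pure clinear_scaleC clinear_add clinear_slice_left
      clinear_slice_right scaleC_complex_def assms)

text \<open>Two slicings reduce the claim to the factors. Slicing \<open>x * (c \<otimes> d)\<close>
  in the second leg gives \<open>slice_right \<eta> x * c = 0\<close> for all \<open>c\<close>,
  hence \<open>slice_right \<eta> x = 0\<close>. Exchanging the slices by
  \<open>slice_slice\<close>, every functional kills \<open>slice_left \<phi> x * d\<close>, and
  non-degeneracy of \<open>'b\<close> finishes.\<close>

lemma times_pure_zero_left:
  fixes x :: "('a::complex_algebra, 'b::complex_algebra) tensor"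
  assumes "left_nondegenerate (UNIV :: 'a set)" "left_nondegenerate (UNIV :: 'b set)"
    and zero: "\<And>c d. x * (c \<otimes> d) = 0"
  shows "x = 0"
proof (rule slices_separate)
  fix \<phi> :: "'a \<Rightarrow> complex" assume \<phi>: "clinear \<phi>"
  have "slice_left \<phi> x * d = 0" for d
  proof (rule clinear_functionals_separate)
    fix \<omega> :: "'b \<Rightarrow> complex" assume \<omega>: "clinear \<omega>"
    obtain \<eta> where \<eta>: "clinear \<eta>" "\<And>b. \<eta> b = \<omega> (b * d)"
      using clinear_compose[OF \<omega> clinear_mult_right[of d]] by blast
    have "slice_right \<eta> x * c = 0" for c
      using slice_right_times_right[OF \<omega> \<eta>, where y=x and c=c]
      by (simp add: zero clinear_0[OF clinear_slice_right[OF \<omega>]])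
    hence "slice_right \<eta> x = 0"
      using assms(1) unfolding left_nondegenerate_def by blast
    thus "\<omega> (slice_left \<phi> x * d) = \<omega> 0"
      using slice_slice[OF \<phi> \<eta>(1), of x]
      by (simp add: \<eta>(2) clinear_0[OF \<phi>] clinear_0[OF \<omega>])
  qed
  thus "slice_left \<phi> x = 0" using assms(2) unfolding left_nondegenerate_def by blast
qed

lemma times_pure_zero_right:
  fixes x :: "('a::complex_algebra, 'b::complex_algebra) tensor"
  assumes "right_nondegenerate (UNIV :: 'a set)" "right_nondegenerate (UNIV :: 'b set)"
    and zero: "\<And>c d. (c \<otimes> d) * x = 0"
  shows "x = 0"
proof (rule slices_separate)
  fix \<phi> :: "'a \<Rightarrow> complex" assume \<phi>: "clinear \<phi>"
  have "d * slice_left \<phi> x = 0" for d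
  proof (rule clinear_functionals_separate)
    fix \<omega> :: "'b \<Rightarrow> complex" assume \<omega>: "clinear \<omega>"
    obtain \<eta> where \<eta>: "clinear \<eta>" "\<And>b. \<eta> b = \<omega> (d * b)"
      using clinear_compose[OF \<omega> clinear_mult_left[of d]] by blast
    have "c * slice_right \<eta> x = 0" for c
      using slice_right_times_left[OF \<omega> \<eta>, where y=x and c=c]
      by (simp add: zero clinear_0[OF clinear_slice_right[OF \<omega>]])
    hence "slice_right \<eta> x = 0"
      using assms(1) unfolding right_nondegenerate_def by blast
    thus "\<omega> (d * slice_left \<phi> x) = \<omega> 0"
      using slice_slice[OF \<phi> \<eta>(1), of x]
      by (simp add: \<eta>(2) clinear_0[OF \<phi>] clinear_0[OF \<omega>])
  qed
  thus "slice_left \<phi> x = 0" using assms(2) unfolding right_nondegenerate_def by blast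
qed

text \<open>Indexed by the type, so that non-degeneracy of \<open>A\<close> and of its tensor powers
  can be handed to rules as plain facts.\<close>

definition nondegenerate_algebra :: "'a::complex_algebra itself \<Rightarrow> bool" where
  "nondegenerate_algebra _ \<longleftrightarrow> left_nondegenerate (UNIV :: 'a set) \<and> right_nondegenerate (UNIV :: 'a set)"

lemma nondegenerate_left_zeroI:
  "nondegenerate_algebra TYPE('a::complex_algebra) \<Longrightarrow> (\<And>c. (b::'a) * c = 0) \<Longrightarrow> b = 0"
  and nondegenerate_right_zeroI:
  "nondegenerate_algebra TYPE('a::complex_algebra) \<Longrightarrow> (\<And>c. c * (b::'a) = 0) \<Longrightarrow> b = 0"
  unfolding nondegenerate_algebra_def left_nondegenerate_def right_nondegenerate_def by blast+

lemma nondegenerate_left_eqI: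
  "nondegenerate_algebra TYPE('a::complex_algebra) \<Longrightarrow> (\<And>c. (b::'a) * c = b' * c) \<Longrightarrow> b = b'"
  using nondegenerate_left_zeroI[of "b - b'"] by (simp add: left_diff_distrib)

lemma nondegenerate_right_eqI:
  "nondegenerate_algebra TYPE('a::complex_algebra) \<Longrightarrow> (\<And>c. c * (b::'a) = c * b') \<Longrightarrow> b = b'"
  using nondegenerate_right_zeroI[of "b - b'"] by (simp add: right_diff_distrib)

lemma nondegenerate_tensor:
  assumes "nondegenerate_algebra TYPE('a::complex_algebra)"
    and "nondegenerate_algebra TYPE('b::complex_algebra)"
  shows "nondegenerate_algebra TYPE(('a, 'b) tensor)"
  using assms times_pure_zero_left[where 'a='a and 'b='b] times_pure_zero_right[where 'a='a and 'b='b]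
  unfolding nondegenerate_algebra_def left_nondegenerate_def[of "UNIV :: ('a, 'b) tensor set"]
    right_nondegenerate_def[of "UNIV :: ('a, 'b) tensor set"] by blast

lemmas mult_left_linear = multiplier_props(1)
  and mult_right_linear = multiplier_props(2)
  and mult_left_right = multiplier_props(3)

lemmas mult_left_add = clinear_add[OF mult_left_linear]
  and mult_left_0 = clinear_0[OF mult_left_linear]
  and mult_left_scaleC = clinear_scaleC[OF mult_left_linear]
  and mult_right_add = clinear_add[OF mult_right_linear]
  and mult_right_0 = clinear_0[OF mult_right_linear]
  and mult_right_scaleC = clinear_scaleC[OF mult_right_linear]

lemma multiplier_actions [simp]:
  "(m * n) \<rhd> a = m \<rhd> n \<rhd> a" "a \<lhd> (m * n) = a \<lhd> m \<lhd> n"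
  "1 \<rhd> a = a" "a \<lhd> 1 = a" "0 \<rhd> a = 0" "a \<lhd> 0 = 0"
  "(m + n) \<rhd> a = m \<rhd> a + n \<rhd> a" "a \<lhd> (m + n) = a \<lhd> m + a \<lhd> n"
  "(c *\<^sub>C m) \<rhd> a = c *\<^sub>C (m \<rhd> a)" "a \<lhd> (c *\<^sub>C m) = c *\<^sub>C (a \<lhd> m)"
  "of_alg b \<rhd> a = b * a" "a \<lhd> of_alg b = a * b"
  by (transfer; auto)+

lemma of_alg_add: "of_alg (a + b) = of_alg a + of_alg b"
  and of_alg_scaleC: "of_alg (c *\<^sub>C a) = c *\<^sub>C of_alg a"
  and of_alg_times: "of_alg (a * b) = of_alg a * of_alg b"
  by (auto intro!: multiplier_eqI simp: algebra_simps mult_scaleC_left mult_scaleC_right)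

lemma clinear_of_alg: "clinear of_alg"
  by (rule clinearI) (simp_all add: of_alg_add of_alg_scaleC)

text \<open>A multiplier is only required to satisfy
  \<open>a * (m \<rhd> b) = (a \<lhd> m) * b\<close>. The module laws and the commutation of left
  and right actions follow by testing against one more factor and cancelling it by
  non-degeneracy.\<close>

lemma
  assumes "nondegenerate_algebra TYPE('a::complex_algebra)"
  shows mult_left_times: "m \<rhd> ((a::'a) * b) = (m \<rhd> a) * b"
    and mult_right_times: "(a * b) \<lhd> m = a * (b \<lhd> m)"
    and mult_left_mult_right: "(m \<rhd> a) \<lhd> n = m \<rhd> (a \<lhd> n)"
proof -
  have 1: "m \<rhd> (a * b) = (m \<rhd> a) * b" for m and a b :: 'a
    by (rule nondegenerate_right_eqI[OF assms]) (simp add: mult_left_right flip: mult.assoc)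
  have 2: "(a * b) \<lhd> m = a * (b \<lhd> m)" for m and a b :: 'a
    by (rule nondegenerate_left_eqI[OF assms]) (simp add: mult_left_right[symmetric] mult.assoc)
  show "m \<rhd> (a * b) = (m \<rhd> a) * b" "(a * b) \<lhd> m = a * (b \<lhd> m)" by (fact 1 2)+
  show "(m \<rhd> a) \<lhd> n = m \<rhd> (a \<lhd> n)"
    by (rule nondegenerate_left_eqI[OF assms]) (simp add: mult_left_right[symmetric] 1[symmetric])
qed

text \<open>Since \<open>(a \<lhd> m) * c = a * (m \<rhd> c)\<close>, the left action determines
  \<open>a \<lhd> m\<close> up to an element annihilating every \<open>c\<close>, and such an
  element is zero.\<close>

lemma multiplier_left_eqI:
  assumes "nondegenerate_algebra TYPE('a::complex_algebra)" "\<And>a::'a. m \<rhd> a = n \<rhd> a"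
  shows "m = n"
proof (rule multiplier_eqI)
  show "a \<lhd> m = a \<lhd> n" for a
    by (rule nondegenerate_left_eqI[OF assms(1)]) (simp add: assms(2) flip: mult_left_right)
qed (rule assms)

lemma multiplier_right_eqI:
  assumes "nondegenerate_algebra TYPE('a::complex_algebra)" "\<And>a::'a. a \<lhd> m = a \<lhd> n"
  shows "m = n"
proof (rule multiplier_eqI)
  show "m \<rhd> a = n \<rhd> a" for a
    by (rule nondegenerate_right_eqI[OF assms(1)]) (simp add: assms(2) mult_left_right)
qed (rule assms)

lemma of_alg_mult_left:
  assumes "nondegenerate_algebra TYPE('a::complex_algebra)"
  shows "m * of_alg (a::'a) = of_alg (m \<rhd> a)"
  by (rule multiplier_left_eqI[OF assms]) (simp add: mult_left_times[OF assms])

lemma of_alg_mult_right: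
  assumes "nondegenerate_algebra TYPE('a::complex_algebra)"
  shows "of_alg (a::'a) * m = of_alg (a \<lhd> m)"
  by (rule multiplier_left_eqI[OF assms]) (simp add: mult_left_right)

lemma inj_of_alg:
  assumes "nondegenerate_algebra TYPE('a::complex_algebra)"
  shows "inj (of_alg :: 'a \<Rightarrow> _)"
proof (rule injI)
  fix a b :: 'a assume "of_alg a = of_alg b"
  hence "of_alg a \<rhd> c = of_alg b \<rhd> c" for c by simp
  hence "a * c = b * c" for c by simp
  thus "a = b" by (rule nondegenerate_left_eqI[OF assms])
qed

lemma to_alg_of_alg:
  assumes "nondegenerate_algebra TYPE('a::complex_algebra)"
  shows "to_alg (of_alg (a::'a)) = a"
  unfolding to_alg_def using inj_of_alg[OF assms] by (auto dest: injD)

lemma mult_tensor_mult: "(m \<otimes>\<^sub>m n) * (m' \<otimes>\<^sub>m n') = (m * m') \<otimes>\<^sub>m (n * n')"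
proof (rule multiplier_eqI)
  fix x :: "('a, 'b) tensor"
  show "((m \<otimes>\<^sub>m n) * (m' \<otimes>\<^sub>m n')) \<rhd> x = (m * m') \<otimes>\<^sub>m (n * n') \<rhd> x"
    by (induction x rule: tensor_induct) (simp_all add: mult_tensor_pure mult_left_add)
  show "x \<lhd> ((m \<otimes>\<^sub>m n) * (m' \<otimes>\<^sub>m n')) = x \<lhd> ((m * m') \<otimes>\<^sub>m (n * n'))"
    by (induction x rule: tensor_induct) (simp_all add: mult_tensor_pure mult_right_add)
qed

lemma tensor_multiplier_eqI:
  assumes "\<And>a b. m \<rhd> (a \<otimes> b) = n \<rhd> (a \<otimes> b)" "\<And>a b. (a \<otimes> b) \<lhd> m = (a \<otimes> b) \<lhd> n"
  shows "m = n"
proof (rule multiplier_eqI)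
  show "m \<rhd> x = n \<rhd> x" for x
    by (induction x rule: tensor_induct) (simp_all add: assms mult_left_add)
  show "x \<lhd> m = x \<lhd> n" for x
    by (induction x rule: tensor_induct) (simp_all add: assms mult_right_add)
qed

lemma mult_tensor_one [simp]: "1 \<otimes>\<^sub>m 1 = 1"
  by (rule tensor_multiplier_eqI) (simp_all add: mult_tensor_pure)

lemma mult_tensor_bilinear:
  "(m + m') \<otimes>\<^sub>m n = m \<otimes>\<^sub>m n + m' \<otimes>\<^sub>m n" "m \<otimes>\<^sub>m (n + n') = m \<otimes>\<^sub>m n + m \<otimes>\<^sub>m n'"
  "(c *\<^sub>C m) \<otimes>\<^sub>m n = c *\<^sub>C (m \<otimes>\<^sub>m n)" "m \<otimes>\<^sub>m (c *\<^sub>C n) = c *\<^sub>C (m \<otimes>\<^sub>m n)"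
  by (rule tensor_multiplier_eqI; simp add: mult_tensor_pure pure_tensor_bilinear)+

lemma mult_tensor_zero [simp]: "0 \<otimes>\<^sub>m n = 0" "m \<otimes>\<^sub>m 0 = 0"
  by (rule tensor_multiplier_eqI; simp add: mult_tensor_pure)+

lemma mult_tensor_of_alg: "of_alg a \<otimes>\<^sub>m of_alg b = of_alg (a \<otimes> b)"
  by (rule tensor_multiplier_eqI) (simp_all add: mult_tensor_pure pure_times_pure)

section \<open>Leg numbering\<close>

lemma iso_multiplier_eqI:
  assumes "algebra_iso \<phi>" "\<And>a. m \<rhd> \<phi> a = n \<rhd> \<phi> a" "\<And>a. \<phi> a \<lhd> m = \<phi> a \<lhd> n"
  shows "m = n"
proof -
  have "\<exists>a. b = \<phi> a" for b
    using assms(1) unfolding algebra_iso_def by (metis bij_pointE)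
  thus ?thesis using assms(2,3) by (metis multiplier_eqI)
qed

lemma mult_transport_times:
  assumes "algebra_iso \<phi>"
  shows "mult_transport \<phi> (m * n) = mult_transport \<phi> m * mult_transport \<phi> n"
  by (rule iso_multiplier_eqI[OF assms]) (simp_all add: mult_transport_actions[OF assms])

lemma clinear_mult_transport:
  assumes "algebra_iso \<phi>"
  shows "clinear (mult_transport \<phi>)"
proof (rule clinearI)
  have lin: "clinear \<phi>" using assms unfolding algebra_iso_def by blast
  show "mult_transport \<phi> (m + n) = mult_transport \<phi> m + mult_transport \<phi> n" for m n
    using assms by (rule iso_multiplier_eqI)
        (simp_all add: mult_transport_actions[OF assms] clinear_add[OF lin])
  show "mult_transport \<phi> (c *\<^sub>C m) = c *\<^sub>C mult_transport \<phi> m" for c m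
    using assms by (rule iso_multiplier_eqI)
        (simp_all add: mult_transport_actions[OF assms] clinear_scaleC[OF lin])
qed

lemma mult_transport_of_alg:
  assumes "algebra_iso \<phi>"
  shows "mult_transport \<phi> (of_alg a) = of_alg (\<phi> a)"
proof -
  have "\<phi> (x * y) = \<phi> x * \<phi> y" for x y using assms unfolding algebra_iso_def by blast
  thus ?thesis using assms by (intro iso_multiplier_eqI[OF assms])
      (simp_all add: mult_transport_actions[OF assms])
qed

lemma triple_multiplier_eqI:
  assumes "\<And>a b c. m \<rhd> (a \<otimes> b \<otimes> c) = n \<rhd> (a \<otimes> b \<otimes> c)"
    "\<And>a b c. (a \<otimes> b \<otimes> c) \<lhd> m = (a \<otimes> b \<otimes> c) \<lhd> n"
  shows "m = n"
proof (rule tensor_multiplier_eqI)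
  fix a x
  show "m \<rhd> (a \<otimes> x) = n \<rhd> (a \<otimes> x)"
    by (induction x rule: tensor_induct) (simp_all add: assms mult_left_add pure_tensor_bilinear)
  show "(a \<otimes> x) \<lhd> m = (a \<otimes> x) \<lhd> n"
    by (induction x rule: tensor_induct) (simp_all add: assms mult_right_add pure_tensor_bilinear)
qed

lemma transport_triple:
  "mult_transport tensor_assoc m \<rhd> (a \<otimes> b \<otimes> c) = tensor_assoc (m \<rhd> ((a \<otimes> b) \<otimes> c))"
  "(a \<otimes> b \<otimes> c) \<lhd> mult_transport tensor_assoc m = tensor_assoc (((a \<otimes> b) \<otimes> c) \<lhd> m)"
  "mult_transport tensor_swap23 n \<rhd> (a \<otimes> d \<otimes> c) = tensor_swap23 (n \<rhd> ((a \<otimes> c) \<otimes> d))"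
  "(a \<otimes> d \<otimes> c) \<lhd> mult_transport tensor_swap23 n = tensor_swap23 (((a \<otimes> c) \<otimes> d) \<lhd> n)"
  by (simp_all flip: mult_transport_actions[OF algebra_iso_assoc]
      mult_transport_actions[OF algebra_iso_swap23]
      add: tensor_assoc_pure tensor_swap23_pure)

lemma transport_assoc_pure:
  "mult_transport tensor_assoc ((m \<otimes>\<^sub>m n) \<otimes>\<^sub>m k) = m \<otimes>\<^sub>m n \<otimes>\<^sub>m k"
  by (rule triple_multiplier_eqI)
    (simp_all add: transport_triple mult_tensor_pure tensor_assoc_pure)

lemma transport_swap23_pure:
  "mult_transport tensor_swap23 ((m \<otimes>\<^sub>m n) \<otimes>\<^sub>m k) = m \<otimes>\<^sub>m k \<otimes>\<^sub>m n"
  by (rule triple_multiplier_eqI)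
    (simp_all add: transport_triple mult_tensor_pure tensor_swap23_pure)

lemma leg_times:
  "leg12 (m * n) = leg12 m * leg12 n" "leg23 (m * n) = leg23 m * leg23 n"
  "leg13 (m * n) = leg13 m * leg13 n"
  by (simp_all add: leg12_def leg23_def leg13_def mult_tensor_mult
      flip: mult_transport_times[OF algebra_iso_assoc] mult_transport_times[OF algebra_iso_swap23])

lemma leg_pure:
  "leg12 (m \<otimes>\<^sub>m n) = m \<otimes>\<^sub>m n \<otimes>\<^sub>m 1" "leg23 (m \<otimes>\<^sub>m n) = 1 \<otimes>\<^sub>m m \<otimes>\<^sub>m n"
  "leg13 (m \<otimes>\<^sub>m n) = m \<otimes>\<^sub>m 1 \<otimes>\<^sub>m n"
  by (simp_all add: leg12_def leg23_def leg13_def transport_assoc_pure transport_swap23_pure)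

text \<open>Both orders give the same transported tensor, so a multiplier in the third leg commutes
  with any multiplier in the first two.\<close>

lemma leg12_third:
  "leg12 m * (1 \<otimes>\<^sub>m 1 \<otimes>\<^sub>m k) = mult_transport tensor_assoc (m \<otimes>\<^sub>m k)"
  "(1 \<otimes>\<^sub>m 1 \<otimes>\<^sub>m k) * leg12 m = mult_transport tensor_assoc (m \<otimes>\<^sub>m k)"
  unfolding leg12_def transport_assoc_pure[symmetric]
  by (simp_all add: mult_tensor_mult flip: mult_transport_times[OF algebra_iso_assoc])

lemma leg13_second:
  "leg13 m * (1 \<otimes>\<^sub>m k \<otimes>\<^sub>m 1) = mult_transport tensor_swap23 (m \<otimes>\<^sub>m k)"
  "(1 \<otimes>\<^sub>m k \<otimes>\<^sub>m 1) * leg13 m = mult_transport tensor_swap23 (m \<otimes>\<^sub>m k)"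
  unfolding leg13_def transport_swap23_pure[symmetric]
  by (simp_all add: mult_tensor_mult flip: mult_transport_times[OF algebra_iso_swap23])

lemma leg23_first:
  "leg23 m * (k \<otimes>\<^sub>m 1) = k \<otimes>\<^sub>m m" "(k \<otimes>\<^sub>m 1) * leg23 m = k \<otimes>\<^sub>m m"
  by (simp_all add: leg23_def mult_tensor_mult)

lemma leg12_of_alg_third:
  "leg12 (of_alg x) * (1 \<otimes>\<^sub>m 1 \<otimes>\<^sub>m of_alg c) = of_alg (tensor_assoc (x \<otimes> c))"
  by (simp add: leg12_third mult_tensor_of_alg mult_transport_of_alg[OF algebra_iso_assoc])

lemma leg13_of_alg_second:
  "leg13 (of_alg x) * (1 \<otimes>\<^sub>m of_alg b \<otimes>\<^sub>m 1) = of_alg (tensor_swap23 (x \<otimes> b))"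
  "(1 \<otimes>\<^sub>m of_alg b \<otimes>\<^sub>m 1) * leg13 (of_alg x) = of_alg (tensor_swap23 (x \<otimes> b))"
  by (simp_all add: leg13_second mult_tensor_of_alg mult_transport_of_alg[OF algebra_iso_swap23])

lemma on_legs12_assoc:
  assumes "clinear T"
  shows "on_legs12 T (tensor_assoc (x \<otimes> c)) = tensor_assoc (T x \<otimes> c)"
proof -
  have "inj (tensor_assoc :: (('a, 'a) tensor, 'a) tensor \<Rightarrow> _)"
    using algebra_iso_assoc unfolding algebra_iso_def by (blast dest: bij_is_inj)
  thus ?thesis
    unfolding on_legs12_def by (simp add: inv_f_f tensor_map_pure[OF assms clinear_id])
qed

lemma clinear_on_legs12:
  assumes "clinear T"
  shows "clinear (on_legs12 T)"
proof -
  have *: "bij (tensor_assoc :: (('a, 'a) tensor, 'a) tensor \<Rightarrow> _)"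
    using algebra_iso_assoc unfolding algebra_iso_def by blast
  have "clinear (inv (tensor_assoc :: (('a, 'a) tensor, 'a) tensor \<Rightarrow> _))"
    using clinear_tensor_assoc bij_is_surj[OF *] bij_is_inj[OF *]
    by (intro clinearI inv_f_eq)
      (simp_all add: clinear_add[OF clinear_tensor_assoc] clinear_scaleC[OF clinear_tensor_assoc]
          surj_f_inv_f)
  thus ?thesis unfolding on_legs12_def
    by (intro clinear_compose[OF clinear_tensor_assoc]
        clinear_compose[OF clinear_tensor_map[OF assms clinear_id]])
qed

lemma clinear_on_legs23: "clinear T \<Longrightarrow> clinear (on_legs23 T)"
  unfolding on_legs23_def by (rule clinear_tensor_map[OF clinear_id])

lemma on_legs23_pure: "clinear T \<Longrightarrow> on_legs23 T (a \<otimes> x) = a \<otimes> T x"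
  unfolding on_legs23_def by (simp add: tensor_map_pure[OF clinear_id])

section \<open>Canonical maps\<close>

lemma opposite_comult_actions:
  "opposite_comult \<Delta> a * (1 \<otimes>\<^sub>m n) = mult_transport tensor_flip (\<Delta> a * (n \<otimes>\<^sub>m 1))"
  "(n \<otimes>\<^sub>m 1) * opposite_comult \<Delta> a = mult_transport tensor_flip ((1 \<otimes>\<^sub>m n) * \<Delta> a)"
proof -
  have "mult_transport tensor_flip (m \<otimes>\<^sub>m k) = k \<otimes>\<^sub>m m" for m k :: "'a multiplier"
    by (rule tensor_multiplier_eqI)
      (simp_all add: mult_transport_actions(1)[OF algebra_iso_flip, where a = "_ \<otimes> _", unfolded
          tensor_flip_pure]
        mult_transport_actions(2)[OF algebra_iso_flip, where a = "_ \<otimes> _", unfolded tensor_flip_pure]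
        mult_tensor_pure tensor_flip_pure)
  thus "opposite_comult \<Delta> a * (1 \<otimes>\<^sub>m n) = mult_transport tensor_flip (\<Delta> a * (n \<otimes>\<^sub>m 1))"
    "(n \<otimes>\<^sub>m 1) * opposite_comult \<Delta> a = mult_transport tensor_flip ((1 \<otimes>\<^sub>m n) * \<Delta> a)"
    by (simp_all add: opposite_comult_def mult_transport_times[OF algebra_iso_flip])
qed

text \<open>\<open>to_alg\<close> is meaningful only on the range of \<open>of_alg\<close>.
  Bilinearity is therefore checked after applying the injective map \<open>of_alg\<close>, where
  \<open>h\<close> itself reappears.\<close>

lemma clinear_to_alg_lift:
  fixes h :: "'b::complex_vector \<Rightarrow> 'c::complex_vector \<Rightarrow> 'd::complex_algebra multiplier"
  assumes "nondegenerate_algebra TYPE('d)" "cbilinear h" "\<And>a b. h a b \<in> range of_alg"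
  shows "clinear (tensor_lift (\<lambda>a b. to_alg (h a b)))"
    and "of_alg (tensor_lift (\<lambda>a b. to_alg (h a b)) (a \<otimes> b)) = h a b"
proof -
  have h: "of_alg (to_alg (h a b)) = h a b" for a b
    using assms(3)[of a b] by (auto simp: to_alg_of_alg[OF assms(1)])
  have bil: "h (a + a') b = h a b + h a' b" "h (c *\<^sub>C a) b = c *\<^sub>C h a b"
    "h a (b' + b'') = h a b' + h a b''" "h a (c *\<^sub>C b') = c *\<^sub>C h a b'" for a a' b b' b'' c
    using assms(2) unfolding cbilinear_def clinear_iff by blast+
  have "cbilinear (\<lambda>a b. to_alg (h a b))"
    by (rule cbilinearI; rule injD[OF inj_of_alg[OF assms(1)]])
      (simp_all only: h of_alg_add of_alg_scaleC, simp_all only: bil)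
  thus "clinear (tensor_lift (\<lambda>a b. to_alg (h a b)))"
    "of_alg (tensor_lift (\<lambda>a b. to_alg (h a b)) (a \<otimes> b)) = h a b"
    by (simp_all add: clinear_tensor_lift tensor_lift_pure h)
qed

lemma
  fixes \<Delta> :: "'a::complex_algebra comult"
  assumes N: "nondegenerate_algebra TYPE('a)" and lin: "clinear \<Delta>" and wd: "canon_well_defined \<Delta>"
  shows clinear_canon: "clinear (canon1 \<Delta>)" "clinear (canon2 \<Delta>)" "clinear (canon3 \<Delta>)" "clinear (canon4 \<Delta>)"
    and canon1_pure: "of_alg (canon1 \<Delta> (a \<otimes> b)) = \<Delta> a * (1 \<otimes>\<^sub>m of_alg b)"
    and canon2_pure: "of_alg (canon2 \<Delta> (a \<otimes> b)) = (of_alg a \<otimes>\<^sub>m 1) * \<Delta> b"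
    and canon3_pure: "of_alg (canon3 \<Delta> (a \<otimes> b)) = (1 \<otimes>\<^sub>m of_alg b) * \<Delta> a"
    and canon4_pure: "of_alg (canon4 \<Delta> (a \<otimes> b)) = \<Delta> b * (of_alg a \<otimes>\<^sub>m 1)"
proof -
  note NN = nondegenerate_tensor[OF N N]
  note lin = clinear_add[OF lin] clinear_scaleC[OF lin] of_alg_add of_alg_scaleC mult_tensor_bilinear
    distrib_left distrib_right mult_scaleC_left mult_scaleC_right
  note wd = wd[unfolded canon_well_defined_def, rule_format]
  have bil: "cbilinear (\<lambda>a b. \<Delta> a * (1 \<otimes>\<^sub>m of_alg b))" "cbilinear (\<lambda>a b. (of_alg a \<otimes>\<^sub>m 1) * \<Delta> b)"
    "cbilinear (\<lambda>a b. (1 \<otimes>\<^sub>m of_alg b) * \<Delta> a)" "cbilinear (\<lambda>a b. \<Delta> b * (of_alg a \<otimes>\<^sub>m 1))"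
    by (rule cbilinearI; simp add: lin)+
  show "clinear (canon1 \<Delta>)" "of_alg (canon1 \<Delta> (a \<otimes> b)) = \<Delta> a * (1 \<otimes>\<^sub>m of_alg b)"
    unfolding canon1_def by (intro clinear_to_alg_lift[OF NN] bil; use wd in blast)+
  show "clinear (canon2 \<Delta>)" "of_alg (canon2 \<Delta> (a \<otimes> b)) = (of_alg a \<otimes>\<^sub>m 1) * \<Delta> b"
    unfolding canon2_def by (intro clinear_to_alg_lift[OF NN] bil; use wd in blast)+
  show "clinear (canon3 \<Delta>)" "of_alg (canon3 \<Delta> (a \<otimes> b)) = (1 \<otimes>\<^sub>m of_alg b) * \<Delta> a"
    unfolding canon3_def by (intro clinear_to_alg_lift[OF NN] bil; use wd in blast)+
  show "clinear (canon4 \<Delta>)" "of_alg (canon4 \<Delta> (a \<otimes> b)) = \<Delta> b * (of_alg a \<otimes>\<^sub>m 1)"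
    unfolding canon4_def by (intro clinear_to_alg_lift[OF NN] bil; use wd in blast)+
qed

lemma tensor_lift_eq: "clinear F \<Longrightarrow> tensor_lift (\<lambda>a b. F (a \<otimes> b)) = F"
proof -
  assume F: "clinear F"
  hence bil: "cbilinear (\<lambda>a b. F (a \<otimes> b))"
    by (intro cbilinearI) (simp_all add: clinear_add clinear_scaleC pure_tensor_bilinear)
  show ?thesis by (rule clinear_tensor_eqI[OF clinear_tensor_lift[OF bil] F])
      (rule tensor_lift_pure[OF bil])
qed

text \<open>The flip turns a factor in one leg into a factor in the other. Two of the four
  bijections are assumed for the opposite coproduct, and this translates them into statements on
  \<open>canon4\<close> and \<open>canon3\<close>.\<close>

lemma canon_opposite:
  fixes \<Delta> :: "'a::complex_algebra comult"
  assumes N: "nondegenerate_algebra TYPE('a)" and lin: "clinear \<Delta>" and wd: "canon_well_defined \<Delta>"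
  shows "canon1 (opposite_comult \<Delta>) = tensor_flip \<circ> canon4 \<Delta> \<circ> tensor_flip"
    "canon2 (opposite_comult \<Delta>) = tensor_flip \<circ> canon3 \<Delta> \<circ> tensor_flip"
proof -
  note NN = nondegenerate_tensor[OF N N]
  note F = clinear_compose[OF clinear_tensor_flip clinear_compose[OF clinear_canon(4)[OF assms]
      clinear_tensor_flip]]
    clinear_compose[OF clinear_tensor_flip clinear_compose[OF clinear_canon(3)[OF assms]
        clinear_tensor_flip]]
  show "canon1 (opposite_comult \<Delta>) = tensor_flip \<circ> canon4 \<Delta> \<circ> tensor_flip"
    using tensor_lift_eq[OF F(1)]
    unfolding canon1_def opposite_comult_actions canon4_pure[OF assms, symmetric]
      mult_transport_of_alg[OF algebra_iso_flip] to_alg_of_alg[OF NN] tensor_flip_pure comp_def .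
  show "canon2 (opposite_comult \<Delta>) = tensor_flip \<circ> canon3 \<Delta> \<circ> tensor_flip"
    using tensor_lift_eq[OF F(2)]
    unfolding canon2_def opposite_comult_actions canon3_pure[OF assms, symmetric]
      mult_transport_of_alg[OF algebra_iso_flip] to_alg_of_alg[OF NN] tensor_flip_pure comp_def .
qed

lemma
  fixes \<Delta> :: "'a::complex_algebra comult"
  assumes "clinear \<Delta>"
  shows clinear_comult_id: "clinear (comult_id \<Delta>)"
    and comult_id_pure: "comult_id \<Delta> (a \<otimes> b) = leg12 (\<Delta> a) * (1 \<otimes>\<^sub>m 1 \<otimes>\<^sub>m of_alg b)"
    and clinear_id_comult: "clinear (id_comult \<Delta>)"
    and id_comult_pure: "id_comult \<Delta> (a \<otimes> b) = leg23 (\<Delta> b) * (of_alg a \<otimes>\<^sub>m 1)"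
proof -
  note lin = clinear_add[OF assms] clinear_scaleC[OF assms] of_alg_add of_alg_scaleC mult_tensor_bilinear
    clinear_add[OF clinear_mult_transport[OF algebra_iso_assoc]]
    clinear_scaleC[OF clinear_mult_transport[OF algebra_iso_assoc]]
  have bil: "cbilinear (\<lambda>a b. mult_transport tensor_assoc (\<Delta> a \<otimes>\<^sub>m of_alg b))"
    "cbilinear (\<lambda>a b. of_alg a \<otimes>\<^sub>m \<Delta> b)"
    by (rule cbilinearI; simp add: lin)+
  show "clinear (comult_id \<Delta>)" "clinear (id_comult \<Delta>)"
    "comult_id \<Delta> (a \<otimes> b) = leg12 (\<Delta> a) * (1 \<otimes>\<^sub>m 1 \<otimes>\<^sub>m of_alg b)"
    "id_comult \<Delta> (a \<otimes> b) = leg23 (\<Delta> b) * (of_alg a \<otimes>\<^sub>m 1)"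
    unfolding comult_id_def id_comult_def leg12_third leg23_first
    using clinear_tensor_lift[OF bil(1)] tensor_lift_pure[OF bil(1)]
      clinear_tensor_lift[OF bil(2)] tensor_lift_pure[OF bil(2)] by auto
qed

lemma tensor_multiplicativeI:
  fixes f :: "('a::complex_algebra, 'b::complex_algebra) tensor \<Rightarrow> 'c::complex_algebra"
  assumes lin: "clinear f" and "\<And>a b a' b'. f ((a * a') \<otimes> (b * b')) = f (a \<otimes> b) * f (a' \<otimes> b')"
  shows "f (x * y) = f x * f y"
proof (induction x rule: tensor_induct)
  case (pure a b)
  show ?case
    by (induction y rule: tensor_induct)
        (simp_all add: pure_times_pure assms clinear_add[OF lin] distrib_left)
qed (simp add: clinear_add[OF lin] distrib_right)

lemma
  fixes \<Delta> :: "'a::complex_algebra comult"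
  assumes lin: "clinear \<Delta>" and mult: "\<And>a b. \<Delta> (a * b) = \<Delta> a * \<Delta> b"
  shows comult_id_times: "comult_id \<Delta> (x * y) = comult_id \<Delta> x * comult_id \<Delta> y"
    and id_comult_times: "id_comult \<Delta> (x * y) = id_comult \<Delta> x * id_comult \<Delta> y"
  by (rule tensor_multiplicativeI[OF clinear_comult_id[OF lin]],
      simp add: comult_id_pure[OF lin] leg12_third mult of_alg_times mult_tensor_mult
        flip: mult_transport_times[OF algebra_iso_assoc])
    (rule tensor_multiplicativeI[OF clinear_id_comult[OF lin]],
      simp add: id_comult_pure[OF lin] leg23_first mult of_alg_times mult_tensor_mult)

section \<open>Extensions to multipliers\<close>

text \<open>Uniqueness: a solution is determined on the vectors \<open>f c \<rhd> w\<close>, these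
  span the range of \<open>e\<close>, and a solution is unchanged by right multiplication with
  \<open>e\<close>. Its left action is thus determined everywhere.\<close>

lemma multiplier_extension_eqI:
  assumes N: "nondegenerate_algebra TYPE('d::complex_algebra)"
    and span: "\<And>z :: 'd. e \<rhd> z \<in> cspan {f c \<rhd> w | c w. c \<in> C}"
    and n: "e * n = n" "n * e = n" "\<And>c. c \<in> C \<Longrightarrow> n * f c = f (m \<rhd> c)"
      "\<And>c. c \<in> C \<Longrightarrow> f c * n = f (c \<lhd> m)"
  shows "multiplier_extension C f e m = n"
  unfolding multiplier_extension_def
proof (rule the_equality)
  fix n' assume n': "e * n' = n' \<and> n' * e = n' \<and> (\<forall>c\<in>C. n' * f c = f (m \<rhd> c) \<and> f c * n' = f (c \<lhd> m))"
  show "n' = n"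
  proof (rule multiplier_left_eqI[OF N])
    fix z
    have "n' \<rhd> e \<rhd> z = n \<rhd> e \<rhd> z"
    proof (rule clinear_eq_on_span[OF mult_left_linear mult_left_linear _ span])
      fix y assume "y \<in> {f c \<rhd> w | c w. c \<in> C}"
      then obtain c w where "y = f c \<rhd> w" "c \<in> C" by blast
      thus "n' \<rhd> y = n \<rhd> y" using n n' by (simp flip: multiplier_actions(1))
    qed
    thus "n' \<rhd> z = n \<rhd> z" using n n' by (metis multiplier_actions(1))
  qed
qed (use n in blast)

text \<open>The multiplier has to send \<open>f c \<rhd> w\<close> to
  \<open>f (m \<rhd> c) \<rhd> w\<close> and \<open>w \<lhd> f c\<close> to
  \<open>w \<lhd> f (c \<lhd> m)\<close>. That these prescriptions are well defined follows by
  pairing one with the other and using non-degeneracy. Without existence, an equation between two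
  definite descriptions would carry no information.\<close>

lemma multiplier_extension_exists:
  fixes f :: "'c::complex_algebra \<Rightarrow> 'd::complex_algebra multiplier"
  assumes N: "nondegenerate_algebra TYPE('d)"
    and lin: "clinear f" and mult: "\<And>x y. f (x * y) = f x * f y"
    and e: "e * e = e" "\<And>c. c \<in> C \<Longrightarrow> e * f c = f c" "\<And>c. c \<in> C \<Longrightarrow> f c * e = f c"
    and span: "\<And>z. e \<rhd> z \<in> cspan {f c \<rhd> w | c w. c \<in> C}"
      "\<And>z. z \<lhd> e \<in> cspan {w \<lhd> f c | c w. c \<in> C}"
    and m: "\<And>c. c \<in> C \<Longrightarrow> m \<rhd> c \<in> C" "\<And>c. c \<in> C \<Longrightarrow> c \<lhd> m \<in> C"
  obtains n where "e * n = n" "n * e = n" "\<And>c. c \<in> C \<Longrightarrow> n * f c = f (m \<rhd> c)"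
    "\<And>c. c \<in> C \<Longrightarrow> f c * n = f (c \<lhd> m)" "multiplier_extension C f e m = n"
proof -
  define S where "S = tensor_subspace C (UNIV :: 'd set)"
  have pure_S: "c \<otimes> z \<in> S" if "c \<in> C" for c z
    unfolding S_def tensor_subspace_def using that by (auto intro: cvec.span_base)
  have sub: "csubspace S" unfolding S_def tensor_subspace_def by (rule cvec.subspace_span)
  have bil: "cbilinear (\<lambda>c z. f (g c) \<rhd> z)" "cbilinear (\<lambda>c z. z \<lhd> f (g c))" if "clinear g" for g
    by (rule cbilinearI; simp add: clinear_add[OF lin] clinear_scaleC[OF lin] clinear_add[OF that]
        clinear_scaleC[OF that] mult_left_add mult_right_add mult_left_scaleC mult_right_scaleC)+
  \<comment> \<open>Sums of vectors \<open>f c \<rhd> z\<close> or \<open>z \<lhd> f c\<close> are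
    parametrised by tensors in \<open>S\<close>: \<open>p\<close> and \<open>p'\<close> evaluate
    such a sum, \<open>q\<close> and \<open>q'\<close> evaluate its prescribed image.\<close>
  define p q p' q' where "p = tensor_lift (\<lambda>c z. f c \<rhd> z)" and "q = tensor_lift (\<lambda>c z. f (m \<rhd> c) \<rhd> z)"
    and "p' = tensor_lift (\<lambda>c z. z \<lhd> f c)" and "q' = tensor_lift (\<lambda>c z. z \<lhd> f (c \<lhd> m))"
  have linear: "clinear p" "clinear q" "clinear p'" "clinear q'"
    unfolding p_def q_def p'_def q'_def
    using clinear_tensor_lift[OF bil(1)[OF clinear_ident]]
        clinear_tensor_lift[OF bil(1)[OF mult_left_linear]]
      clinear_tensor_lift[OF bil(2)[OF clinear_ident]]
          clinear_tensor_lift[OF bil(2)[OF mult_right_linear]]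
    by auto
  have pure: "p (c \<otimes> z) = f c \<rhd> z" "q (c \<otimes> z) = f (m \<rhd> c) \<rhd> z" "p' (c \<otimes> z) = z \<lhd> f c"
    "q' (c \<otimes> z) = z \<lhd> f (c \<lhd> m)" for c z
    unfolding p_def q_def p'_def q'_def
    using tensor_lift_pure[OF bil(1)[OF clinear_ident]] tensor_lift_pure[OF bil(1)[OF mult_left_linear]]
      tensor_lift_pure[OF bil(2)[OF clinear_ident]] tensor_lift_pure[OF bil(2)[OF mult_right_linear]]
    by auto
  note add = clinear_add[OF linear(1)] clinear_add[OF linear(2)] clinear_add[OF linear(3)]
      clinear_add[OF linear(4)]
  have eq_S: "F t = G t" if "clinear F" "clinear G" "\<And>c z. c \<in> C \<Longrightarrow> F (c \<otimes> z) = G (c \<otimes> z)" "t \<in> S"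
      for F G :: "_ \<Rightarrow> 'd" and t
    using that(4) unfolding S_def tensor_subspace_def
    by (rule clinear_eq_on_span[OF that(1,2), rotated]) (use that(3) in auto)
  have e': "e \<rhd> f c \<rhd> z = f c \<rhd> z" "z \<lhd> f c \<lhd> e = z \<lhd> f c" if "c \<in> C" for c z
    using e(2,3)[OF that] by (metis multiplier_actions(1), metis multiplier_actions(2))
  have q_e: "e \<rhd> q t = q t" "q' t \<lhd> e = q' t" if "t \<in> S" for t
    by (rule eq_S[OF clinear_compose[OF mult_left_linear linear(2)] linear(2) _ that], simp add: pure e'
        m,
        rule eq_S[OF clinear_compose[OF mult_right_linear linear(4)] linear(4) _ that], simp add: pure
            e' m)
  have fq: "f c \<rhd> q t = f (c \<lhd> m) \<rhd> p t" for c t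
    by (induction t rule: tensor_induct)
      (simp_all add: pure add mult_left_add mult_left_right flip: multiplier_actions(1) mult)
  \<comment> \<open>This pairing identity yields both the well-definedness of the two actions and
    their compatibility \<open>w * l z = r w * z\<close>.\<close>
  have pq: "p' u * q t = q' u * p t" for u t
    by (induction u rule: tensor_induct)
      (simp_all add: pure add distrib_right fq flip: mult_left_right)
  have "cspan {f c \<rhd> w | c w. c \<in> C} \<subseteq> p ` S"
    by (rule cvec.span_minimal[OF _ cvec_pair.linear_subspace_image[OF linear(1) sub]])
      (auto simp: pure_S simp flip: pure(1))
  moreover have "cspan {w \<lhd> f c | c w. c \<in> C} \<subseteq> p' ` S"
    by (rule cvec.span_minimal[OF _ cvec_pair.linear_subspace_image[OF linear(3) sub]])
      (auto simp: pure_S simp flip: pure(3))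
  ultimately have "e \<rhd> z \<in> p ` S" "z \<lhd> e \<in> p' ` S" for z
    using span(1)[of z] span(2)[of z] by blast+
  hence "\<forall>z. \<exists>t. t \<in> S \<and> p t = e \<rhd> z" "\<forall>z. \<exists>t. t \<in> S \<and> p' t = z \<lhd> e"
    unfolding image_iff by (blast intro: sym)+
  then obtain s s' where s: "\<And>z. s z \<in> S" "\<And>z. p (s z) = e \<rhd> z"
    and s': "\<And>z. s' z \<in> S" "\<And>z. p' (s' z) = z \<lhd> e"
    by (auto dest!: choice)
  define l r where "l z = q (s z)" and "r z = q' (s' z)" for z
  \<comment> \<open>If \<open>p t = 0\<close>, then
    \<open>w * q t = p' (s' w) * q t = q' (s' w) * p t = 0\<close> for every \<open>w\<close>; the
    first equality holds because \<open>e\<close> fixes \<open>q t\<close>.\<close>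
  have q0: "q t = 0" if "t \<in> S" "p t = 0" for t
  proof (rule nondegenerate_right_zeroI[OF N])
    fix w
    have "w * q t = p' (s' w) * q t" using q_e(1)[OF that(1)] by (metis mult_left_right s'(2))
    thus "w * q t = 0" by (simp add: pq that(2))
  qed
  have l: "q t = l z" if "t \<in> S" "p t = e \<rhd> z" for t z
  proof -
    have "q (t - s z) = 0"
      using that s cvec.subspace_diff[OF sub]
      by (intro q0) (simp_all add: clinear_diff[OF linear(1)])
    thus ?thesis by (simp add: clinear_diff[OF linear(2)] l_def)
  qed
  have q'0: "q' t = 0" if "t \<in> S" "p' t = 0" for t
  proof (rule nondegenerate_left_zeroI[OF N])
    fix w
    have "q' t * w = q' t * p (s w)" using q_e(2)[OF that(1)] by (metis mult_left_right s(2))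
    thus "q' t * w = 0" by (simp add: that(2) flip: pq)
  qed
  have r: "q' t = r z" if "t \<in> S" "p' t = z \<lhd> e" for t z
  proof -
    have "q' (t - s' z) = 0"
      using that s' cvec.subspace_diff[OF sub]
      by (intro q'0) (simp_all add: clinear_diff[OF linear(3)])
    thus ?thesis by (simp add: clinear_diff[OF linear(4)] r_def)
  qed
  have "clinear l"
  proof (rule clinearI)
    show "l (x + y) = l x + l y" for x y
      using l[of "s x + s y" "x + y"] s cvec.subspace_add[OF sub]
      by (simp add: add mult_left_add) (simp add: l_def)
    show "l (c *\<^sub>C x) = c *\<^sub>C l x" for c x
      using l[of "c *\<^sub>C s x" "c *\<^sub>C x"] s cvec.subspace_scale[OF sub]
      by (simp add: clinear_scaleC[OF linear(1)] clinear_scaleC[OF linear(2)] mult_left_scaleC)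
          (simp add: l_def)
  qed
  moreover have "clinear r"
  proof (rule clinearI)
    show "r (x + y) = r x + r y" for x y
      using r[of "s' x + s' y" "x + y"] s' cvec.subspace_add[OF sub]
      by (simp add: add mult_right_add) (simp add: r_def)
    show "r (c *\<^sub>C x) = c *\<^sub>C r x" for c x
      using r[of "c *\<^sub>C s' x" "c *\<^sub>C x"] s' cvec.subspace_scale[OF sub]
      by (simp add: clinear_scaleC[OF linear(3)] clinear_scaleC[OF linear(4)] mult_right_scaleC)
          (simp add: r_def)
  qed
  moreover have "w * l z = r w * z" for w z
    using q_e(1)[OF s(1)[of z]] q_e(2)[OF s'(1)[of w]] pq[of "s' w" "s z"]
    unfolding l_def r_def s(2) s'(2) by (metis mult_left_right)
  ultimately have Rep: "Rep_multiplier (Abs_multiplier (l, r)) = (l, r)"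
    by (intro Abs_multiplier_inverse) simp
  define n where "n = Abs_multiplier (l, r)"
  have n: "n \<rhd> z = l z" "z \<lhd> n = r z" for z
    unfolding n_def by (simp_all add: mult_left.rep_eq mult_right.rep_eq Rep)
  have en: "e * n = n"
    by (rule multiplier_left_eqI[OF N]) (simp add: n l_def q_e s)
  have ne: "n * e = n"
    by (rule multiplier_right_eqI[OF N]) (simp add: n r_def q_e s')
  have nf: "n * f c = f (m \<rhd> c)" if "c \<in> C" for c
  proof (rule multiplier_left_eqI[OF N])
    show "(n * f c) \<rhd> z = f (m \<rhd> c) \<rhd> z" for z
      using l[OF pure_S[OF that], of z "f c \<rhd> z"] that by (simp add: n pure e')
  qed
  have fn: "f c * n = f (c \<lhd> m)" if "c \<in> C" for c
  proof (rule multiplier_right_eqI[OF N])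
    show "z \<lhd> (f c * n) = z \<lhd> f (c \<lhd> m)" for z
      using r[OF pure_S[OF that], of z "z \<lhd> f c"] that by (simp add: n pure e')
  qed
  show ?thesis
    using that[OF en ne nf fn] multiplier_extension_eqI[OF N span(1) en ne nf fn] by blast
qed

section \<open>Decompositions and diagonal projections\<close>

text \<open>Stated for bare maps, so that left multiplication by local units, right multiplication
  by them, and the component projections of a grading are all instances. The sum is finite at each
  element, while \<open>I\<close> may be infinite.\<close>

definition decomposition :: "'i set \<Rightarrow> ('i \<Rightarrow> 'a::complex_vector \<Rightarrow> 'a) \<Rightarrow> bool" where
  "decomposition I P \<longleftrightarrow> (\<forall>r\<in>I. clinear (P r)) \<and>
     (\<forall>r\<in>I. \<forall>s\<in>I. \<forall>a. P r (P s a) = (if r = s then P s a else 0)) \<and>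
     (\<forall>a. finite {r\<in>I. P r a \<noteq> 0} \<and> (\<Sum>r | r \<in> I \<and> P r a \<noteq> 0. P r a) = a)"

lemma
  assumes "decomposition I P"
  shows decomposition_linear: "r \<in> I \<Longrightarrow> clinear (P r)"
    and decomposition_idem: "r \<in> I \<Longrightarrow> P r (P r a) = P r a"
    and decomposition_orth: "r \<in> I \<Longrightarrow> s \<in> I \<Longrightarrow> r \<noteq> s \<Longrightarrow> P r (P s a) = 0"
    and decomposition_finite: "finite {r\<in>I. P r a \<noteq> 0}"
    and decomposition_sum: "(\<Sum>r | r \<in> I \<and> P r a \<noteq> 0. P r a) = a"
  using assms unfolding decomposition_def by simp_all

lemma decomposition_eqI:
  assumes "decomposition I P" "clinear f" "clinear g" "\<And>r a. r \<in> I \<Longrightarrow> f (P r a) = g (P r a)"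
  shows "f a = g a"
proof -
  have "f (\<Sum>r | r \<in> I \<and> P r a \<noteq> 0. P r a) = g (\<Sum>r | r \<in> I \<and> P r a \<noteq> 0. P r a)"
    using assms(4) by (simp add: clinear_sum[OF assms(2)] clinear_sum[OF assms(3)])
  thus ?thesis by (simp add: decomposition_sum[OF assms(1)])
qed

lemma decomposition_into:
  assumes "decomposition I P" "csubspace V" "\<And>r. r \<in> I \<Longrightarrow> P r a \<in> V"
  shows "a \<in> V"
proof -
  have "(\<Sum>r | r \<in> I \<and> P r a \<noteq> 0. P r a) \<in> V"
    using assms(3) by (intro cvec.subspace_sum[OF assms(2)]) auto
  thus ?thesis by (simp add: decomposition_sum[OF assms(1)])
qed

lemma tensor_decomposition_eqI:
  fixes F G :: "('a::complex_vector, 'b::complex_vector) tensor \<Rightarrow> 'c::complex_vector"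
  assumes F: "clinear F" and G: "clinear G"
  shows "decomposition I P \<Longrightarrow> (\<And>r a b. r \<in> I \<Longrightarrow> F (P r a \<otimes> b) = G (P r a \<otimes> b)) \<Longrightarrow> F x = G x"
    and "decomposition I Q \<Longrightarrow> (\<And>r a b. r \<in> I \<Longrightarrow> F (a \<otimes> Q r b) = G (a \<otimes> Q r b)) \<Longrightarrow> F x = G x"
proof -
  note lin = clinear_compose[OF F clinear_pure_tensor(1)] clinear_compose[OF F clinear_pure_tensor(2)]
    clinear_compose[OF G clinear_pure_tensor(1)] clinear_compose[OF G clinear_pure_tensor(2)]
  show "F x = G x" if P: "decomposition I P" and eq: "\<And>r a b. r \<in> I \<Longrightarrow> F (P r a \<otimes> b) = G (P r a \<otimes> b)"
  proof (induction x rule: tensor_induct)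
    case (pure a b)
    show ?case by (rule decomposition_eqI[OF P lin(1) lin(3)]) (rule eq)
  qed (simp add: clinear_add[OF F] clinear_add[OF G])
  show "F x = G x" if Q: "decomposition I Q" and eq: "\<And>r a b. r \<in> I \<Longrightarrow> F (a \<otimes> Q r b) = G (a \<otimes> Q r b)"
  proof (induction x rule: tensor_induct)
    case (pure a b)
    show ?case by (rule decomposition_eqI[OF Q lin(2) lin(4)]) (rule eq)
  qed (simp add: clinear_add[OF F] clinear_add[OF G])
qed

text \<open>The sum of all \<open>P r \<otimes> Q r\<close>, made finite on pure tensors by the
  support of the first factor. Both actions of \<open>E\<close> and all four
  \<open>G\<^sub>i\<close> have this form, for suitable choices among left and right units.\<close>

definition diag :: "'i set \<Rightarrow> ('i \<Rightarrow> 'a::complex_vector \<Rightarrow> 'a) \<Rightarrow>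
    ('i \<Rightarrow> 'b::complex_vector \<Rightarrow> 'b) \<Rightarrow> ('a, 'b) tensor \<Rightarrow> ('a, 'b) tensor" where
  "diag I P Q = tensor_lift (\<lambda>a b. \<Sum>r | r \<in> I \<and> P r a \<noteq> 0. P r a \<otimes> Q r b)"

context
  fixes I :: "'i set" and P :: "'i \<Rightarrow> 'a::complex_vector \<Rightarrow> 'a" and Q :: "'i \<Rightarrow> 'b::complex_vector \<Rightarrow> 'b"
  assumes P: "decomposition I P" and Q: "decomposition I Q"
begin

lemma diag_sum_superset:
  assumes "finite F" "F \<subseteq> I" "\<And>r. r \<in> I \<Longrightarrow> P r a \<noteq> 0 \<Longrightarrow> r \<in> F"
  shows "(\<Sum>r | r \<in> I \<and> P r a \<noteq> 0. P r a \<otimes> Q r b) = (\<Sum>r\<in>F. P r a \<otimes> Q r b)"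
  using assms by (intro sum.mono_neutral_left) auto

lemma cbilinear_diag: "cbilinear (\<lambda>a b. \<Sum>r | r \<in> I \<and> P r a \<noteq> 0. P r a \<otimes> Q r b)"
proof (rule cbilinearI)
  note P_lin = clinear_add[OF decomposition_linear[OF P]] clinear_scaleC[OF decomposition_linear[OF P]]
    and Q_lin = clinear_add[OF decomposition_linear[OF Q]] clinear_scaleC[OF decomposition_linear[OF Q]]
  fix a a' b b' c
  let ?F = "{r\<in>I. P r a \<noteq> 0} \<union> {r\<in>I. P r a' \<noteq> 0}"
  have F: "finite ?F" "?F \<subseteq> I" using decomposition_finite[OF P] by auto
  note sup = diag_sum_superset[OF F]
  have "P r (a + a') = 0" if "r \<in> I" "r \<notin> ?F" for r
    using that by (simp add: P_lin)
  hence "(\<Sum>r | r \<in> I \<and> P r (a + a') \<noteq> 0. P r (a + a') \<otimes> Q r b) = (\<Sum>r\<in>?F. P r (a + a') \<otimes> Q r b)"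
    by (intro sup) blast
  also have "\<dots> = (\<Sum>r\<in>?F. P r a \<otimes> Q r b) + (\<Sum>r\<in>?F. P r a' \<otimes> Q r b)"
    using F(2) by (subst sum.distrib[symmetric], intro sum.cong) (auto simp: P_lin pure_tensor_bilinear)
  also have "\<dots> = (\<Sum>r | r \<in> I \<and> P r a \<noteq> 0. P r a \<otimes> Q r b) + (\<Sum>r | r \<in> I \<and> P r a' \<noteq> 0. P r a' \<otimes> Q r b)"
    by (subst (1 2) sup) auto
  finally show "(\<Sum>r | r \<in> I \<and> P r (a + a') \<noteq> 0. P r (a + a') \<otimes> Q r b) =
      (\<Sum>r | r \<in> I \<and> P r a \<noteq> 0. P r a \<otimes> Q r b) + (\<Sum>r | r \<in> I \<and> P r a' \<noteq> 0. P r a' \<otimes> Q r b)" .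
  have "P r (c *\<^sub>C a) = 0" if "r \<in> I" "r \<notin> ?F" for r
    using that by (simp add: P_lin)
  hence "(\<Sum>r | r \<in> I \<and> P r (c *\<^sub>C a) \<noteq> 0. P r (c *\<^sub>C a) \<otimes> Q r b) = (\<Sum>r\<in>?F. P r (c *\<^sub>C a) \<otimes> Q r b)"
    by (intro sup) blast
  also have "\<dots> = c *\<^sub>C (\<Sum>r\<in>?F. P r a \<otimes> Q r b)"
    using F(2) by (subst cvec.scale_sum_right, intro sum.cong) (auto simp: P_lin pure_tensor_bilinear)
  also have "\<dots> = c *\<^sub>C (\<Sum>r | r \<in> I \<and> P r a \<noteq> 0. P r a \<otimes> Q r b)"
    by (subst sup) auto
  finally show "(\<Sum>r | r \<in> I \<and> P r (c *\<^sub>C a) \<noteq> 0. P r (c *\<^sub>C a) \<otimes> Q r b) =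
      c *\<^sub>C (\<Sum>r | r \<in> I \<and> P r a \<noteq> 0. P r a \<otimes> Q r b)" .
  show "(\<Sum>r | r \<in> I \<and> P r a \<noteq> 0. P r a \<otimes> Q r (b + b')) =
      (\<Sum>r | r \<in> I \<and> P r a \<noteq> 0. P r a \<otimes> Q r b) + (\<Sum>r | r \<in> I \<and> P r a \<noteq> 0. P r a \<otimes> Q r b')"
    by (subst sum.distrib[symmetric], intro sum.cong) (auto simp: Q_lin pure_tensor_bilinear)
  show "(\<Sum>r | r \<in> I \<and> P r a \<noteq> 0. P r a \<otimes> Q r (c *\<^sub>C b)) =
      c *\<^sub>C (\<Sum>r | r \<in> I \<and> P r a \<noteq> 0. P r a \<otimes> Q r b)"
    by (subst cvec.scale_sum_right, intro sum.cong) (auto simp: Q_lin pure_tensor_bilinear)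
qed

lemma clinear_diag: "clinear (diag I P Q)"
  unfolding diag_def by (rule clinear_tensor_lift[OF cbilinear_diag])

lemma diag_pure:
  assumes "finite F" "F \<subseteq> I" "\<And>r. r \<in> I \<Longrightarrow> P r a \<noteq> 0 \<Longrightarrow> r \<in> F"
  shows "diag I P Q (a \<otimes> b) = (\<Sum>r\<in>F. P r a \<otimes> Q r b)"
  unfolding diag_def by (simp add: tensor_lift_pure[OF cbilinear_diag] diag_sum_superset[OF assms])

lemma diag_left:
  assumes "r \<in> I"
  shows "diag I P Q (P r a \<otimes> b) = P r a \<otimes> Q r b"
proof -
  have "diag I P Q (P r a \<otimes> b) = (\<Sum>s\<in>{r}. P s (P r a) \<otimes> Q s b)"
    using assms decomposition_orth[OF P _ assms] by (intro diag_pure) auto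
  thus ?thesis by (simp add: decomposition_idem[OF P assms])
qed

lemma diag_right:
  assumes "r \<in> I"
  shows "diag I P Q (a \<otimes> Q r b) = P r a \<otimes> Q r b"
proof -
  \<comment> \<open>The finite sum runs over the support of \<open>a\<close>, which need not contain
    \<open>r\<close>; adding \<open>r\<close> makes the surviving term visible.\<close>
  define F where "F = insert r {s\<in>I. P s a \<noteq> 0}"
  have F: "finite F" "r \<in> F" "F \<subseteq> I"
    using decomposition_finite[OF P, of a] assms by (auto simp: F_def)
  have "diag I P Q (a \<otimes> Q r b) = (\<Sum>s\<in>F. P s a \<otimes> Q s (Q r b))"
    using F by (intro diag_pure) (auto simp: F_def)
  also have "\<dots> = (\<Sum>s\<in>F. if s = r then P r a \<otimes> Q r b else 0)"
    using F assms decomposition_orth[OF Q _ assms] decomposition_idem[OF Q assms]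
    by (intro sum.cong) auto
  finally show ?thesis using F by simp
qed

text \<open>Domains and codomains of the four bijections are given as spans; this exhibits them as
  images of projections. Each generator is a value of \<open>diag\<close> by
  \<open>diag_left\<close>.\<close>

lemma range_diag:
  "range (diag I P Q) = diagonal_tensor I (\<lambda>r. range (P r)) (\<lambda>r. range (Q r))" (is "_ = ?D")
proof
  have sub: "csubspace ?D" unfolding diagonal_tensor_def by (rule cvec.subspace_span)
  have in_D: "P r a \<otimes> Q r b \<in> ?D" if "r \<in> I" for r a b
    unfolding diagonal_tensor_def tensor_subspace_def
    by (rule cvec.span_base, rule UN_I[OF that], rule cvec.span_base) auto
  have "diag I P Q x \<in> ?D" for x
  proof (induction x rule: tensor_induct)
    case (pure a b)
    have "diag I P Q (a \<otimes> b) = (\<Sum>r | r \<in> I \<and> P r a \<noteq> 0. P r a \<otimes> Q r b)"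
      using decomposition_finite[OF P] by (intro diag_pure) auto
    thus ?case using in_D by (auto intro!: cvec.subspace_sum[OF sub])
  qed (simp add: clinear_add[OF clinear_diag] cvec.subspace_add[OF sub])
  thus "range (diag I P Q) \<subseteq> ?D" by blast
  have "P r a \<otimes> Q r b \<in> range (diag I P Q)" if "r \<in> I" for r a b
    using diag_left[OF that, of a b] by (metis rangeI)
  hence "tensor_subspace (range (P r)) (range (Q r)) \<subseteq> range (diag I P Q)" if "r \<in> I" for r
    unfolding tensor_subspace_def using that
    by (intro cvec.span_minimal csubspace_range[OF clinear_diag]) auto
  thus "?D \<subseteq> range (diag I P Q)" unfolding diagonal_tensor_def
    by (intro cvec.span_minimal csubspace_range[OF clinear_diag]) auto
qed

end

lemma flip_diagonal_tensor_subset: "tensor_flip ` diagonal_tensor I V W \<subseteq> diagonal_tensor I W V"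
proof -
  have sub: "csubspace (tensor_flip -` diagonal_tensor I W V)"
    by (rule cvec_pair.linear_subspace_vimage[OF clinear_tensor_flip]) (simp add: diagonal_tensor_def)
  have "b \<otimes> a \<in> diagonal_tensor I W V" if "r \<in> I" "a \<in> V r" "b \<in> W r" for r a b
    unfolding diagonal_tensor_def tensor_subspace_def using that(2,3)
    by (intro cvec.span_base UN_I[OF that(1)]) blast
  hence "tensor_subspace (V r) (W r) \<subseteq> tensor_flip -` diagonal_tensor I W V" if "r \<in> I" for r
    unfolding tensor_subspace_def using that
        by (intro cvec.span_minimal[OF _ sub]) (auto simp: tensor_flip_pure)
  hence "diagonal_tensor I V W \<subseteq> tensor_flip -` diagonal_tensor I W V"
    unfolding diagonal_tensor_def[of I V W] by (intro cvec.span_minimal[OF _ sub]) auto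
  thus ?thesis by blast
qed

lemma bij_betw_tensor_flip: "bij_betw tensor_flip (diagonal_tensor I V W) (diagonal_tensor I W V)"
proof (rule bij_betw_byWitness[where f' = tensor_flip])
  show "tensor_flip ` diagonal_tensor I V W \<subseteq> diagonal_tensor I W V"
    "tensor_flip ` diagonal_tensor I W V \<subseteq> diagonal_tensor I V W"
    by (rule flip_diagonal_tensor_subset)+
qed (simp_all add: tensor_flip_flip)

lemma bij_betw_flip:
  assumes "bij_betw (tensor_flip \<circ> T \<circ> tensor_flip) (diagonal_tensor I V W) (diagonal_tensor I V' W')"
  shows "bij_betw T (diagonal_tensor I W V) (diagonal_tensor I W' V')"
proof -
  have "bij_betw (tensor_flip \<circ> ((tensor_flip \<circ> T \<circ> tensor_flip) \<circ> tensor_flip)) (diagonal_tensor I W V)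
      (diagonal_tensor I W' V')"
    by (rule bij_betw_trans[OF bij_betw_trans[OF bij_betw_tensor_flip assms] bij_betw_tensor_flip])
  moreover have "tensor_flip \<circ> ((tensor_flip \<circ> T \<circ> tensor_flip) \<circ> tensor_flip) = T"
    by (simp add: fun_eq_iff tensor_flip_flip)
  ultimately show ?thesis by simp
qed

text \<open>\<open>T x = 0\<close> gives \<open>T (G x) = T (G 0)\<close>, so injectivity on the
  range of \<open>G\<close> forces \<open>G x = 0\<close>, and then \<open>x\<close> equals
  \<open>x - G x\<close>. For the canonical maps this injectivity is part of the assumed
  bijections.\<close>

lemma kernel_projection:
  assumes "clinear T" "\<And>x. T (G x) = T x" "inj_on T (range G)" "clinear G"
  shows "kernel T = range (\<lambda>x. x - G x)"
proof -
  have "x = x - G x" if "T x = 0" for x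
  proof -
    have "T (G x) = T (G 0)" using that by (simp add: assms(2) clinear_0[OF assms(1)])
    hence "G x = G 0" using assms(3) by (auto dest: inj_onD)
    thus ?thesis by (simp add: clinear_0[OF assms(4)])
  qed
  hence "kernel T \<subseteq> range (\<lambda>x. x - G x)" unfolding kernel_def by blast
  moreover have "range (\<lambda>x. x - G x) \<subseteq> kernel T"
    by (auto simp: kernel_def clinear_diff[OF assms(1)] assms(2))
  ultimately show ?thesis by blast
qed

section \<open>Comultiplications compatible with two families of local units\<close>

text \<open>The multipliers \<open>U r\<close> and \<open>L r\<close> stand for \<open>1\<^sup>r\<close> and \<open>1\<^sub>r\<close>.\<close>

locale graded_comultiplication =
  fixes I :: "'i set" and U L :: "'i \<Rightarrow> 'a::complex_algebra multiplier" and \<Delta> :: "'a comult"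
    and E :: "('a, 'a) tensor multiplier" and \<epsilon> :: "'a \<Rightarrow> complex"
  assumes N: "nondegenerate_algebra TYPE('a)"
    and decomp: "decomposition I (\<lambda>r a. U r \<rhd> a)" "decomposition I (\<lambda>r a. a \<lhd> U r)"
      "decomposition I (\<lambda>r a. L r \<rhd> a)" "decomposition I (\<lambda>r a. a \<lhd> L r)"
    and E_left: "\<And>x. E \<rhd> x = diag I (\<lambda>r a. L r \<rhd> a) (\<lambda>r a. U r \<rhd> a) x"
    and E_right: "\<And>x. x \<lhd> E = diag I (\<lambda>r a. a \<lhd> L r) (\<lambda>r a. a \<lhd> U r) x"
    and linear: "clinear \<Delta>" and mult: "\<And>a b. \<Delta> (a * b) = \<Delta> a * \<Delta> b" and wd: "canon_well_defined \<Delta>"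
    and E_comult: "\<And>a. E * \<Delta> a = \<Delta> a" "\<And>a. \<Delta> a * E = \<Delta> a"
    and comult_units: "\<And>r a. r \<in> I \<Longrightarrow> \<Delta> (U r \<rhd> a) = (U r \<otimes>\<^sub>m 1) * \<Delta> a"
      "\<And>r a. r \<in> I \<Longrightarrow> \<Delta> (a \<lhd> U r) = \<Delta> a * (U r \<otimes>\<^sub>m 1)"
      "\<And>r a. r \<in> I \<Longrightarrow> \<Delta> (L r \<rhd> a) = (1 \<otimes>\<^sub>m L r) * \<Delta> a"
      "\<And>r a. r \<in> I \<Longrightarrow> \<Delta> (a \<lhd> L r) = \<Delta> a * (1 \<otimes>\<^sub>m L r)"
    and counit_linear: "clinear \<epsilon>"
    and counit_times: "\<And>r x y. r \<in> I \<Longrightarrow> \<epsilon> (x * (L r \<rhd> y)) = \<epsilon> (x \<lhd> L r) * \<epsilon> (L r \<rhd> y)"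
      "\<And>r x y. r \<in> I \<Longrightarrow> \<epsilon> (x * (U r \<rhd> y)) = \<epsilon> (x \<lhd> U r) * \<epsilon> (U r \<rhd> y)"
    and counit_units: "\<And>r x. r \<in> I \<Longrightarrow> \<epsilon> (L r \<rhd> x) = \<epsilon> (U r \<rhd> x)" "\<And>r x. r \<in> I \<Longrightarrow> \<epsilon> (x \<lhd> L r) = \<epsilon> (x \<lhd> U r)"
    and counit_nonzero: "\<And>r. r \<in> I \<Longrightarrow> \<exists>x. \<epsilon> (L r \<rhd> x) \<noteq> 0" "\<And>r. r \<in> I \<Longrightarrow> \<exists>x. \<epsilon> (x \<lhd> L r) \<noteq> 0"
    and counit: "\<And>a b. slice_left \<epsilon> (canon1 \<Delta> (a \<otimes> b)) = a * b"
      "\<And>a b. slice_right \<epsilon> (canon2 \<Delta> (a \<otimes> b)) = a * b"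
      "\<And>a b. slice_left \<epsilon> (canon3 \<Delta> (a \<otimes> b)) = b * a"
      "\<And>a b. slice_right \<epsilon> (canon4 \<Delta> (a \<otimes> b)) = b * a"
    and bij: "bij_betw (canon1 \<Delta>) (range (diag I (\<lambda>r a. a \<lhd> L r) (\<lambda>r a. L r \<rhd> a))) (range (\<lambda>x. E \<rhd> x))"
      "bij_betw (canon2 \<Delta>) (range (diag I (\<lambda>r a. a \<lhd> U r) (\<lambda>r a. U r \<rhd> a))) (range (\<lambda>x. x \<lhd> E))"
      "bij_betw (canon3 \<Delta>) (range (diag I (\<lambda>r a. L r \<rhd> a) (\<lambda>r a. a \<lhd> L r))) (range (\<lambda>x. x \<lhd> E))"
      "bij_betw (canon4 \<Delta>) (range (diag I (\<lambda>r a. U r \<rhd> a) (\<lambda>r a. a \<lhd> U r))) (range (\<lambda>x. E \<rhd> x))"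
begin

lemmas N2 = nondegenerate_tensor[OF N N]
lemmas N3 = nondegenerate_tensor[OF N N2]
lemmas canon_linear = clinear_canon[OF N linear wd]
lemmas canon_pure = canon1_pure[OF N linear wd] canon2_pure[OF N linear wd]
  canon3_pure[OF N linear wd] canon4_pure[OF N linear wd]
lemmas of_alg2_inject = injD[OF inj_of_alg[OF N2]]
lemmas of_alg3_inject = injD[OF inj_of_alg[OF N3]]

lemma leg1_times: "(m * n) \<otimes>\<^sub>m 1 = (m \<otimes>\<^sub>m 1) * (n \<otimes>\<^sub>m 1)"
  and leg2_times: "1 \<otimes>\<^sub>m (m * n) = (1 \<otimes>\<^sub>m m) * (1 \<otimes>\<^sub>m n)"
  by (simp_all add: mult_tensor_mult)

lemma legs_commute: "(1 \<otimes>\<^sub>m n) * (m \<otimes>\<^sub>m 1) = (m \<otimes>\<^sub>m 1) * (1 \<otimes>\<^sub>m n)"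
  "(1 \<otimes>\<^sub>m n) * ((m \<otimes>\<^sub>m 1) * k) = (m \<otimes>\<^sub>m 1) * ((1 \<otimes>\<^sub>m n) * k)"
  by (simp_all add: mult_tensor_mult flip: mult.assoc)

lemma of_alg_left: "of_alg (m \<rhd> a) = m * of_alg a" for a :: 'a
  by (rule of_alg_mult_left[OF N, symmetric])

lemma of_alg_right: "of_alg (a \<lhd> m) = of_alg a * m" for a :: 'a
  by (rule of_alg_mult_right[OF N, symmetric])

lemma unit_actions_idem [simp]:
  assumes "r \<in> I"
  shows "L r \<rhd> L r \<rhd> a = L r \<rhd> a" "U r \<rhd> U r \<rhd> a = U r \<rhd> a" "a \<lhd> L r \<lhd> L r = a \<lhd> L r" "a \<lhd> U r \<lhd> U r
      = a \<lhd> U r"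
  using decomposition_idem[OF decomp(1) assms] decomposition_idem[OF decomp(2) assms]
    decomposition_idem[OF decomp(3) assms] decomposition_idem[OF decomp(4) assms] by simp_all

lemma unit_idem: "r \<in> I \<Longrightarrow> L r * L r = L r" "r \<in> I \<Longrightarrow> U r * U r = U r"
  by (rule multiplier_left_eqI[OF N]; simp)+

lemma unit_leg_idem:
  assumes "r \<in> I"
  shows "(L r \<otimes>\<^sub>m 1) * ((L r \<otimes>\<^sub>m 1) * k) = (L r \<otimes>\<^sub>m 1) * k" "(1 \<otimes>\<^sub>m L r) * ((1 \<otimes>\<^sub>m L r) * k) = (1 \<otimes>\<^sub>m L r) * k"
    "(U r \<otimes>\<^sub>m 1) * ((U r \<otimes>\<^sub>m 1) * k) = (U r \<otimes>\<^sub>m 1) * k" "(1 \<otimes>\<^sub>m U r) * ((1 \<otimes>\<^sub>m U r) * k) = (1 \<otimes>\<^sub>m U r) * k"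
  using assms by (simp_all add: mult_tensor_mult unit_idem flip: mult.assoc)

lemma E_pure:
  assumes "r \<in> I"
  shows "E \<rhd> ((L r \<rhd> a) \<otimes> b) = (L r \<rhd> a) \<otimes> (U r \<rhd> b)" "E \<rhd> (a \<otimes> (U r \<rhd> b)) = (L r \<rhd> a) \<otimes> (U r \<rhd> b)"
    "((a \<lhd> L r) \<otimes> b) \<lhd> E = (a \<lhd> L r) \<otimes> (b \<lhd> U r)" "(a \<otimes> (b \<lhd> U r)) \<lhd> E = (a \<lhd> L r) \<otimes> (b \<lhd> U r)"
  by (simp_all add: E_left E_right diag_left[OF decomp(3,1) assms] diag_right[OF decomp(3,1) assms]
      diag_left[OF decomp(4,2) assms] diag_right[OF decomp(4,2) assms])

lemma E_units:
  assumes "r \<in> I"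
  shows "E * (L r \<otimes>\<^sub>m 1) = L r \<otimes>\<^sub>m U r" "E * (1 \<otimes>\<^sub>m U r) = L r \<otimes>\<^sub>m U r"
    "(L r \<otimes>\<^sub>m 1) * E = L r \<otimes>\<^sub>m U r" "(1 \<otimes>\<^sub>m U r) * E = L r \<otimes>\<^sub>m U r"
proof -
  have "(E * (L r \<otimes>\<^sub>m 1)) \<rhd> x = (L r \<otimes>\<^sub>m U r) \<rhd> x" "(E * (1 \<otimes>\<^sub>m U r)) \<rhd> x = (L r \<otimes>\<^sub>m U r) \<rhd> x"
    "x \<lhd> ((L r \<otimes>\<^sub>m 1) * E) = x \<lhd> (L r \<otimes>\<^sub>m U r)" "x \<lhd> ((1 \<otimes>\<^sub>m U r) * E) = x \<lhd> (L r \<otimes>\<^sub>m U r)" for x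
    by (induction x rule: tensor_induct; simp add: mult_tensor_pure E_pure[OF assms] mult_left_add
        mult_right_add)+
  note * = this
  show "E * (L r \<otimes>\<^sub>m 1) = L r \<otimes>\<^sub>m U r" "E * (1 \<otimes>\<^sub>m U r) = L r \<otimes>\<^sub>m U r"
    by (rule multiplier_left_eqI[OF N2], rule *)+
  show "(L r \<otimes>\<^sub>m 1) * E = L r \<otimes>\<^sub>m U r" "(1 \<otimes>\<^sub>m U r) * E = L r \<otimes>\<^sub>m U r"
    by (rule multiplier_right_eqI[OF N2], rule *)+
qed

lemma E_idem: "E * E = E"
  by (rule multiplier_left_eqI[OF N2], rule tensor_decomposition_eqI(1)[OF mult_left_linear
      mult_left_linear decomp(3)])
    (simp add: E_pure)

text \<open>\<open>E\<close> can be inserted next to \<open>\<Delta> a\<close>, and \<open>E\<close>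
  does not distinguish \<open>L r\<close> in the first leg from \<open>U r\<close> in the second. A
  unit can thereby change legs.\<close>

lemma comult_exchange:
  assumes "r \<in> I"
  shows "\<Delta> a * (L r \<otimes>\<^sub>m 1) = \<Delta> a * (1 \<otimes>\<^sub>m U r)" "(L r \<otimes>\<^sub>m 1) * \<Delta> a = (1 \<otimes>\<^sub>m U r) * \<Delta> a"
    "\<Delta> a * ((L r \<otimes>\<^sub>m 1) * k) = \<Delta> a * ((1 \<otimes>\<^sub>m U r) * k)"
proof -
  show *: "\<Delta> a * (L r \<otimes>\<^sub>m 1) = \<Delta> a * (1 \<otimes>\<^sub>m U r)" "(L r \<otimes>\<^sub>m 1) * \<Delta> a = (1 \<otimes>\<^sub>m U r) * \<Delta> a"
    using E_units[OF assms] E_comult by (metis mult.assoc)+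
  show "\<Delta> a * ((L r \<otimes>\<^sub>m 1) * k) = \<Delta> a * ((1 \<otimes>\<^sub>m U r) * k)"
    by (simp add: * flip: mult.assoc)
qed

text \<open>In each canonical map one leg of the coproduct carries no extra factor. A unit placed in
  that free leg moves to the other leg by \<open>comult_exchange\<close> and is absorbed by the
  factor there. These formulas drive both the equations for the \<open>G\<^sub>i\<close> and the
  counit computations.\<close>

lemma canon_units:
  assumes "r \<in> I"
  shows "canon1 \<Delta> (a \<otimes> b) \<lhd> (L r \<otimes>\<^sub>m 1) = canon1 \<Delta> (a \<otimes> (U r \<rhd> b))"
    "(1 \<otimes>\<^sub>m U r) \<rhd> canon2 \<Delta> (a \<otimes> b) = canon2 \<Delta> ((a \<lhd> L r) \<otimes> b)"
    "(L r \<otimes>\<^sub>m 1) \<rhd> canon3 \<Delta> (a \<otimes> b) = canon3 \<Delta> (a \<otimes> (b \<lhd> U r))"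
    "canon4 \<Delta> (a \<otimes> b) \<lhd> (1 \<otimes>\<^sub>m U r) = canon4 \<Delta> ((L r \<rhd> a) \<otimes> b)"
proof -
  note simps = canon_pure of_alg_left of_alg_right leg1_times leg2_times mult.assoc legs_commute
    of_alg_mult_left[OF N2, symmetric] of_alg_mult_right[OF N2, symmetric]
  show "canon1 \<Delta> (a \<otimes> b) \<lhd> (L r \<otimes>\<^sub>m 1) = canon1 \<Delta> (a \<otimes> (U r \<rhd> b))"
    by (rule of_alg2_inject) (simp only: simps comult_exchange[OF assms])
  show "(1 \<otimes>\<^sub>m U r) \<rhd> canon2 \<Delta> (a \<otimes> b) = canon2 \<Delta> ((a \<lhd> L r) \<otimes> b)"
    by (rule of_alg2_inject) (simp only: simps comult_exchange[OF assms])
  show "(L r \<otimes>\<^sub>m 1) \<rhd> canon3 \<Delta> (a \<otimes> b) = canon3 \<Delta> (a \<otimes> (b \<lhd> U r))"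
    by (rule of_alg2_inject) (simp only: simps comult_exchange(2)[OF assms, symmetric])
  show "canon4 \<Delta> (a \<otimes> b) \<lhd> (1 \<otimes>\<^sub>m U r) = canon4 \<Delta> ((L r \<rhd> a) \<otimes> b)"
    by (rule of_alg2_inject) (simp only: simps comult_exchange[OF assms])
qed

section \<open>Kernels and ranges of the canonical maps, and the equations for the maps
  \<open>G\<^sub>i\<close>\<close>

abbreviation "G1 \<equiv> diag I (\<lambda>r a. a \<lhd> L r) (\<lambda>r a. L r \<rhd> a)"
abbreviation "G2 \<equiv> diag I (\<lambda>r a. a \<lhd> U r) (\<lambda>r a. U r \<rhd> a)"
abbreviation "G3 \<equiv> diag I (\<lambda>r a. L r \<rhd> a) (\<lambda>r a. a \<lhd> L r)"
abbreviation "G4 \<equiv> diag I (\<lambda>r a. U r \<rhd> a) (\<lambda>r a. a \<lhd> U r)"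

lemmas G_linear = clinear_diag[OF decomp(4,3)] clinear_diag[OF decomp(2,1)]
  clinear_diag[OF decomp(3,4)] clinear_diag[OF decomp(1,2)]

text \<open>The canonical maps are balanced over the units. For \<open>canon1\<close>, the product
  \<open>\<Delta> (a \<lhd> L r) * (1 \<otimes>\<^sub>m of_alg b)\<close> does not change when
  \<open>L r\<close> is put in front of \<open>b\<close>, and this is all that \<open>G1\<close>
  does to \<open>(a \<lhd> L r) \<otimes> b\<close>.\<close>

lemma canon_G:
  "canon1 \<Delta> (G1 x) = canon1 \<Delta> x" "canon2 \<Delta> (G2 x) = canon2 \<Delta> x"
  "canon3 \<Delta> (G3 x) = canon3 \<Delta> x" "canon4 \<Delta> (G4 x) = canon4 \<Delta> x"
proof -
  note lin = clinear_compose[OF canon_linear(1) G_linear(1)]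
      clinear_compose[OF canon_linear(2) G_linear(2)]
    clinear_compose[OF canon_linear(3) G_linear(3)] clinear_compose[OF canon_linear(4) G_linear(4)]
  note simps = canon_pure of_alg_left of_alg_right leg1_times leg2_times comult_units mult.assoc
      unit_leg_idem
  show "canon1 \<Delta> (G1 x) = canon1 \<Delta> x"
    by (rule tensor_decomposition_eqI(1)[OF lin(1) canon_linear(1) decomp(4)], rule of_alg2_inject)
      (simp only: diag_left[OF decomp(4,3)] simps)
  show "canon2 \<Delta> (G2 x) = canon2 \<Delta> x"
    by (rule tensor_decomposition_eqI(1)[OF lin(2) canon_linear(2) decomp(2)], rule of_alg2_inject)
      (simp only: diag_left[OF decomp(2,1)] simps)
  show "canon3 \<Delta> (G3 x) = canon3 \<Delta> x"
    by (rule tensor_decomposition_eqI(1)[OF lin(3) canon_linear(3) decomp(3)], rule of_alg2_inject)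
      (simp only: diag_left[OF decomp(3,4)] simps)
  show "canon4 \<Delta> (G4 x) = canon4 \<Delta> x"
    by (rule tensor_decomposition_eqI(1)[OF lin(4) canon_linear(4) decomp(1)], rule of_alg2_inject)
      (simp only: diag_left[OF decomp(1,2)] simps)
qed

lemma kernel_canon:
  "kernel (canon1 \<Delta>) = range (\<lambda>x. x - G1 x)" "kernel (canon2 \<Delta>) = range (\<lambda>x. x - G2 x)"
  "kernel (canon3 \<Delta>) = range (\<lambda>x. x - G3 x)" "kernel (canon4 \<Delta>) = range (\<lambda>x. x - G4 x)"
  by (rule kernel_projection canon_linear canon_G G_linear bij_betw_imp_inj_on[OF bij(1)]
      bij_betw_imp_inj_on[OF bij(2)] bij_betw_imp_inj_on[OF bij(3)] bij_betw_imp_inj_on[OF bij(4)])+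

lemma E_canon:
  "E \<rhd> canon1 \<Delta> x = canon1 \<Delta> x" "canon2 \<Delta> x \<lhd> E = canon2 \<Delta> x"
  "canon3 \<Delta> x \<lhd> E = canon3 \<Delta> x" "E \<rhd> canon4 \<Delta> x = canon4 \<Delta> x"
proof -
  have 1: "E \<rhd> T x = T x" if "clinear T" and ex: "\<And>a b. \<exists>m c. of_alg (T (a \<otimes> b)) = \<Delta> c * m"
      for T :: "('a, 'a) tensor \<Rightarrow> ('a, 'a) tensor"
  proof (induction x rule: tensor_induct)
    case (pure a b)
    obtain m c where "of_alg (T (a \<otimes> b)) = \<Delta> c * m" using ex by blast
    hence "of_alg (E \<rhd> T (a \<otimes> b)) = of_alg (T (a \<otimes> b))"
      by (simp add: E_comult flip: of_alg_mult_left[OF N2] mult.assoc)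
    thus ?case by (rule of_alg2_inject)
  qed (simp add: clinear_add[OF that(1)] mult_left_add)
  have 2: "T x \<lhd> E = T x" if "clinear T" and ex: "\<And>a b. \<exists>m c. of_alg (T (a \<otimes> b)) = m * \<Delta> c"
      for T :: "('a, 'a) tensor \<Rightarrow> ('a, 'a) tensor"
  proof (induction x rule: tensor_induct)
    case (pure a b)
    obtain m c where "of_alg (T (a \<otimes> b)) = m * \<Delta> c" using ex by blast
    hence "of_alg (T (a \<otimes> b) \<lhd> E) = of_alg (T (a \<otimes> b))"
      by (simp add: E_comult mult.assoc flip: of_alg_mult_right[OF N2])
    thus ?case by (rule of_alg2_inject)
  qed (simp add: clinear_add[OF that(1)] mult_right_add)
  show "E \<rhd> canon1 \<Delta> x = canon1 \<Delta> x" "E \<rhd> canon4 \<Delta> x = canon4 \<Delta> x"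
    by (rule 1[OF canon_linear(1)] 1[OF canon_linear(4)], use canon_pure in blast)+
  show "canon2 \<Delta> x \<lhd> E = canon2 \<Delta> x" "canon3 \<Delta> x \<lhd> E = canon3 \<Delta> x"
    by (rule 2[OF canon_linear(2)] 2[OF canon_linear(3)], use canon_pure in blast)+
qed

text \<open>The bijections concern only the diagonal subspaces and give one inclusion; the other
  holds because \<open>E\<close> fixes every value of the canonical maps on the appropriate
  side.\<close>

lemma range_canon:
  "range (canon1 \<Delta>) = range (\<lambda>x. E \<rhd> x)" "range (canon2 \<Delta>) = range (\<lambda>x. x \<lhd> E)"
  "range (canon3 \<Delta>) = range (\<lambda>x. x \<lhd> E)" "range (canon4 \<Delta>) = range (\<lambda>x. E \<rhd> x)"
proof -
  have *: "range T = range P" if "bij_betw T X (range P)" "\<And>x. P (T x) = T x"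
      for T P :: "('a, 'a) tensor \<Rightarrow> ('a, 'a) tensor" and X
  proof
    show "range T \<subseteq> range P" using that(2) by (metis image_subsetI rangeI)
    show "range P \<subseteq> range T" using that(1) unfolding bij_betw_def by blast
  qed
  show "range (canon1 \<Delta>) = range (\<lambda>x. E \<rhd> x)" by (rule *[OF bij(1)]) (rule E_canon)
  show "range (canon2 \<Delta>) = range (\<lambda>x. x \<lhd> E)" by (rule *[OF bij(2)]) (rule E_canon)
  show "range (canon3 \<Delta>) = range (\<lambda>x. x \<lhd> E)" by (rule *[OF bij(3)]) (rule E_canon)
  show "range (canon4 \<Delta>) = range (\<lambda>x. E \<rhd> x)" by (rule *[OF bij(4)]) (rule E_canon)
qed

text \<open>The middle factor \<open>b\<close> commutes with \<open>leg13 (\<Delta> a)\<close>,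
  which leaves a canonical map in legs one and three with \<open>b\<close> parked in between. This
  evaluates the \<open>to_alg\<close> terms in the defining equations of the
  \<open>G\<^sub>i\<close>.\<close>

lemma comult13:
  "leg13 (\<Delta> a) * leg23 (of_alg (b \<otimes> c)) = of_alg (tensor_swap23 (canon1 \<Delta> (a \<otimes> c) \<otimes> b))"
  "leg12 (of_alg (c \<otimes> b)) * leg13 (\<Delta> a) = of_alg (tensor_swap23 (canon2 \<Delta> (c \<otimes> a) \<otimes> b))"
  "leg23 (of_alg (b \<otimes> c)) * leg13 (\<Delta> a) = of_alg (tensor_swap23 (canon3 \<Delta> (a \<otimes> c) \<otimes> b))"
  "leg13 (\<Delta> a) * leg12 (of_alg (c \<otimes> b)) = of_alg (tensor_swap23 (canon4 \<Delta> (c \<otimes> a) \<otimes> b))"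
proof -
  let ?b = "1 \<otimes>\<^sub>m of_alg b \<otimes>\<^sub>m 1 :: ('a, ('a, 'a) tensor) tensor multiplier"
  have "leg23 (of_alg (b \<otimes> c)) = leg13 (1 \<otimes>\<^sub>m of_alg c) * ?b" "leg23 (of_alg (b \<otimes> c))
      = ?b * leg13 (1 \<otimes>\<^sub>m of_alg c)"
    "leg12 (of_alg (c \<otimes> b)) = leg13 (of_alg c \<otimes>\<^sub>m 1) * ?b" "leg12 (of_alg (c \<otimes> b))
        = ?b * leg13 (of_alg c \<otimes>\<^sub>m 1)"
    by (simp_all only: leg_pure mult_tensor_mult mult_tensor_of_alg[symmetric] mult_1_left mult_1_right)
  note legs = this
  have "leg13 (\<Delta> a) * leg23 (of_alg (b \<otimes> c)) = leg13 (\<Delta> a * (1 \<otimes>\<^sub>m of_alg c)) * ?b"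
    by (simp only: legs(1) leg_times mult.assoc)
  thus "leg13 (\<Delta> a) * leg23 (of_alg (b \<otimes> c)) = of_alg (tensor_swap23 (canon1 \<Delta> (a \<otimes> c) \<otimes> b))"
    by (simp only: canon_pure[symmetric] leg13_of_alg_second)
  have "leg12 (of_alg (c \<otimes> b)) * leg13 (\<Delta> a) = ?b * leg13 ((of_alg c \<otimes>\<^sub>m 1) * \<Delta> a)"
    by (simp only: legs(4) leg_times mult.assoc)
  thus "leg12 (of_alg (c \<otimes> b)) * leg13 (\<Delta> a) = of_alg (tensor_swap23 (canon2 \<Delta> (c \<otimes> a) \<otimes> b))"
    by (simp only: canon_pure[symmetric] leg13_of_alg_second)
  have "leg23 (of_alg (b \<otimes> c)) * leg13 (\<Delta> a) = ?b * leg13 ((1 \<otimes>\<^sub>m of_alg c) * \<Delta> a)"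
    by (simp only: legs(2) leg_times mult.assoc)
  thus "leg23 (of_alg (b \<otimes> c)) * leg13 (\<Delta> a) = of_alg (tensor_swap23 (canon3 \<Delta> (a \<otimes> c) \<otimes> b))"
    by (simp only: canon_pure[symmetric] leg13_of_alg_second)
  have "leg13 (\<Delta> a) * leg12 (of_alg (c \<otimes> b)) = leg13 (\<Delta> a * (of_alg c \<otimes>\<^sub>m 1)) * ?b"
    by (simp only: legs(3) leg_times mult.assoc)
  thus "leg13 (\<Delta> a) * leg12 (of_alg (c \<otimes> b)) = of_alg (tensor_swap23 (canon4 \<Delta> (c \<otimes> a) \<otimes> b))"
    by (simp only: canon_pure[symmetric] leg13_of_alg_second)
qed

lemma clinear_swap23: "clinear (tensor_swap23 :: (('a, 'a) tensor, 'a) tensor \<Rightarrow> _)"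
  using algebra_iso_swap23 unfolding algebra_iso_def by blast

text \<open>If \<open>G\<close>, on tensors with the fixed factor \<open>b\<close>, acts only
  through \<open>k\<close> on the other factor, then with \<open>b\<close> parked in the middle it
  acts as \<open>k\<close> on a single leg of \<open>y\<close>; \<open>h\<close> is that
  action.\<close>

lemma on_legs_swap23:
  fixes b :: 'a
  assumes G: "clinear G" and h: "clinear h"
  shows "(\<And>p q. h (p \<otimes> q) = k p \<otimes> q) \<Longrightarrow> (\<And>p. G (p \<otimes> b) = k p \<otimes> b) \<Longrightarrow>
      on_legs12 G (tensor_swap23 (y \<otimes> b)) = tensor_swap23 (h y \<otimes> b)"
    and "(\<And>p q. h (p \<otimes> q) = p \<otimes> k q) \<Longrightarrow> (\<And>q. G (b \<otimes> q) = b \<otimes> k q) \<Longrightarrow>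
      on_legs23 G (tensor_swap23 (y \<otimes> b)) = tensor_swap23 (h y \<otimes> b)"
proof -
  note add = clinear_add[OF clinear_swap23] pure_tensor_bilinear clinear_add[OF h]
    clinear_add[OF clinear_on_legs12[OF G]] clinear_add[OF clinear_on_legs23[OF G]]
  show "on_legs12 G (tensor_swap23 (y \<otimes> b)) = tensor_swap23 (h y \<otimes> b)"
    if "\<And>p q. h (p \<otimes> q) = k p \<otimes> q" "\<And>p. G (p \<otimes> b) = k p \<otimes> b"
  proof (induction y rule: tensor_induct)
    case (pure p q)
    have "on_legs12 G (tensor_assoc ((p \<otimes> b) \<otimes> q)) = tensor_assoc (G (p \<otimes> b) \<otimes> q)"
      by (rule on_legs12_assoc[OF G])
    thus ?case by (simp add: that tensor_assoc_pure tensor_swap23_pure)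
  qed (simp only: add)
  show "on_legs23 G (tensor_swap23 (y \<otimes> b)) = tensor_swap23 (h y \<otimes> b)"
    if "\<And>p q. h (p \<otimes> q) = p \<otimes> k q" "\<And>q. G (b \<otimes> q) = b \<otimes> k q"
    by (induction y rule: tensor_induct)
      (simp only: that on_legs23_pure[OF G] tensor_swap23_pure, simp only: add)
qed

lemma clinear_legs_of_alg:
  "clinear (\<lambda>w. m * leg12 (of_alg w))" "clinear (\<lambda>w. leg12 (of_alg w) * m)"
  "clinear (\<lambda>w. m * leg23 (of_alg w))" "clinear (\<lambda>w. leg23 (of_alg w) * m)"
  for m :: "('a, ('a, 'a) tensor) tensor multiplier"
  by (rule clinearI; simp add: leg12_def leg23_def of_alg_add of_alg_scaleC mult_tensor_bilinear
      clinear_add[OF clinear_mult_transport[OF algebra_iso_assoc]]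
      clinear_scaleC[OF clinear_mult_transport[OF algebra_iso_assoc]]
      distrib_left distrib_right mult_scaleC_left mult_scaleC_right)+

text \<open>By linearity \<open>b\<close> may be supported at one index, on the side where
  \<open>E\<close> meets it: \<open>L r \<rhd> b\<close>, \<open>b \<lhd> U r\<close>,
  \<open>b \<lhd> L r\<close>, \<open>U r \<rhd> b\<close> in the four cases. Then
  \<open>G\<^sub>i\<close> acts by one unit on one of the outer legs, \<open>E\<close> by one unit
  on the other outer leg, and \<open>canon_units\<close> exchanges the two.\<close>

lemma is_G:
  "is_G1 \<Delta> E G1" "is_G2 \<Delta> E G2" "is_G3 \<Delta> E G3" "is_G4 \<Delta> E G4"
proof -
  note sw = clinear_compose[OF clinear_of_alg clinear_compose[OF clinear_on_legs12
        clinear_compose[OF clinear_swap23 clinear_pure_tensor(2)]]]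
    clinear_compose[OF clinear_of_alg clinear_compose[OF clinear_on_legs23
        clinear_compose[OF clinear_swap23 clinear_pure_tensor(2)]]]
  show "is_G1 \<Delta> E G1"
    unfolding is_G1_def comult13 to_alg_of_alg[OF N3] mult.assoc leg_times[symmetric]
        of_alg_mult_left[OF N2]
  proof (intro conjI allI G_linear)
    fix a b c
    show "of_alg (on_legs12 G1 (tensor_swap23 (canon1 \<Delta> (a \<otimes> c) \<otimes> b)))
        = leg13 (\<Delta> a) * leg23 (of_alg (E \<rhd> (b \<otimes> c)))"
    proof (rule decomposition_eqI[OF decomp(3) sw(1)[OF G_linear(1)]])
      show "clinear (\<lambda>b. leg13 (\<Delta> a) * leg23 (of_alg (E \<rhd> (b \<otimes> c))))"
        by (rule clinear_compose[OF clinear_legs_of_alg(3) clinear_compose[OF mult_left_linear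
            clinear_pure_tensor(1)]])
      fix r b assume r: "r \<in> I"
      have "on_legs12 G1 (tensor_swap23 (canon1 \<Delta> (a \<otimes> c) \<otimes> (L r \<rhd> b))) =
          tensor_swap23 ((canon1 \<Delta> (a \<otimes> c) \<lhd> (L r \<otimes>\<^sub>m 1)) \<otimes> (L r \<rhd> b))"
        by (rule on_legs_swap23(1)[OF G_linear(1) mult_right_linear, where k = "\<lambda>p. p \<lhd> L r"])
          (simp_all add: mult_tensor_pure diag_right[OF decomp(4,3) r])
      thus "of_alg (on_legs12 G1 (tensor_swap23 (canon1 \<Delta> (a \<otimes> c) \<otimes> (L r \<rhd> b)))) =
          leg13 (\<Delta> a) * leg23 (of_alg (E \<rhd> ((L r \<rhd> b) \<otimes> c)))"
        by (simp add: comult13 E_pure[OF r] canon_units[OF r])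
    qed
  qed
  show "is_G2 \<Delta> E G2"
    unfolding is_G2_def comult13 to_alg_of_alg[OF N3] leg_times[symmetric] of_alg_mult_right[OF N2]
  proof (intro conjI allI G_linear)
    fix a b c
    show "of_alg (on_legs23 G2 (tensor_swap23 (canon2 \<Delta> (a \<otimes> c) \<otimes> b)))
        = leg12 (of_alg ((a \<otimes> b) \<lhd> E)) * leg13 (\<Delta> c)"
    proof (rule decomposition_eqI[OF decomp(2) sw(2)[OF G_linear(2)]])
      show "clinear (\<lambda>b. leg12 (of_alg ((a \<otimes> b) \<lhd> E)) * leg13 (\<Delta> c))"
        by (rule clinear_compose[OF clinear_legs_of_alg(2) clinear_compose[OF mult_right_linear
            clinear_pure_tensor(2)]])
      fix r b assume r: "r \<in> I"
      have "on_legs23 G2 (tensor_swap23 (canon2 \<Delta> (a \<otimes> c) \<otimes> (b \<lhd> U r))) =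
          tensor_swap23 (((1 \<otimes>\<^sub>m U r) \<rhd> canon2 \<Delta> (a \<otimes> c)) \<otimes> (b \<lhd> U r))"
        by (rule on_legs_swap23(2)[OF G_linear(2) mult_left_linear, where k = "\<lambda>p. U r \<rhd> p"])
          (simp_all add: mult_tensor_pure diag_left[OF decomp(2,1) r])
      thus "of_alg (on_legs23 G2 (tensor_swap23 (canon2 \<Delta> (a \<otimes> c) \<otimes> (b \<lhd> U r)))) =
          leg12 (of_alg ((a \<otimes> (b \<lhd> U r)) \<lhd> E)) * leg13 (\<Delta> c)"
        by (simp add: comult13 E_pure[OF r] canon_units[OF r])
    qed
  qed
  show "is_G3 \<Delta> E G3"
    unfolding is_G3_def comult13 to_alg_of_alg[OF N3] leg_times[symmetric] of_alg_mult_right[OF N2]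
  proof (intro conjI allI G_linear)
    fix a b c
    show "of_alg (on_legs12 G3 (tensor_swap23 (canon3 \<Delta> (a \<otimes> c) \<otimes> b)))
        = leg23 (of_alg ((b \<otimes> c) \<lhd> E)) * leg13 (\<Delta> a)"
    proof (rule decomposition_eqI[OF decomp(4) sw(1)[OF G_linear(3)]])
      show "clinear (\<lambda>b. leg23 (of_alg ((b \<otimes> c) \<lhd> E)) * leg13 (\<Delta> a))"
        by (rule clinear_compose[OF clinear_legs_of_alg(4) clinear_compose[OF mult_right_linear
            clinear_pure_tensor(1)]])
      fix r b assume r: "r \<in> I"
      have "on_legs12 G3 (tensor_swap23 (canon3 \<Delta> (a \<otimes> c) \<otimes> (b \<lhd> L r))) =
          tensor_swap23 (((L r \<otimes>\<^sub>m 1) \<rhd> canon3 \<Delta> (a \<otimes> c)) \<otimes> (b \<lhd> L r))"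
        by (rule on_legs_swap23(1)[OF G_linear(3) mult_left_linear, where k = "\<lambda>p. L r \<rhd> p"])
          (simp_all add: mult_tensor_pure diag_right[OF decomp(3,4) r])
      thus "of_alg (on_legs12 G3 (tensor_swap23 (canon3 \<Delta> (a \<otimes> c) \<otimes> (b \<lhd> L r)))) =
          leg23 (of_alg (((b \<lhd> L r) \<otimes> c) \<lhd> E)) * leg13 (\<Delta> a)"
        by (simp add: comult13 E_pure[OF r] canon_units[OF r])
    qed
  qed
  show "is_G4 \<Delta> E G4"
    unfolding is_G4_def comult13 to_alg_of_alg[OF N3] mult.assoc leg_times[symmetric]
        of_alg_mult_left[OF N2]
  proof (intro conjI allI G_linear)
    fix a b c
    show "of_alg (on_legs23 G4 (tensor_swap23 (canon4 \<Delta> (a \<otimes> c) \<otimes> b)))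
        = leg13 (\<Delta> c) * leg12 (of_alg (E \<rhd> (a \<otimes> b)))"
    proof (rule decomposition_eqI[OF decomp(1) sw(2)[OF G_linear(4)]])
      show "clinear (\<lambda>b. leg13 (\<Delta> c) * leg12 (of_alg (E \<rhd> (a \<otimes> b))))"
        by (rule clinear_compose[OF clinear_legs_of_alg(1) clinear_compose[OF mult_left_linear
            clinear_pure_tensor(2)]])
      fix r b assume r: "r \<in> I"
      have "on_legs23 G4 (tensor_swap23 (canon4 \<Delta> (a \<otimes> c) \<otimes> (U r \<rhd> b))) =
          tensor_swap23 ((canon4 \<Delta> (a \<otimes> c) \<lhd> (1 \<otimes>\<^sub>m U r)) \<otimes> (U r \<rhd> b))"
        by (rule on_legs_swap23(2)[OF G_linear(4) mult_right_linear, where k = "\<lambda>p. p \<lhd> U r"])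
          (simp_all add: mult_tensor_pure diag_left[OF decomp(1,2) r])
      thus "of_alg (on_legs23 G4 (tensor_swap23 (canon4 \<Delta> (a \<otimes> c) \<otimes> (U r \<rhd> b)))) =
          leg13 (\<Delta> c) * leg12 (of_alg (E \<rhd> (a \<otimes> (U r \<rhd> b))))"
        by (simp add: comult13 E_pure[OF r] canon_units[OF r])
    qed
  qed
qed

end

section \<open>Slices by the counit, fullness, and the counit axioms for \<open>E\<close>\<close>

context graded_comultiplication
begin

text \<open>\<open>counit_times\<close> splits the counit of a product at a local unit, so the value
  on \<open>b\<close> leaves the slice as a scalar and only the unit keeps acting on
  \<open>y\<close>.\<close>

lemma counit_slice:
  assumes "r \<in> I"
  shows "slice_left \<epsilon> (y \<lhd> (of_alg (L r \<rhd> b) \<otimes>\<^sub>m 1)) = \<epsilon> (L r \<rhd> b) *\<^sub>C slice_left \<epsilon> (y \<lhd> (L r \<otimes>\<^sub>m 1))"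
    "slice_left \<epsilon> ((of_alg (b \<lhd> L r) \<otimes>\<^sub>m 1) \<rhd> y) = \<epsilon> (b \<lhd> L r) *\<^sub>C slice_left \<epsilon> ((L r \<otimes>\<^sub>m 1) \<rhd> y)"
    "slice_right \<epsilon> (y \<lhd> (1 \<otimes>\<^sub>m of_alg (U r \<rhd> b))) = \<epsilon> (U r \<rhd> b) *\<^sub>C slice_right \<epsilon> (y \<lhd> (1 \<otimes>\<^sub>m U r))"
    "slice_right \<epsilon> ((1 \<otimes>\<^sub>m of_alg (b \<lhd> U r)) \<rhd> y) = \<epsilon> (b \<lhd> U r) *\<^sub>C slice_right \<epsilon> ((1 \<otimes>\<^sub>m U r) \<rhd> y)"
  by (induction y rule: tensor_induct;
      simp add: mult_tensor_pure slice_left_pure[OF counit_linear] slice_right_pure[OF counit_linear]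
        counit_times[OF assms] scaleC_scaleC mult.commute scaleC_add_right mult_left_add mult_right_add
        clinear_add[OF clinear_slice_left[OF counit_linear]]
            clinear_add[OF clinear_slice_right[OF counit_linear]]
        mult_left_right[symmetric])+

lemma slice_actions:
  "slice_right \<epsilon> y * c = slice_right \<epsilon> (y \<lhd> (of_alg c \<otimes>\<^sub>m 1))" "c * slice_right \<epsilon> y
      = slice_right \<epsilon> ((of_alg c \<otimes>\<^sub>m 1) \<rhd> y)"
  "slice_left \<epsilon> y * c = slice_left \<epsilon> (y \<lhd> (1 \<otimes>\<^sub>m of_alg c))" "c * slice_left \<epsilon> y
      = slice_left \<epsilon> ((1 \<otimes>\<^sub>m of_alg c) \<rhd> y)"
  by (induction y rule: tensor_induct;
      simp add: mult_tensor_pure slice_left_pure[OF counit_linear] slice_right_pure[OF counit_linear]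
        mult_left_add mult_right_add mult_scaleC_left mult_scaleC_right distrib_left distrib_right
        clinear_add[OF clinear_slice_left[OF counit_linear]]
            clinear_add[OF clinear_slice_right[OF counit_linear]])+

text \<open>Both sides of the first equation are \<open>\<Delta> a\<close> times
  \<open>c \<otimes> b\<close>, those of the second \<open>a \<otimes> c\<close> times
  \<open>\<Delta> b\<close>. The counit property is available for only one slice of each canonical
  map; this allows the map to be changed before the other slice is taken.\<close>

lemma canon_actions:
  "canon1 \<Delta> (a \<otimes> b) \<lhd> (of_alg c \<otimes>\<^sub>m 1) = canon4 \<Delta> (c \<otimes> a) \<lhd> (1 \<otimes>\<^sub>m of_alg b)"
  "(1 \<otimes>\<^sub>m of_alg c) \<rhd> canon2 \<Delta> (a \<otimes> b) = (of_alg a \<otimes>\<^sub>m 1) \<rhd> canon3 \<Delta> (b \<otimes> c)"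
  by (rule of_alg2_inject,
      simp only: canon_pure mult.assoc legs_commute of_alg_mult_left[OF N2, symmetric]
          of_alg_mult_right[OF N2, symmetric])+

lemma comult_actions:
  "\<Delta> a \<rhd> (b \<otimes> c) = canon1 \<Delta> (a \<otimes> c) \<lhd> (of_alg b \<otimes>\<^sub>m 1)"
  "(a \<otimes> b) \<lhd> \<Delta> c = (of_alg a \<otimes>\<^sub>m 1) \<rhd> canon3 \<Delta> (c \<otimes> b)"
proof -
  have "of_alg (b \<otimes> c) = (1 \<otimes>\<^sub>m of_alg c) * (of_alg b \<otimes>\<^sub>m 1)" for b c :: 'a
    by (simp add: mult_tensor_mult mult_tensor_of_alg)
  thus "\<Delta> a \<rhd> (b \<otimes> c) = canon1 \<Delta> (a \<otimes> c) \<lhd> (of_alg b \<otimes>\<^sub>m 1)"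
    "(a \<otimes> b) \<lhd> \<Delta> c = (of_alg a \<otimes>\<^sub>m 1) \<rhd> canon3 \<Delta> (c \<otimes> b)"
    by (rule_tac [!] of_alg2_inject)
      (simp_all only: canon_pure mult.assoc legs_commute of_alg_mult_left[OF N2, symmetric]
          of_alg_mult_right[OF N2, symmetric])
qed

text \<open>Multiply by an arbitrary \<open>c\<close> in the free leg. For the first formula,
  \<open>canon_actions\<close> turns \<open>canon1\<close> into \<open>canon4\<close>,
  \<open>counit_slice\<close> extracts the scalar and leaves \<open>U r\<close>,
  \<open>canon_units\<close> moves that unit onto \<open>L r \<rhd> c\<close>, and the counit
  property gives \<open>a * (L r \<rhd> c)\<close>. Then \<open>c\<close> is cancelled. The other
  formulas are mirror images.\<close>

lemma counit_canon:
  assumes "r \<in> I"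
  shows "slice_right \<epsilon> (canon1 \<Delta> (a \<otimes> (U r \<rhd> b))) = \<epsilon> (U r \<rhd> b) *\<^sub>C (a \<lhd> L r)"
    "slice_left \<epsilon> (canon2 \<Delta> ((b \<lhd> L r) \<otimes> a)) = \<epsilon> (b \<lhd> L r) *\<^sub>C (U r \<rhd> a)"
    "slice_right \<epsilon> (canon3 \<Delta> (a \<otimes> (b \<lhd> U r))) = \<epsilon> (b \<lhd> U r) *\<^sub>C (L r \<rhd> a)"
    "slice_left \<epsilon> (canon4 \<Delta> ((L r \<rhd> b) \<otimes> a)) = \<epsilon> (L r \<rhd> b) *\<^sub>C (a \<lhd> U r)"
proof -
  show "slice_right \<epsilon> (canon1 \<Delta> (a \<otimes> (U r \<rhd> b))) = \<epsilon> (U r \<rhd> b) *\<^sub>C (a \<lhd> L r)"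
    by (rule nondegenerate_left_eqI[OF N]) (simp only: slice_actions(1) canon_actions(1)
        counit_slice(3)[OF assms] canon_units(4)[OF assms] counit(4) mult_scaleC_left mult_left_right)
  show "slice_left \<epsilon> (canon2 \<Delta> ((b \<lhd> L r) \<otimes> a)) = \<epsilon> (b \<lhd> L r) *\<^sub>C (U r \<rhd> a)"
    by (rule nondegenerate_right_eqI[OF N]) (simp only: slice_actions(4) canon_actions(2)
        counit_slice(2)[OF assms] canon_units(3)[OF assms] counit(3) mult_scaleC_right mult_left_right)
  show "slice_right \<epsilon> (canon3 \<Delta> (a \<otimes> (b \<lhd> U r))) = \<epsilon> (b \<lhd> U r) *\<^sub>C (L r \<rhd> a)"
    by (rule nondegenerate_right_eqI[OF N]) (simp only: slice_actions(2) canon_actions(2)[symmetric]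
        counit_slice(4)[OF assms] canon_units(2)[OF assms] counit(2) mult_scaleC_right mult_left_right)
  show "slice_left \<epsilon> (canon4 \<Delta> ((L r \<rhd> b) \<otimes> a)) = \<epsilon> (L r \<rhd> b) *\<^sub>C (a \<lhd> U r)"
    by (rule nondegenerate_left_eqI[OF N]) (simp only: slice_actions(3) canon_actions(1)[symmetric]
        counit_slice(1)[OF assms] canon_units(1)[OF assms] counit(1) mult_scaleC_left mult_left_right)
qed

lemma slice_subspace:
  assumes "csubspace V"
  shows "x \<in> tensor_subspace V UNIV \<Longrightarrow> slice_right \<epsilon> x \<in> V" "x \<in> tensor_subspace UNIV V \<Longrightarrow> slice_left \<epsilon> x
      \<in> V"
  unfolding tensor_subspace_def
  by (erule clinear_span_into[OF clinear_slice_right[OF counit_linear] assms, rotated]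
      clinear_span_into[OF clinear_slice_left[OF counit_linear] assms, rotated];
      use cvec.subspace_scale[OF assms] in \<open>auto simp: slice_left_pure[OF counit_linear]
          slice_right_pure[OF counit_linear]\<close>)+

text \<open>The scalars \<open>c\<close> will be nonzero values of the counit. Dividing by them puts
  every \<open>P r a\<close> into \<open>V\<close>, and every element is a finite sum of
  these.\<close>

lemma subspace_UNIV_by_units:
  assumes V: "csubspace V" and P: "decomposition I P"
    and nz: "\<And>r. r \<in> I \<Longrightarrow> \<exists>c. c \<noteq> 0 \<and> (\<forall>a. c *\<^sub>C P r a \<in> V)"
  shows "V = UNIV"
proof -
  have "a \<in> V" for a
  proof (rule decomposition_into[OF P V])
    fix r assume "r \<in> I"
    then obtain c where "c \<noteq> 0" "c *\<^sub>C P r a \<in> V" using nz by blast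
    thus "P r a \<in> V" using cvec.subspace_scale[OF V, of "c *\<^sub>C P r a" "inverse c"]
      by (simp add: scaleC_scaleC scaleC_one)
  qed
  thus ?thesis by blast
qed

lemma of_alg2_image: "of_alg x \<in> of_alg ` S \<longleftrightarrow> x \<in> S" for x :: "('a, 'a) tensor"
  using inj_image_mem_iff[OF inj_of_alg[OF N2]] .

lemma slice_flip: "slice_right \<epsilon> (tensor_flip y) = slice_left \<epsilon> y" "slice_left \<epsilon> (tensor_flip y)
    = slice_right \<epsilon> y"
  for y :: "('a, 'a) tensor"
  by (induction y rule: tensor_induct;
      simp add: tensor_flip_pure slice_left_pure[OF counit_linear] slice_right_pure[OF counit_linear]
        clinear_add[OF clinear_tensor_flip]
        clinear_add[OF clinear_slice_left[OF counit_linear]]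
            clinear_add[OF clinear_slice_right[OF counit_linear]])+

lemma full: "full_comult \<Delta>"
  unfolding full_comult_def canon_pure[symmetric] of_alg2_image
proof (intro conjI allI impI; elim conjE)
  fix V :: "'a set" assume V: "csubspace V" and *: "\<forall>a b. canon1 \<Delta> (a \<otimes> b) \<in> tensor_subspace V UNIV"
  show "V = UNIV"
    \<comment> \<open>Some \<open>b\<close> has \<open>\<epsilon> (U r \<rhd> b) \<noteq> 0\<close>,
      by \<open>counit_nonzero(1)\<close> transferred from \<open>L r\<close> to \<open>U r\<close>.
      Slicing the canonical map at \<open>a \<otimes> (U r \<rhd> b)\<close> puts a nonzero multiple
      of \<open>a \<lhd> L r\<close> into \<open>V\<close>.\<close>
    by (rule subspace_UNIV_by_units[OF V decomp(4)])
      (use counit_nonzero(1) slice_subspace(1)[OF V *[rule_format]] in \<open>metis counit_canon(1)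
          counit_units(1)\<close>)
next
  fix V :: "'a set" assume V: "csubspace V" and *: "\<forall>a b. canon2 \<Delta> (a \<otimes> b) \<in> tensor_subspace UNIV V"
  show "V = UNIV"
    by (rule subspace_UNIV_by_units[OF V decomp(1)])
      (use counit_nonzero(2) slice_subspace(2)[OF V *[rule_format]] in \<open>metis counit_canon(2)\<close>)
qed

lemma full_opposite: "full_comult (opposite_comult \<Delta>)"
  unfolding full_comult_def opposite_comult_actions canon_pure[symmetric]
      mult_transport_of_alg[OF algebra_iso_flip] of_alg2_image
proof (intro conjI allI impI; elim conjE)
  fix V :: "'a set" assume V: "csubspace V" and *: "\<forall>a b. tensor_flip (canon4 \<Delta> (b \<otimes> a))
      \<in> tensor_subspace V UNIV"
  show "V = UNIV"
    by (rule subspace_UNIV_by_units[OF V decomp(2)])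
      (use counit_nonzero(1) slice_subspace(1)[OF V *[rule_format]] in \<open>metis counit_canon(4)
          slice_flip(1)\<close>)
next
  fix V :: "'a set" assume V: "csubspace V" and *: "\<forall>a b. tensor_flip (canon3 \<Delta> (b \<otimes> a))
      \<in> tensor_subspace UNIV V"
  show "V = UNIV"
    by (rule subspace_UNIV_by_units[OF V decomp(3)])
      (use counit_nonzero(2) slice_subspace(2)[OF V *[rule_format]] in \<open>metis counit_canon(3)
          counit_units(2) slice_flip(2)\<close>)
qed

text \<open>With \<open>L r \<rhd> b\<close> in place of \<open>b\<close>, both sides of the first
  equation become \<open>\<epsilon> (L r \<rhd> b) *\<^sub>C (a * (U r \<rhd> c))\<close>: on the
  left \<open>E\<close> puts \<open>U r\<close> on \<open>c\<close>, on the right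
  \<open>counit_slice\<close> leaves \<open>L r\<close> in the first leg and
  \<open>canon_units\<close> converts it into \<open>U r\<close> on \<open>c\<close>. The second
  equation is the mirror image.\<close>

lemma counit_E:
  "slice_left \<epsilon> ((1 \<otimes>\<^sub>m of_alg a) \<rhd> (E \<rhd> (b \<otimes> c))) = slice_left \<epsilon> (\<Delta> a \<rhd> (b \<otimes> c))"
  "slice_left \<epsilon> (((a \<otimes> b) \<lhd> E) \<lhd> (1 \<otimes>\<^sub>m of_alg c)) = slice_left \<epsilon> ((a \<otimes> b) \<lhd> \<Delta> c)"
proof -
  note lin = clinear_compose[OF clinear_slice_left[OF counit_linear]]
    clinear_compose[OF mult_left_linear] clinear_compose[OF mult_right_linear] mult_left_linear
        mult_right_linear
    clinear_pure_tensor
  show "slice_left \<epsilon> ((1 \<otimes>\<^sub>m of_alg a) \<rhd> (E \<rhd> (b \<otimes> c))) = slice_left \<epsilon> (\<Delta> a \<rhd> (b \<otimes> c))"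
  proof (rule decomposition_eqI[OF decomp(3), where a = b])
    fix r b assume r: "r \<in> I"
    show "slice_left \<epsilon> ((1 \<otimes>\<^sub>m of_alg a) \<rhd> (E \<rhd> ((L r \<rhd> b) \<otimes> c))) = slice_left \<epsilon> (\<Delta> a \<rhd> ((L r \<rhd> b) \<otimes> c))"
      by (simp add: E_pure[OF r] comult_actions counit_slice[OF r] canon_units[OF r] counit
          mult_tensor_pure slice_left_pure[OF counit_linear])
  qed (intro lin)+
  show "slice_left \<epsilon> (((a \<otimes> b) \<lhd> E) \<lhd> (1 \<otimes>\<^sub>m of_alg c)) = slice_left \<epsilon> ((a \<otimes> b) \<lhd> \<Delta> c)"
  proof (rule decomposition_eqI[OF decomp(4), where a = a])
    fix r a assume r: "r \<in> I"
    show "slice_left \<epsilon> ((((a \<lhd> L r) \<otimes> b) \<lhd> E) \<lhd> (1 \<otimes>\<^sub>m of_alg c)) = slice_left \<epsilon> (((a \<lhd> L r) \<otimes> b) \<lhd> \<Delta> c)"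
      by (simp add: E_pure[OF r] comult_actions counit_slice[OF r] canon_units[OF r] counit
          mult_tensor_pure slice_left_pure[OF counit_linear])
  qed (intro lin)+
qed

end

section \<open>Coassociativity beyond the corner, and the axioms for \<open>E\<close>\<close>

definition corner :: "'a::complex_algebra multiplier \<Rightarrow> 'a set" where
  "corner e = {x. e \<rhd> x = x \<and> x \<lhd> e = x}"

text \<open>\<open>corner E\<close> is \<open>E (A \<otimes> A) E\<close>, later identified with the
  carrier of \<open>A \<otimes>\<^sup>I A\<close>. The spanning conditions replace units: the ranges
  of both actions of \<open>E\<close> are generated by values of \<open>\<Delta>\<close>, and also
  by the corner, where \<open>coassoc\<close> is given.\<close>

locale coassociative_graded_comultiplication = graded_comultiplication I U L \<Delta> E \<epsilon>
  for I :: "'i set" and U L :: "'i \<Rightarrow> 'a::complex_algebra multiplier" and \<Delta> E \<epsilon> +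
  assumes units_commute: "\<And>r s. r \<in> I \<Longrightarrow> s \<in> I \<Longrightarrow> L r * U s = U s * L r"
    and idempotent: "idempotent_algebra (UNIV :: 'a set)"
    and comult_span: "\<And>z. E \<rhd> z \<in> cspan {\<Delta> a \<rhd> w | a w. True}" "\<And>z. z \<lhd> E \<in> cspan {w \<lhd> \<Delta> a | a w. True}"
    and E_local: "\<And>z. E \<rhd> z \<in> cspan {c * w | c w. c \<in> corner E}"
      "\<And>z. z \<lhd> E \<in> cspan {w * c | c w. c \<in> corner E}"
    and coassoc: "\<And>a. multiplier_extension (corner E) (comult_id \<Delta>) (leg12 E * leg23 E) (\<Delta> a) =
      multiplier_extension (corner E) (id_comult \<Delta>) (leg12 E * leg23 E) (\<Delta> a)"
begin

text \<open>One inclusion comes from \<open>E\<close> being absorbed by \<open>\<Delta>\<close>, the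
  other from \<open>comult_span\<close>.\<close>

lemma cspan_E:
  "cspan {\<Delta> a \<rhd> (b \<otimes> c) | a b c. True} = cspan {E \<rhd> (b \<otimes> c) | b c. True}"
  "cspan {(a \<otimes> b) \<lhd> \<Delta> c | a b c. True} = cspan {(a \<otimes> b) \<lhd> E | a b. True}"
proof -
  let ?D = "cspan {\<Delta> a \<rhd> (b \<otimes> c) | a b c. True}" and ?D' = "cspan {(a \<otimes> b) \<lhd> \<Delta> c | a b c. True}"
  let ?E = "cspan {E \<rhd> (b \<otimes> c) | b c. True}" and ?E' = "cspan {(a \<otimes> b) \<lhd> E | a b. True}"
  have D: "\<Delta> a \<rhd> w \<in> ?D" "w \<lhd> \<Delta> a \<in> ?D'" and E: "E \<rhd> w \<in> ?E" "w \<lhd> E \<in> ?E'" for a w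
    by (induction w rule: tensor_induct)
        (auto simp: mult_left_add mult_right_add intro: cvec.span_base cvec.span_add)
  have "\<Delta> a \<rhd> w \<in> ?E" "w \<lhd> \<Delta> a \<in> ?E'" for a w
    using E(1)[of "\<Delta> a \<rhd> w"] E(2)[of "w \<lhd> \<Delta> a"] E_comult[of a]
    by (simp_all flip: multiplier_actions(1,2))
  note DE = this
  have sub: "cspan S \<subseteq> cspan T" if "S \<subseteq> cspan T" for S T :: "('a, 'a) tensor set"
    using that by (rule cvec.span_minimal[OF _ cvec.subspace_span])
  have "?D \<subseteq> ?E" "?D' \<subseteq> ?E'" by (rule sub; use DE in blast)+
  moreover have "cspan {\<Delta> a \<rhd> w | a w. True} \<subseteq> ?D" "cspan {w \<lhd> \<Delta> a | a w. True} \<subseteq> ?D'"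
    by (rule sub; use D in blast)+
  hence "?E \<subseteq> ?D" "?E' \<subseteq> ?D'"
    by (intro sub; use comult_span in blast)+
  ultimately show "?D = ?E" "?D' = ?E'" by blast+
qed

text \<open>On \<open>(L r \<rhd> a) \<otimes> (L s \<rhd> b) \<otimes> c\<close>,
  \<open>leg12 E\<close> acts by \<open>U r\<close> on the middle leg and \<open>leg23 E\<close> by
  \<open>U s\<close> on the last. The middle leg stays supported at \<open>L s\<close> because
  \<open>U r\<close> and \<open>L s\<close> commute.\<close>

lemma E_legs_commute: "leg12 E * leg23 E = leg23 E * leg12 E"
proof (rule multiplier_left_eqI[OF N3])
  fix z
  show "(leg12 E * leg23 E) \<rhd> z = (leg23 E * leg12 E) \<rhd> z"
  proof (induction z rule: tensor_induct)
    case (pure a y)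
    show ?case
    proof (induction y rule: tensor_induct)
      case (pure b c)
      show ?case
      proof (rule decomposition_eqI[OF decomp(3), where a = a], goal_cases)
        case (3 r a)
        show ?case
        proof (rule decomposition_eqI[OF decomp(3), where a = b], goal_cases)
          case (3 s b)
          have E12: "leg12 E \<rhd> ((L r \<rhd> a) \<otimes> x \<otimes> y) = (L r \<rhd> a) \<otimes> (U r \<rhd> x) \<otimes> y" for x y
            unfolding leg12_def by (simp add: transport_triple mult_tensor_pure E_pure \<open>r \<in> I\<close>
                tensor_assoc_pure)
          have E23: "leg23 E \<rhd> (x \<otimes> (L s \<rhd> b) \<otimes> y) = x \<otimes> (L s \<rhd> b) \<otimes> (U s \<rhd> y)" for x b y
            unfolding leg23_def by (simp add: mult_tensor_pure E_pure 3)
          have "U r \<rhd> L s \<rhd> b = L s \<rhd> U r \<rhd> b"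
            using units_commute[OF 3 \<open>r \<in> I\<close>] by (metis multiplier_actions(1))
          thus ?case by (simp add: E12 E23)
        qed (intro clinear_compose[OF mult_left_linear] clinear_compose[OF clinear_pure_tensor(2)]
            clinear_pure_tensor)+
      qed (intro clinear_compose[OF mult_left_linear] clinear_pure_tensor)+
    qed (simp add: mult_left_add pure_tensor_bilinear)
  qed (simp add: mult_left_add)
qed

abbreviation "f \<equiv> comult_id \<Delta>"
abbreviation "g \<equiv> id_comult \<Delta>"

lemmas fg_linear = clinear_comult_id[OF linear] clinear_id_comult[OF linear]
lemmas fg_pure = comult_id_pure[OF linear] id_comult_pure[OF linear]
lemmas fg_times = comult_id_times[OF linear mult] id_comult_times[OF linear mult]

lemma leg_idem: "leg12 E * leg12 E = leg12 E" "leg23 E * leg23 E = leg23 E"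
  by (simp_all add: E_idem flip: leg_times)

lemma leg_commute: "(1 \<otimes>\<^sub>m 1 \<otimes>\<^sub>m k) * leg12 m = leg12 m * (1 \<otimes>\<^sub>m 1 \<otimes>\<^sub>m k)" "(k \<otimes>\<^sub>m 1) * leg23 m
    = leg23 m * (k \<otimes>\<^sub>m 1)"
  by (simp_all only: leg12_third leg23_first)

lemma fg_absorb: "leg12 E * f x = f x" "f x * leg12 E = f x" "leg23 E * g x = g x" "g x * leg23 E = g x"
proof -
  have "leg12 E * f (a \<otimes> b) = f (a \<otimes> b)" "f (a \<otimes> b) * leg12 E = f (a \<otimes> b)"
    "leg23 E * g (a \<otimes> b) = g (a \<otimes> b)" "g (a \<otimes> b) * leg23 E = g (a \<otimes> b)" for a b
    by (simp_all add: fg_pure E_comult flip: leg_times mult.assoc)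
      (simp_all add: leg_commute E_comult mult.assoc flip: leg_times, simp_all add: E_comult flip:
          leg_times mult.assoc)
  thus "leg12 E * f x = f x" "f x * leg12 E = f x" "leg23 E * g x = g x" "g x * leg23 E = g x"
    by (induction x rule: tensor_induct; simp add: clinear_add[OF fg_linear(1)]
        clinear_add[OF fg_linear(2)] distrib_left distrib_right)+
qed

lemma f_units:
  "r \<in> I \<Longrightarrow> f ((L r \<rhd> a) \<otimes> b) = (1 \<otimes>\<^sub>m L r \<otimes>\<^sub>m 1) * f (a \<otimes> b)"
  "r \<in> I \<Longrightarrow> f ((a \<lhd> L r) \<otimes> b) = f (a \<otimes> b) * (1 \<otimes>\<^sub>m L r \<otimes>\<^sub>m 1)"
  "f (a \<otimes> (k \<rhd> b)) = (1 \<otimes>\<^sub>m 1 \<otimes>\<^sub>m k) * f (a \<otimes> b)"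
  "f (a \<otimes> (b \<lhd> k)) = f (a \<otimes> b) * (1 \<otimes>\<^sub>m 1 \<otimes>\<^sub>m k)"
proof -
  have third: "1 \<otimes>\<^sub>m 1 \<otimes>\<^sub>m (m * n) = (1 \<otimes>\<^sub>m 1 \<otimes>\<^sub>m m) * (1 \<otimes>\<^sub>m 1 \<otimes>\<^sub>m n)" for m n :: "'a multiplier"
    by (simp add: mult_tensor_mult)
  note simps = fg_pure comult_units leg_times leg_pure(1) of_alg_left of_alg_right third mult.assoc
  show "f ((L r \<rhd> a) \<otimes> b) = (1 \<otimes>\<^sub>m L r \<otimes>\<^sub>m 1) * f (a \<otimes> b)" if "r \<in> I"
    using that by (simp add: simps)
  have "((1 :: 'a multiplier) \<otimes>\<^sub>m 1 \<otimes>\<^sub>m of_alg b) * (1 \<otimes>\<^sub>m L r \<otimes>\<^sub>m 1)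
      = (1 \<otimes>\<^sub>m L r \<otimes>\<^sub>m 1) * (1 \<otimes>\<^sub>m 1 \<otimes>\<^sub>m of_alg b)"
    by (simp add: mult_tensor_mult)
  thus "f ((a \<lhd> L r) \<otimes> b) = f (a \<otimes> b) * (1 \<otimes>\<^sub>m L r \<otimes>\<^sub>m 1)" if "r \<in> I"
    using that by (simp add: simps)
  show "f (a \<otimes> (k \<rhd> b)) = (1 \<otimes>\<^sub>m 1 \<otimes>\<^sub>m k) * f (a \<otimes> b)"
    unfolding fg_pure of_alg_left third mult.assoc[symmetric] leg_commute ..
  show "f (a \<otimes> (b \<lhd> k)) = f (a \<otimes> b) * (1 \<otimes>\<^sub>m 1 \<otimes>\<^sub>m k)"
    unfolding fg_pure of_alg_right third mult.assoc ..
qed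

lemma g_units:
  "r \<in> I \<Longrightarrow> g (a \<otimes> (U r \<rhd> b)) = (1 \<otimes>\<^sub>m U r \<otimes>\<^sub>m 1) * g (a \<otimes> b)"
  "r \<in> I \<Longrightarrow> g (a \<otimes> (b \<lhd> U r)) = g (a \<otimes> b) * (1 \<otimes>\<^sub>m U r \<otimes>\<^sub>m 1)"
  "g ((k \<rhd> a) \<otimes> b) = (k \<otimes>\<^sub>m 1) * g (a \<otimes> b)"
  "g ((a \<lhd> k) \<otimes> b) = g (a \<otimes> b) * (k \<otimes>\<^sub>m 1)"
proof -
  show "g (a \<otimes> (U r \<rhd> b)) = (1 \<otimes>\<^sub>m U r \<otimes>\<^sub>m 1) * g (a \<otimes> b)" if "r \<in> I"
    using that by (simp add: fg_pure comult_units leg_times leg_pure mult.assoc)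
  have "(of_alg a \<otimes>\<^sub>m 1) * (1 \<otimes>\<^sub>m U r \<otimes>\<^sub>m (1 :: 'a multiplier)) = (1 \<otimes>\<^sub>m U r \<otimes>\<^sub>m 1) * (of_alg a \<otimes>\<^sub>m 1)"
    by (simp add: mult_tensor_mult)
  thus "g (a \<otimes> (b \<lhd> U r)) = g (a \<otimes> b) * (1 \<otimes>\<^sub>m U r \<otimes>\<^sub>m 1)" if "r \<in> I"
    using that by (simp add: fg_pure comult_units leg_times leg_pure mult.assoc)
  show "g ((k \<rhd> a) \<otimes> b) = (k \<otimes>\<^sub>m 1) * g (a \<otimes> b)"
    unfolding fg_pure of_alg_left leg1_times mult.assoc[symmetric] leg_commute ..
  show "g ((a \<lhd> k) \<otimes> b) = g (a \<otimes> b) * (k \<otimes>\<^sub>m 1)"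
    unfolding fg_pure of_alg_right leg1_times mult.assoc ..
qed

text \<open>This is how \<open>\<Delta> \<otimes> id\<close> carries \<open>E\<close> to
  \<open>1 \<otimes> E\<close>, and \<open>id \<otimes> \<Delta>\<close> carries it to
  \<open>E \<otimes> 1\<close>. If the first leg is supported at \<open>L r\<close>, then
  \<open>E\<close> only applies \<open>U r\<close> to the second leg. Now \<open>\<Delta>\<close>
  carries \<open>L r\<close> into its second leg, so \<open>f\<close> produces
  \<open>1 \<otimes>\<^sub>m L r \<otimes>\<^sub>m U r\<close>, which is \<open>leg23 E\<close> next
  to \<open>L r\<close> in the middle leg. For \<open>g\<close> the second leg is supported at
  \<open>U r\<close> instead.\<close>

lemma fg_E:
  "f (E \<rhd> x) = leg23 E * f x" "f (x \<lhd> E) = f x * leg23 E"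
  "g (E \<rhd> x) = leg12 E * g x" "g (x \<lhd> E) = g x * leg12 E"
proof -
  have times: "clinear (\<lambda>x. h * k x)" "clinear (\<lambda>x. k x * h)" if "clinear k"
    for h :: "('a, ('a, 'a) tensor) tensor multiplier" and k :: "('a, 'a) tensor \<Rightarrow> _"
    by (rule clinear_compose[OF _ that], rule clinear_mult_left clinear_mult_right)+
  note lin = clinear_compose[OF fg_linear(1)] clinear_compose[OF fg_linear(2)]
  have legs: "leg23 E * (1 \<otimes>\<^sub>m L r \<otimes>\<^sub>m 1) = 1 \<otimes>\<^sub>m L r \<otimes>\<^sub>m U r"
    "(1 \<otimes>\<^sub>m L r \<otimes>\<^sub>m 1) * leg23 E = 1 \<otimes>\<^sub>m L r \<otimes>\<^sub>m U r"
    "leg12 E * (1 \<otimes>\<^sub>m U r \<otimes>\<^sub>m 1) = L r \<otimes>\<^sub>m U r \<otimes>\<^sub>m 1"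
    "(1 \<otimes>\<^sub>m U r \<otimes>\<^sub>m 1) * leg12 E = L r \<otimes>\<^sub>m U r \<otimes>\<^sub>m 1" if "r \<in> I" for r
  proof -
    have "leg23 E * leg23 (L r \<otimes>\<^sub>m 1) = leg23 (L r \<otimes>\<^sub>m U r)" "leg23 (L r \<otimes>\<^sub>m 1) * leg23 E
        = leg23 (L r \<otimes>\<^sub>m U r)"
      "leg12 E * leg12 (1 \<otimes>\<^sub>m U r) = leg12 (L r \<otimes>\<^sub>m U r)" "leg12 (1 \<otimes>\<^sub>m U r) * leg12 E = leg12 (L r \<otimes>\<^sub>m U r)"
      by (simp_all only: leg_times[symmetric] E_units[OF that])
    thus "leg23 E * (1 \<otimes>\<^sub>m L r \<otimes>\<^sub>m 1) = 1 \<otimes>\<^sub>m L r \<otimes>\<^sub>m U r"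
      "(1 \<otimes>\<^sub>m L r \<otimes>\<^sub>m 1) * leg23 E = 1 \<otimes>\<^sub>m L r \<otimes>\<^sub>m U r"
      "leg12 E * (1 \<otimes>\<^sub>m U r \<otimes>\<^sub>m 1) = L r \<otimes>\<^sub>m U r \<otimes>\<^sub>m 1"
      "(1 \<otimes>\<^sub>m U r \<otimes>\<^sub>m 1) * leg12 E = L r \<otimes>\<^sub>m U r \<otimes>\<^sub>m 1"
      by (simp_all add: leg_pure)
  qed
  show "f (E \<rhd> x) = leg23 E * f x"
  proof (rule tensor_decomposition_eqI(1)[OF lin(1)[OF mult_left_linear] times(1)[OF fg_linear(1)]
      decomp(3)])
    fix r a b assume r: "r \<in> I"
    show "f (E \<rhd> ((L r \<rhd> a) \<otimes> b)) = leg23 E * f ((L r \<rhd> a) \<otimes> b)"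
      by (simp add: E_pure[OF r] f_units r legs[OF r] mult_tensor_mult flip: mult.assoc)
  qed
  show "f (x \<lhd> E) = f x * leg23 E"
  proof (rule tensor_decomposition_eqI(1)[OF lin(1)[OF mult_right_linear] times(2)[OF fg_linear(1)]
      decomp(4)])
    fix r a b assume r: "r \<in> I"
    show "f (((a \<lhd> L r) \<otimes> b) \<lhd> E) = f ((a \<lhd> L r) \<otimes> b) * leg23 E"
      by (simp add: E_pure[OF r] f_units r legs[OF r] mult_tensor_mult mult.assoc)
  qed
  show "g (E \<rhd> x) = leg12 E * g x"
  proof (rule tensor_decomposition_eqI(2)[OF lin(2)[OF mult_left_linear] times(1)[OF fg_linear(2)]
      decomp(1)])
    fix r a b assume r: "r \<in> I"
    show "g (E \<rhd> (a \<otimes> (U r \<rhd> b))) = leg12 E * g (a \<otimes> (U r \<rhd> b))"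
      by (simp add: E_pure[OF r] g_units r legs[OF r] mult_tensor_mult flip: mult.assoc)
  qed
  show "g (x \<lhd> E) = g x * leg12 E"
  proof (rule tensor_decomposition_eqI(2)[OF lin(2)[OF mult_right_linear] times(2)[OF fg_linear(2)]
      decomp(2)])
    fix r a b assume r: "r \<in> I"
    show "g ((a \<otimes> (b \<lhd> U r)) \<lhd> E) = g (a \<otimes> (b \<lhd> U r)) * leg12 E"
      by (simp add: E_pure[OF r] g_units r legs[OF r] mult_tensor_mult mult.assoc)
  qed
qed

lemma products_span: "a \<in> cspan {v * w | v w. True}" for a :: 'a
  using idempotent unfolding idempotent_algebra_def set_product_def by simp

text \<open>Combines \<open>comult_span\<close> in two legs with \<open>A = A A\<close> in the
  remaining one. This is the spanning condition required for extending \<open>f\<close> and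
  \<open>g\<close> to multipliers.\<close>

lemma fg_span:
  "leg12 E \<rhd> z \<in> cspan {f x \<rhd> w | x w. True}" "z \<lhd> leg12 E \<in> cspan {w \<lhd> f x | x w. True}"
  "leg23 E \<rhd> z \<in> cspan {g x \<rhd> w | x w. True}" "z \<lhd> leg23 E \<in> cspan {w \<lhd> g x | x w. True}"
proof -
  have f_act: "f (p \<otimes> v) \<rhd> tensor_assoc (w \<otimes> u) = tensor_assoc ((\<Delta> p \<rhd> w) \<otimes> (v * u))"
    "tensor_assoc (w \<otimes> u) \<lhd> f (p \<otimes> v) = tensor_assoc ((w \<lhd> \<Delta> p) \<otimes> (u * v))" for p v w u
    by (simp_all add: fg_pure leg12_third mult_transport_actions[OF algebra_iso_assoc] mult_tensor_pure)
  have g_act: "g (v \<otimes> p) \<rhd> (u \<otimes> w) = (v * u) \<otimes> (\<Delta> p \<rhd> w)"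
    "(u \<otimes> w) \<lhd> g (v \<otimes> p) = (u * v) \<otimes> (w \<lhd> \<Delta> p)" for p v w u
    by (simp_all add: fg_pure leg23_first mult_tensor_pure)
  have E_act: "leg12 E \<rhd> tensor_assoc (y \<otimes> c) = tensor_assoc ((E \<rhd> y) \<otimes> c)"
    "tensor_assoc (y \<otimes> c) \<lhd> leg12 E = tensor_assoc ((y \<lhd> E) \<otimes> c)"
    "leg23 E \<rhd> (c \<otimes> y) = c \<otimes> (E \<rhd> y)" "(c \<otimes> y) \<lhd> leg23 E = c \<otimes> (y \<lhd> E)" for y c
    by (simp_all add: leg12_def leg23_def mult_transport_actions[OF algebra_iso_assoc] mult_tensor_pure)
  note span = tensor_subspace_span[OF comult_span(1) products_span]
      tensor_subspace_span[OF comult_span(2) products_span]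
    tensor_subspace_span[OF products_span comult_span(1)]
        tensor_subspace_span[OF products_span comult_span(2)]
  have 12: "leg12 E \<rhd> tensor_assoc (y \<otimes> c) \<in> cspan {f x \<rhd> w | x w. True}"
    "tensor_assoc (y \<otimes> c) \<lhd> leg12 E \<in> cspan {w \<lhd> f x | x w. True}" for y c
    unfolding E_act
    by (rule clinear_span_into[OF clinear_tensor_assoc cvec.subspace_span _ span(1)]
        clinear_span_into[OF clinear_tensor_assoc cvec.subspace_span _ span(2)];
        use f_act[symmetric] in \<open>blast intro: cvec.span_base\<close>)+
  have 23: "leg23 E \<rhd> (c \<otimes> y) \<in> cspan {g x \<rhd> w | x w. True}"
    "(c \<otimes> y) \<lhd> leg23 E \<in> cspan {w \<lhd> g x | x w. True}" for y c
    unfolding E_act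
    by (rule clinear_span_into[OF clinear_ident cvec.subspace_span _ span(3)]
        clinear_span_into[OF clinear_ident cvec.subspace_span _ span(4)];
        use g_act[symmetric] in \<open>blast intro: cvec.span_base\<close>)+
  show "leg23 E \<rhd> z \<in> cspan {g x \<rhd> w | x w. True}" "z \<lhd> leg23 E \<in> cspan {w \<lhd> g x | x w. True}"
    by (induction z rule: tensor_induct; (rule 23)?; simp only: mult_left_add mult_right_add
        cvec.span_add)+
  have assoc: "leg12 E \<rhd> tensor_assoc t \<in> cspan {f x \<rhd> w | x w. True}"
    "tensor_assoc t \<lhd> leg12 E \<in> cspan {w \<lhd> f x | x w. True}" for t
    by (induction t rule: tensor_induct; (rule 12)?;
        simp only: mult_left_add mult_right_add cvec.span_add clinear_add[OF clinear_tensor_assoc])+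
  have "surj (tensor_assoc :: (('a, 'a) tensor, 'a) tensor \<Rightarrow> _)"
    using algebra_iso_assoc unfolding algebra_iso_def by (blast dest: bij_is_surj)
  then obtain t where z: "z = tensor_assoc t" by (rule surjE)
  show "leg12 E \<rhd> z \<in> cspan {f x \<rhd> w | x w. True}" "z \<lhd> leg12 E \<in> cspan {w \<lhd> f x | x w. True}"
    unfolding z by (rule assoc)+
qed

text \<open>By uniqueness it suffices that \<open>leg23 E * leg12 E\<close> satisfies the defining
  equations. For each of \<open>f\<close> and \<open>g\<close>, one of the two factors is absorbed
  and the other acts as described by \<open>fg_E\<close>.\<close>

lemma extension_E:
  "multiplier_extension UNIV f (leg12 E) E = leg23 E * leg12 E"
  "multiplier_extension UNIV g (leg23 E) E = leg23 E * leg12 E"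
proof -
  have a: "leg12 E * (leg23 E * leg12 E) = leg23 E * leg12 E" "leg23 E * leg12 E * leg12 E
      = leg23 E * leg12 E"
    "leg23 E * (leg23 E * leg12 E) = leg23 E * leg12 E" "leg23 E * leg12 E * leg23 E = leg23 E * leg12 E"
    by (metis E_legs_commute leg_idem mult.assoc)+
  have b: "leg23 E * leg12 E * f c = f (E \<rhd> c)" "f c * (leg23 E * leg12 E) = f (c \<lhd> E)"
    "leg23 E * leg12 E * g c = g (E \<rhd> c)" "g c * (leg23 E * leg12 E) = g (c \<lhd> E)" for c
    unfolding fg_E by (metis E_legs_commute fg_absorb mult.assoc)+
  show "multiplier_extension UNIV f (leg12 E) E = leg23 E * leg12 E"
    by (rule multiplier_extension_eqI[OF N3]) (use fg_span a b in simp_all)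
  show "multiplier_extension UNIV g (leg23 E) E = leg23 E * leg12 E"
    by (rule multiplier_extension_eqI[OF N3]) (use fg_span a b in simp_all)
qed

text \<open>
  Coassociativity is only given for multipliers acting on the corner \<open>E (A \<otimes> A) E\<close>. Since \<open>E (A \<otimes> A)\<close>
  is spanned by products of the corner with \<open>A \<otimes> A\<close>, the multiplier \<open>n\<close> below represents the iterated
  coproduct of \<open>b\<close> on all of \<open>A \<otimes> A\<close>.
\<close>

lemma comult_twice_exists:
  fixes h :: "('a, 'a) tensor \<Rightarrow> ('a, ('a, 'a) tensor) tensor multiplier"
  assumes lin: "clinear h" and times: "\<And>x y. h (x * y) = h x * h y"
    and pq: "p * q = q * p" "p * p = p" "q * q = q"
    and hE: "\<And>x. h (E \<rhd> x) = q * h x" "\<And>x. h (x \<lhd> E) = h x * q"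
    and ph: "\<And>x. p * h x = h x" "\<And>x. h x * p = h x"
    and span: "\<And>z. p \<rhd> z \<in> cspan {h x \<rhd> w | x w. True}" "\<And>z. z \<lhd> p \<in> cspan {w \<lhd> h x | x w. True}"
  obtains n where "(p * q) * n = n" "n * (p * q) = n" "\<And>x. n * h x = h (\<Delta> b \<rhd> x)" "\<And>x. h x * n
      = h (x \<lhd> \<Delta> b)"
    "multiplier_extension (corner E) h (p * q) (\<Delta> b) = n"
proof -
  \<comment> \<open>\<open>p\<close> is the idempotent absorbed by \<open>h\<close>, and
    \<open>q\<close> the one through which \<open>E\<close> acts under \<open>h\<close>:
    \<open>leg12 E\<close> and \<open>leg23 E\<close> for \<open>\<Delta> \<otimes> id\<close>,
    interchanged for \<open>id \<otimes> \<Delta>\<close>.\<close>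
  let ?C = "corner E" and ?e = "p * q"
  have e: "?e * ?e = ?e" using pq by (metis mult.assoc)
  have m: "\<Delta> b \<rhd> c \<in> ?C" "c \<lhd> \<Delta> b \<in> ?C" if "c \<in> ?C" for c
  proof -
    have "E \<rhd> \<Delta> b \<rhd> c = \<Delta> b \<rhd> c" "c \<lhd> \<Delta> b \<lhd> E = c \<lhd> \<Delta> b"
      using E_comult[of b] by (metis multiplier_actions(1), metis multiplier_actions(2))
    thus "\<Delta> b \<rhd> c \<in> ?C" "c \<lhd> \<Delta> b \<in> ?C"
      using that mult_left_mult_right[OF N2, of "\<Delta> b" c E] mult_left_mult_right[OF N2, of E c "\<Delta> b"]
          unfolding corner_def by auto
  qed
  have he: "?e * h c = h c" "h c * ?e = h c" if "c \<in> ?C" for c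
  proof -
    have c: "E \<rhd> c = c" "c \<lhd> E = c" using that unfolding corner_def by auto
    have "q * h c = h c" "h c * q = h c"
        by (rule hE(1)[of c, unfolded c, symmetric], rule hE(2)[of c, unfolded c, symmetric])
    thus "?e * h c = h c" "h c * ?e = h c"
        by (simp only: mult.assoc ph, simp only: mult.assoc[symmetric] ph)
  qed
  have act: "clinear (\<lambda>x. h x \<rhd> w)" "clinear (\<lambda>x. w \<lhd> h x)" for w
    by (rule clinearI; simp add: clinear_add[OF lin] clinear_scaleC[OF lin])+
  have local_span: "h (E \<rhd> x) \<rhd> w \<in> cspan {h c \<rhd> w | c w. c \<in> ?C}" "w \<lhd> h (x \<lhd> E)
      \<in> cspan {w \<lhd> h c | c w. c \<in> ?C}" for x w
  proof -
    have "h y \<rhd> w \<in> cspan {h c \<rhd> w | c w. c \<in> ?C}" if y: "y \<in> {c * w | c w. c \<in> corner E}" for y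
    proof -
      obtain c v where "y = c * v" and c: "c \<in> ?C" using y by auto
      hence "h y \<rhd> w = h c \<rhd> h v \<rhd> w" by (simp add: times)
      thus ?thesis using c by (blast intro: cvec.span_base)
    qed
    thus "h (E \<rhd> x) \<rhd> w \<in> cspan {h c \<rhd> w | c w. c \<in> ?C}"
      by (rule clinear_span_into[OF act(1) cvec.subspace_span _ E_local(1)])
    have "w \<lhd> h y \<in> cspan {w \<lhd> h c | c w. c \<in> ?C}" if y: "y \<in> {w * c | c w. c \<in> corner E}" for y
    proof -
      obtain c v where "y = v * c" and c: "c \<in> ?C" using y by auto
      hence "w \<lhd> h y = w \<lhd> h v \<lhd> h c" by (simp add: times)
      thus ?thesis using c by (blast intro: cvec.span_base)
    qed
    thus "w \<lhd> h (x \<lhd> E) \<in> cspan {w \<lhd> h c | c w. c \<in> ?C}"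
      by (rule clinear_span_into[OF act(2) cvec.subspace_span _ E_local(2)])
  qed
  \<comment> \<open>The values of \<open>h\<close> span the range of \<open>p\<close>. Applying
    \<open>q\<close> replaces \<open>h x\<close> by \<open>h (E \<rhd> x)\<close>, or by
    \<open>h (x \<lhd> E)\<close> on the other side, and \<open>E_local\<close> reduces these to
    elements of the corner.\<close>
  have e_span: "?e \<rhd> z \<in> cspan {h c \<rhd> w | c w. c \<in> ?C}" "z \<lhd> ?e \<in> cspan {w \<lhd> h c | c w. c \<in> ?C}" for z
  proof -
    have "q \<rhd> p \<rhd> z \<in> cspan {h c \<rhd> w | c w. c \<in> ?C}"
    proof (rule clinear_span_into[OF mult_left_linear cvec.subspace_span _ span(1)])
      fix y assume "y \<in> {h x \<rhd> w | x w. True}"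
      then obtain x w where "q \<rhd> y = h (E \<rhd> x) \<rhd> w" by (auto simp: hE)
      thus "q \<rhd> y \<in> cspan {h c \<rhd> w | c w. c \<in> ?C}" using local_span(1) by simp
    qed
    thus "?e \<rhd> z \<in> cspan {h c \<rhd> w | c w. c \<in> ?C}" by (simp add: pq(1))
    have "z \<lhd> p \<lhd> q \<in> cspan {w \<lhd> h c | c w. c \<in> ?C}"
    proof (rule clinear_span_into[OF mult_right_linear cvec.subspace_span _ span(2)])
      fix y assume "y \<in> {w \<lhd> h x | x w. True}"
      then obtain x w where "y \<lhd> q = w \<lhd> h (x \<lhd> E)" by (auto simp: hE)
      thus "y \<lhd> q \<in> cspan {w \<lhd> h c | c w. c \<in> ?C}" using local_span(2) by simp
    qed
    thus "z \<lhd> ?e \<in> cspan {w \<lhd> h c | c w. c \<in> ?C}" by simp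
  qed
  obtain n where n: "?e * n = n" "n * ?e = n" "\<And>c. c \<in> ?C \<Longrightarrow> n * h c = h (\<Delta> b \<rhd> c)"
    "\<And>c. c \<in> ?C \<Longrightarrow> h c * n = h (c \<lhd> \<Delta> b)" "multiplier_extension ?C h ?e (\<Delta> b) = n"
    by (rule multiplier_extension_exists[OF N3 lin times e he e_span m]) blast+
  note lins = clinear_compose[OF clinear_mult_left lin] clinear_compose[OF lin mult_left_linear]
    clinear_compose[OF clinear_mult_right lin] clinear_compose[OF lin mult_right_linear]
  \<comment> \<open>Leaving the corner: \<open>n\<close> absorbs \<open>p * q\<close>, so
    \<open>n * h x = n * h (E \<rhd> x)\<close>. Here \<open>E \<rhd> x\<close> is a combination of
    products \<open>c * w\<close> with \<open>c\<close> in the corner, and the equation for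
    \<open>c\<close> passes to such products since \<open>h\<close> is multiplicative.\<close>
  have "n * h x = h (\<Delta> b \<rhd> x)" for x
  proof -
    have "n * h x = n * h (E \<rhd> x)" using n(2) pq ph hE by (metis mult.assoc)
    also have "\<dots> = h (\<Delta> b \<rhd> E \<rhd> x)"
    proof (rule clinear_eq_on_span[OF lins(1,2) _ E_local(1)])
      fix y assume "y \<in> {c * w | c w. c \<in> corner E}"
      then obtain c w where y: "y = c * w" and c: "c \<in> ?C" by auto
      show "n * h y = h (\<Delta> b \<rhd> y)"
        using n(3)[OF c] by (simp add: y times mult_left_times[OF N2] flip: mult.assoc)
    qed
    also have "\<Delta> b \<rhd> E \<rhd> x = \<Delta> b \<rhd> x" using E_comult(2) by (metis multiplier_actions(1))
    finally show ?thesis .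
  qed
  moreover have "h x * n = h (x \<lhd> \<Delta> b)" for x
  proof -
    have "h x * n = h (x \<lhd> E) * n" using n(1) pq ph hE by (metis mult.assoc)
    also have "\<dots> = h (x \<lhd> E \<lhd> \<Delta> b)"
    proof (rule clinear_eq_on_span[OF lins(3,4) _ E_local(2)])
      fix y assume "y \<in> {w * c | c w. c \<in> corner E}"
      then obtain c w where y: "y = w * c" and c: "c \<in> ?C" by auto
      show "h y * n = h (y \<lhd> \<Delta> b)"
        using n(4)[OF c] by (simp add: y times mult_right_times[OF N2] mult.assoc)
    qed
    also have "x \<lhd> E \<lhd> \<Delta> b = x \<lhd> \<Delta> b" using E_comult(1) by (metis multiplier_actions(2))
    finally show ?thesis .
  qed
  ultimately show ?thesis using that n(1,2,5) by blast
qed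

text \<open>The extensions belonging to \<open>f\<close> and to \<open>g\<close> exist separately,
  and \<open>coassoc\<close> says that they are the same multiplier. A single \<open>n\<close>, the
  iterated coproduct of \<open>b\<close>, thus satisfies equations of both kinds.\<close>

lemma comult_twice:
  obtains n where "leg12 E * leg23 E * n = n" "n * (leg12 E * leg23 E) = n"
    "\<And>x. n * f x = f (\<Delta> b \<rhd> x)" "\<And>x. g x * n = g (x \<lhd> \<Delta> b)"
proof -
  obtain n where n: "leg12 E * leg23 E * n = n" "n * (leg12 E * leg23 E) = n" "\<And>x. n * f x = f (\<Delta> b \<rhd> x)"
    "multiplier_extension (corner E) f (leg12 E * leg23 E) (\<Delta> b) = n"
    by (rule comult_twice_exists[OF fg_linear(1) fg_times(1) E_legs_commute leg_idem fg_E(1,2)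
        fg_absorb(1,2) fg_span(1,2), where b = b]) blast
  obtain n' where n': "\<And>x. g x * n' = g (x \<lhd> \<Delta> b)"
    "multiplier_extension (corner E) g (leg23 E * leg12 E) (\<Delta> b) = n'"
    by (rule comult_twice_exists[OF fg_linear(2) fg_times(2) E_legs_commute[symmetric] leg_idem(2,1)
        fg_E(3,4) fg_absorb(3,4) fg_span(3,4), where b = b]) blast
  have "n = n'" using n(4) n'(2) coassoc[of b] by (simp add: E_legs_commute)
  thus ?thesis using that[OF n(1,2,3)] n'(1) by blast
qed

text \<open>Both compositions send \<open>a \<otimes> b \<otimes> c\<close> to
  \<open>(a \<otimes> 1 \<otimes> 1) n (1 \<otimes> 1 \<otimes> c)\<close>, where \<open>n\<close>
  is the iterated coproduct of \<open>b\<close>.\<close>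

lemma canon_coassoc: "on_legs12 (canon2 \<Delta>) \<circ> on_legs23 (canon1 \<Delta>)
    = on_legs23 (canon1 \<Delta>) \<circ> on_legs12 (canon2 \<Delta>)"
proof -
  have pure: "on_legs12 (canon2 \<Delta>) (on_legs23 (canon1 \<Delta>) (a \<otimes> b \<otimes> c)) =
      on_legs23 (canon1 \<Delta>) (on_legs12 (canon2 \<Delta>) (a \<otimes> b \<otimes> c))" for a b c
  proof (rule of_alg3_inject)
    obtain n where n: "leg12 E * leg23 E * n = n" "n * (leg12 E * leg23 E) = n"
      "\<And>x. n * f x = f (\<Delta> b \<rhd> x)" "\<And>x. g x * n = g (x \<lhd> \<Delta> b)"
      by (rule comult_twice[where b = b]) blast
    have nE: "n * leg12 E = n" "leg23 E * n = n"
      using n(1,2) E_legs_commute leg_idem by (metis mult.assoc)+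
    let ?a = "of_alg a \<otimes>\<^sub>m 1 :: ('a, ('a, 'a) tensor) tensor multiplier"
    let ?c = "1 \<otimes>\<^sub>m 1 \<otimes>\<^sub>m of_alg c :: ('a, ('a, 'a) tensor) tensor multiplier"
    have f1: "f ((1 \<otimes>\<^sub>m of_alg c) \<rhd> x) = ?c * f x" for x
      by (rule fun_cong[OF clinear_tensor_eqI[of "\<lambda>x. f ((1 \<otimes>\<^sub>m of_alg c) \<rhd> x)" "\<lambda>x. ?c * f x"]])
        (use clinear_compose[OF fg_linear(1) mult_left_linear] clinear_compose[OF clinear_mult_left
            fg_linear(1)]
          f_units(3)[of _ "of_alg c"] in \<open>simp_all add: mult_tensor_pure\<close>)
    have g1: "g (x \<lhd> (of_alg a \<otimes>\<^sub>m 1)) = g x * ?a" for x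
      by (rule fun_cong[OF clinear_tensor_eqI[of "\<lambda>x. g (x \<lhd> (of_alg a \<otimes>\<^sub>m 1))" "\<lambda>x. g x * ?a"]])
        (use clinear_compose[OF fg_linear(2) mult_right_linear] clinear_compose[OF clinear_mult_right
            fg_linear(2)]
          g_units(4)[of _ "of_alg a"] in \<open>simp_all add: mult_tensor_pure\<close>)
    \<comment> \<open>\<open>n\<close> is known through its products with values of
      \<open>f\<close>, and these reach only the range of \<open>leg12 E\<close>. Both sides absorb
      \<open>leg12 E\<close> on the right, so testing on that range is enough.\<close>
    have f_canon: "f (canon1 \<Delta> (b \<otimes> c)) = n * ?c"
    proof (rule multiplier_left_eqI[OF N3])
      fix z
      have "f (canon1 \<Delta> (b \<otimes> c)) \<rhd> leg12 E \<rhd> z = (n * ?c) \<rhd> leg12 E \<rhd> z"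
      proof (rule clinear_eq_on_span[OF mult_left_linear mult_left_linear _ fg_span(1)])
        fix y assume "y \<in> {f x \<rhd> w | x w. True}"
        then obtain x w where y: "y = f x \<rhd> w" by blast
        have "canon1 \<Delta> (b \<otimes> c) * x = \<Delta> b \<rhd> (1 \<otimes>\<^sub>m of_alg c) \<rhd> x"
          by (simp only: canon_pure(1)[of b c] multiplier_actions(1) multiplier_actions(11)[symmetric,
              where b = "canon1 \<Delta> (b \<otimes> c)"])
        hence "f (canon1 \<Delta> (b \<otimes> c)) * f x = n * ?c * f x"
          by (simp add: n(3) f1 mult.assoc flip: fg_times) (simp add: n(3) flip: f1)
        thus "f (canon1 \<Delta> (b \<otimes> c)) \<rhd> y = (n * ?c) \<rhd> y"
          unfolding y by (metis multiplier_actions(1))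
      qed
      moreover have "n * ?c * leg12 E = n * ?c" by (metis mult.assoc leg_commute(1) nE(1))
      ultimately show "f (canon1 \<Delta> (b \<otimes> c)) \<rhd> z = (n * ?c) \<rhd> z"
        by (metis fg_absorb(2) multiplier_actions(1))
    qed
    have g_canon: "g (canon2 \<Delta> (a \<otimes> b)) = ?a * n"
    proof (rule multiplier_right_eqI[OF N3])
      fix z
      have "z \<lhd> leg23 E \<lhd> g (canon2 \<Delta> (a \<otimes> b)) = z \<lhd> leg23 E \<lhd> (?a * n)"
      proof (rule clinear_eq_on_span[OF mult_right_linear mult_right_linear _ fg_span(4)])
        fix y assume "y \<in> {w \<lhd> g x | x w. True}"
        then obtain x w where y: "y = w \<lhd> g x" by blast
        have "x * canon2 \<Delta> (a \<otimes> b) = x \<lhd> (of_alg a \<otimes>\<^sub>m 1) \<lhd> \<Delta> b"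
          by (simp only: canon_pure(2)[of a b] multiplier_actions(2) multiplier_actions(12)[symmetric,
              where b = "canon2 \<Delta> (a \<otimes> b)"])
        hence "g x * g (canon2 \<Delta> (a \<otimes> b)) = g x * (?a * n)"
          by (simp add: n(4) g1 flip: fg_times) (simp add: n(4) flip: g1 mult.assoc)
        thus "y \<lhd> g (canon2 \<Delta> (a \<otimes> b)) = y \<lhd> (?a * n)"
          unfolding y by (metis multiplier_actions(2))
      qed
      moreover have "leg23 E * (?a * n) = ?a * (leg23 E * n)"
        by (simp only: mult.assoc[symmetric] leg_commute(2))
      hence "leg23 E * (?a * n) = ?a * n" by (simp only: nE(2))
      ultimately show "z \<lhd> g (canon2 \<Delta> (a \<otimes> b)) = z \<lhd> (?a * n)"
        by (metis fg_absorb(3) multiplier_actions(2))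
    qed
    \<comment> \<open>With \<open>a\<close> fixed in the first leg, applying \<open>canon2\<close>
      to the first two legs becomes left multiplication of \<open>f\<close> by
      \<open>a \<otimes> 1 \<otimes> 1\<close>. In the same way \<open>g_leg\<close> turns
      \<open>canon1\<close> into right multiplication of \<open>g\<close> by
      \<open>1 \<otimes> 1 \<otimes> c\<close>.\<close>
    have f_leg: "of_alg (on_legs12 (canon2 \<Delta>) (a \<otimes> y)) = ?a * f y" for y
    proof (induction y rule: tensor_induct)
      case (pure p q)
      have "on_legs12 (canon2 \<Delta>) (a \<otimes> p \<otimes> q) = tensor_assoc (canon2 \<Delta> (a \<otimes> p) \<otimes> q)"
        using on_legs12_assoc[OF canon_linear(2), of "a \<otimes> p" q] by (simp add: tensor_assoc_pure)
      thus ?case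
        by (simp add: fg_pure canon_pure leg_times leg_pure mult.assoc flip: leg12_of_alg_third)
    qed (simp add: pure_tensor_bilinear clinear_add[OF clinear_on_legs12[OF canon_linear(2)]] of_alg_add
        clinear_add[OF fg_linear(1)] distrib_left)
    have g_leg: "of_alg (on_legs23 (canon1 \<Delta>) (tensor_assoc (y \<otimes> c))) = g y * ?c" for y
    proof (induction y rule: tensor_induct)
      case (pure p q)
      have "of_alg (on_legs23 (canon1 \<Delta>) (tensor_assoc ((p \<otimes> q) \<otimes> c)))
          = of_alg p \<otimes>\<^sub>m (\<Delta> q * (1 \<otimes>\<^sub>m of_alg c))"
        by (simp add: tensor_assoc_pure on_legs23_pure[OF canon_linear(1)] canon_pure flip:
            mult_tensor_of_alg)
      thus ?case by (simp add: fg_pure leg23_first mult_tensor_mult)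
    qed (simp add: pure_tensor_bilinear clinear_add[OF clinear_on_legs23[OF canon_linear(1)]] of_alg_add
        clinear_add[OF fg_linear(2)] clinear_add[OF clinear_tensor_assoc] distrib_right)
    have "on_legs12 (canon2 \<Delta>) (a \<otimes> b \<otimes> c) = tensor_assoc (canon2 \<Delta> (a \<otimes> b) \<otimes> c)"
      using on_legs12_assoc[OF canon_linear(2), of "a \<otimes> b" c] by (simp add: tensor_assoc_pure)
    thus "of_alg (on_legs12 (canon2 \<Delta>) (on_legs23 (canon1 \<Delta>) (a \<otimes> b \<otimes> c))) =
        of_alg (on_legs23 (canon1 \<Delta>) (on_legs12 (canon2 \<Delta>) (a \<otimes> b \<otimes> c)))"
      by (simp add: on_legs23_pure[OF canon_linear(1)] f_leg g_leg f_canon g_canon mult.assoc)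
  qed
  note lin = clinear_on_legs12[OF canon_linear(2)] clinear_on_legs23[OF canon_linear(1)]
  have "on_legs12 (canon2 \<Delta>) (on_legs23 (canon1 \<Delta>) (a \<otimes> y)) =
      on_legs23 (canon1 \<Delta>) (on_legs12 (canon2 \<Delta>) (a \<otimes> y))" for a y
    by (induction y rule: tensor_induct)
      (simp_all only: pure pure_tensor_bilinear clinear_add[OF lin(1)] clinear_add[OF lin(2)])
  thus ?thesis
    unfolding comp_def
    by (rule clinear_tensor_eqI[OF clinear_compose[OF lin] clinear_compose[OF lin(2,1)]])
qed

lemma weak_bialgebra: "regular_weak_multiplier_bialgebra \<Delta> E \<epsilon>"
  unfolding regular_weak_multiplier_bialgebra_def extension_E E_legs_commute
  using idempotent N[unfolded nondegenerate_algebra_def] linear mult E_idem counit_linear wd canon_coassoc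
    counit(1,2) cspan_E counit_E by simp

theorem weak_Hopf_algebra: "regular_weak_multiplier_Hopf_algebra \<Delta>"
  unfolding regular_weak_multiplier_Hopf_algebra_def
  using full full_opposite weak_bialgebra range_canon is_G kernel_canon by blast

end

section \<open>Local units of a partial algebra\<close>

text \<open>Sums and scalar multiples of component functions are again component functions, so
  linearity of the projections is read off from uniqueness.\<close>

lemma direct_sum_projections:
  assumes "internal_direct_sum K V"
  obtains \<pi> where "decomposition K \<pi>" "\<And>k a. k \<in> K \<Longrightarrow> \<pi> k a \<in> V k"
    "\<And>k l a. k \<in> K \<Longrightarrow> l \<in> K \<Longrightarrow> a \<in> V l \<Longrightarrow> \<pi> k a = (if k = l then a else 0)"
proof -
  let ?P = "\<lambda>a f. (\<forall>k\<in>K. f k \<in> V k) \<and> (\<forall>k. k \<notin> K \<longrightarrow> f k = 0) \<and> finite {k. f k \<noteq> 0} \<and> a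
      = (\<Sum>k | f k \<noteq> 0. f k)"
  have V: "\<And>k. k \<in> K \<Longrightarrow> csubspace (V k)" and ex1: "\<And>a. \<exists>!f. ?P a f"
    using assms unfolding internal_direct_sum_def by blast+
  obtain F where F: "\<And>a. ?P a (F a)" using ex1 by metis
  hence F_in: "\<And>a k. k \<in> K \<Longrightarrow> F a k \<in> V k" and F_out: "\<And>a k. k \<notin> K \<Longrightarrow> F a k = 0"
    and F_finite: "\<And>a. finite {k. F a k \<noteq> 0}" and F_sum: "\<And>a. (\<Sum>k | F a k \<noteq> 0. F a k) = a"
    by (blast, blast, blast, metis)
  have F_eq: "F a = f" if "?P a f" for a f using ex1[of a] F[of a] that by blast
  have sum_superset: "a = (\<Sum>k\<in>S. F a k)" if "finite S" "{k. F a k \<noteq> 0} \<subseteq> S" for a S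
  proof -
    have "(\<Sum>k\<in>S. F a k) = (\<Sum>k | F a k \<noteq> 0. F a k)"
      using that by (intro sum.mono_neutral_right) auto
    thus ?thesis using F[of a] by simp
  qed
  have F_I: "F a = f" if f: "\<And>k. k \<in> K \<Longrightarrow> f k \<in> V k" "\<And>k. k \<notin> K \<Longrightarrow> f k = 0" "finite S" "\<And>k. k \<notin> S \<Longrightarrow> f k = 0"
    "a = (\<Sum>k\<in>S. f k)" for a f S
  proof (rule F_eq, intro conjI ballI allI impI)
    have sub: "{k. f k \<noteq> 0} \<subseteq> S" using f(4) by blast
    show "finite {k. f k \<noteq> 0}" using finite_subset[OF sub f(3)] .
    show "a = (\<Sum>k | f k \<noteq> 0. f k)"
      unfolding f(5) using f(3) sub by (intro sum.mono_neutral_right) auto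
  qed (use f in blast)+
  have add: "F (a + b) = (\<lambda>k. F a k + F b k)" for a b
  proof (rule F_I)
    let ?S = "{k. F a k \<noteq> 0} \<union> {k. F b k \<noteq> 0}"
    show S: "finite ?S" using F_finite by blast
    have "a = (\<Sum>k\<in>?S. F a k)" "b = (\<Sum>k\<in>?S. F b k)" by (rule sum_superset[OF S]; blast)+
    thus "a + b = (\<Sum>k\<in>?S. F a k + F b k)" unfolding sum.distrib by (rule arg_cong2)
  qed (simp_all add: F_in F_out cvec.subspace_add[OF V])
  have scale: "F (c *\<^sub>C a) = (\<lambda>k. c *\<^sub>C F a k)" for c a
  proof (rule F_I)
    show "finite {k. F a k \<noteq> 0}" by (rule F_finite)
    show "c *\<^sub>C a = (\<Sum>k | F a k \<noteq> 0. c *\<^sub>C F a k)"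
      by (simp add: F_sum flip: cvec.scale_sum_right)
  qed (simp_all add: F_in F_out cvec.subspace_scale[OF V])
  have single: "F a = (\<lambda>k. if k = l then a else 0)" if "l \<in> K" "a \<in> V l" for a l
    by (rule F_I[of _ "{l}"]) (use that V cvec.subspace_0 in auto)
  define \<pi> where "\<pi> k a = F a k" for k a
  have "decomposition K \<pi>"
    unfolding decomposition_def
  proof (intro conjI ballI allI)
    show "clinear (\<pi> k)" for k by (rule clinearI) (simp_all add: \<pi>_def add scale)
    show "\<pi> k (\<pi> l a) = (if k = l then \<pi> l a else 0)" if "k \<in> K" "l \<in> K" for k l a
      using F_in[OF that(2)] by (simp add: \<pi>_def single[OF that(2)])
    have "{k \<in> K. \<pi> k a \<noteq> 0} = {k. F a k \<noteq> 0}" for a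
      using F_out by (auto simp: \<pi>_def)
    thus "finite {k \<in> K. \<pi> k a \<noteq> 0}" "(\<Sum>k | k \<in> K \<and> \<pi> k a \<noteq> 0. \<pi> k a) = a" for a
      using F_finite F_sum by (simp_all add: \<pi>_def)
  qed
  moreover have "\<pi> k a \<in> V k" if "k \<in> K" for k a using F_in[OF that] by (simp add: \<pi>_def)
  moreover have "\<pi> k a = (if k = l then a else 0)" if "k \<in> K" "l \<in> K" "a \<in> V l" for k l a
    using that by (simp add: \<pi>_def single)
  ultimately show ?thesis using that by blast
qed

text \<open>Selection of components by a predicate on their index. All units of a grading act in
  this way, through a predicate on the row index from the left and on the column index from the
  right.\<close>

definition mask :: "'k set \<Rightarrow> ('k \<Rightarrow> 'a::complex_vector \<Rightarrow> 'a) \<Rightarrow> ('k \<Rightarrow> bool) \<Rightarrow> 'a \<Rightarrow> 'a" where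
  "mask K \<pi> Q a = (\<Sum>k | k \<in> K \<and> \<pi> k a \<noteq> 0. if Q k then \<pi> k a else 0)"

context
  fixes K :: "'k set" and \<pi> :: "'k \<Rightarrow> 'a::complex_vector \<Rightarrow> 'a"
  assumes dec: "decomposition K \<pi>"
begin

lemma mask_superset:
  assumes "finite F" "F \<subseteq> K" "\<And>k. k \<in> K \<Longrightarrow> \<pi> k a \<noteq> 0 \<Longrightarrow> k \<in> F"
  shows "mask K \<pi> Q a = (\<Sum>k\<in>F. if Q k then \<pi> k a else 0)"
  unfolding mask_def using assms by (intro sum.mono_neutral_left) auto

lemma clinear_mask: "clinear (mask K \<pi> Q)"
proof (rule clinearI)
  note lin = clinear_add[OF decomposition_linear[OF dec]] clinear_scaleC[OF decomposition_linear[OF dec]]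
  fix a b c
  let ?F = "{k\<in>K. \<pi> k a \<noteq> 0} \<union> {k\<in>K. \<pi> k b \<noteq> 0}"
  have F: "finite ?F" "?F \<subseteq> K" using decomposition_finite[OF dec] by auto
  have "\<pi> k (a + b) = 0" "\<pi> k (c *\<^sub>C a) = 0" if "k \<in> K" "k \<notin> ?F" for k
    using that by (simp_all add: lin)
  note zero = this
  have *: "mask K \<pi> Q (a + b) = (\<Sum>k\<in>?F. if Q k then \<pi> k (a + b) else 0)"
    "mask K \<pi> Q (c *\<^sub>C a) = (\<Sum>k\<in>?F. if Q k then \<pi> k (c *\<^sub>C a) else 0)"
    "mask K \<pi> Q a = (\<Sum>k\<in>?F. if Q k then \<pi> k a else 0)" "mask K \<pi> Q b = (\<Sum>k\<in>?F. if Q k then \<pi> k b else 0)"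
    by (rule mask_superset[OF F]; use zero in blast)+
  show "mask K \<pi> Q (a + b) = mask K \<pi> Q a + mask K \<pi> Q b"
    unfolding * sum.distrib[symmetric] using F(2) by (intro sum.cong) (auto simp: lin)
  show "mask K \<pi> Q (c *\<^sub>C a) = c *\<^sub>C mask K \<pi> Q a"
    unfolding * cvec.scale_sum_right using F(2) by (intro sum.cong) (auto simp: lin)
qed

lemma mask_single:
  assumes "l \<in> K"
  shows "mask K \<pi> Q (\<pi> l a) = (if Q l then \<pi> l a else 0)"
proof -
  have "mask K \<pi> Q (\<pi> l a) = (\<Sum>k\<in>{l}. if Q k then \<pi> k (\<pi> l a) else 0)"
    using assms decomposition_orth[OF dec _ assms] by (intro mask_superset) auto
  thus ?thesis by (simp add: decomposition_idem[OF dec assms])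
qed

lemma mask_cong: "(\<And>k. k \<in> K \<Longrightarrow> \<pi> k a \<noteq> 0 \<Longrightarrow> Q k = Q' k) \<Longrightarrow> mask K \<pi> Q a = mask K \<pi> Q' a"
  unfolding mask_def by (intro sum.cong) auto

lemma mask_mask: "mask K \<pi> Q (mask K \<pi> Q' a) = mask K \<pi> (\<lambda>k. Q k \<and> Q' k) a"
  by (rule decomposition_eqI[OF dec clinear_compose[OF clinear_mask clinear_mask] clinear_mask])
    (simp add: mask_single clinear_0[OF clinear_mask])

text \<open>Coarsens a grading along \<open>\<kappa>\<close>. Exchanging the sum over blocks with
  the sum over components leaves each component once, in the block
  \<open>\<kappa> k\<close>.\<close>

lemma decomposition_mask:
  assumes "\<And>k. k \<in> K \<Longrightarrow> \<kappa> k \<in> I"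
  shows "decomposition I (\<lambda>r. mask K \<pi> (\<lambda>k. \<kappa> k = r))"
  unfolding decomposition_def
proof (intro conjI ballI allI clinear_mask)
  show "mask K \<pi> (\<lambda>k. \<kappa> k = r) (mask K \<pi> (\<lambda>k. \<kappa> k = s) a)
      = (if r = s then mask K \<pi> (\<lambda>k. \<kappa> k = s) a else 0)" for r s a
  proof (cases "r = s")
    case False
    hence "mask K \<pi> (\<lambda>k. \<kappa> k = r \<and> \<kappa> k = s) a = 0" unfolding mask_def by (intro sum.neutral) auto
    thus ?thesis using False by (simp add: mask_mask)
  qed (simp add: mask_mask)
  fix a
  let ?S = "{k \<in> K. \<pi> k a \<noteq> 0}"
  have fin: "finite (\<kappa> ` ?S)" using decomposition_finite[OF dec] by simp
  have sub: "{r \<in> I. mask K \<pi> (\<lambda>k. \<kappa> k = r) a \<noteq> 0} \<subseteq> \<kappa> ` ?S"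
  proof clarify
    fix r assume "mask K \<pi> (\<lambda>k. \<kappa> k = r) a \<noteq> 0"
    then obtain k where "k \<in> ?S" "(if \<kappa> k = r then \<pi> k a else 0) \<noteq> 0"
      unfolding mask_def by (rule sum.not_neutral_contains_not_neutral)
    hence "k \<in> ?S" "\<kappa> k = r" by (auto split: if_splits)
    thus "r \<in> \<kappa> ` ?S" by blast
  qed
  show "finite {r \<in> I. mask K \<pi> (\<lambda>k. \<kappa> k = r) a \<noteq> 0}" using finite_subset[OF sub fin] .
  have "(\<Sum>r | r \<in> I \<and> mask K \<pi> (\<lambda>k. \<kappa> k = r) a \<noteq> 0. mask K \<pi> (\<lambda>k. \<kappa> k = r) a) =
      (\<Sum>r\<in>\<kappa> ` ?S. mask K \<pi> (\<lambda>k. \<kappa> k = r) a)"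
    using sub fin assms by (intro sum.mono_neutral_left) auto
  also have "\<dots> = (\<Sum>k\<in>?S. \<Sum>r\<in>\<kappa> ` ?S. if \<kappa> k = r then \<pi> k a else 0)"
    unfolding mask_def by (rule sum.swap)
  also have "\<dots> = (\<Sum>k\<in>?S. \<pi> k a)" using fin by (intro sum.cong) (auto simp: sum.delta)
  also have "\<dots> = a" by (rule decomposition_sum[OF dec])
  finally show "(\<Sum>r | r \<in> I \<and> mask K \<pi> (\<lambda>k. \<kappa> k = r) a \<noteq> 0. mask K \<pi> (\<lambda>k. \<kappa> k = r) a) = a" .
qed

end

section \<open>Strict sums, and the multipliers attached to predicates on the index set\<close>

lemma strictly_tendsto_unique:
  assumes "strictly_tendsto u m F" "strictly_tendsto u n F" "F \<noteq> bot"
  shows "m = n"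
proof -
  have "\<forall>\<^sub>F x in F. m \<rhd> a = n \<rhd> a \<and> a \<lhd> m = a \<lhd> n" for a
    using assms(1,2)[unfolded strictly_tendsto_def, rule_format, of a] by eventually_elim auto
  thus ?thesis using assms(3) by (intro multiplier_eqI) simp_all
qed

lemma strict_sum_eqI:
  assumes "strictly_tendsto (sum u) m (finite_subsets_at_top S)"
  shows "strict_sum u S = m"
  unfolding strict_sum_def
  using assms by (rule the_equality) (rule strictly_tendsto_unique[OF _ assms
      finite_subsets_at_top_neq_bot])

lemma sum_multiplier_actions:
  "(\<Sum>x\<in>F. u x) \<rhd> a = (\<Sum>x\<in>F. u x \<rhd> a)" "a \<lhd> (\<Sum>x\<in>F. u x) = (\<Sum>x\<in>F. a \<lhd> u x)"
  by (induction F rule: infinite_finite_induct) auto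

locale partial_algebra_units =
  fixes J :: "'j set" and A :: "'j \<Rightarrow> 'j \<Rightarrow> 'a::complex_algebra set"
  assumes pa: "partial_algebra J A"
begin

definition proj :: "'j \<times> 'j \<Rightarrow> 'a \<Rightarrow> 'a" where
  "proj = (SOME \<pi>. decomposition (J \<times> J) \<pi> \<and> (\<forall>k\<in>J \<times> J. \<forall>a. \<pi> k a \<in> A (fst k) (snd k)) \<and>
     (\<forall>k\<in>J \<times> J. \<forall>l\<in>J \<times> J. \<forall>a\<in>A (fst l) (snd l). \<pi> k a = (if k = l then a else 0)))"

lemma proj: "decomposition (J \<times> J) proj"
  "p \<in> J \<Longrightarrow> q \<in> J \<Longrightarrow> proj (p, q) a \<in> A p q"
  "p \<in> J \<Longrightarrow> q \<in> J \<Longrightarrow> a \<in> A p q \<Longrightarrow> proj (p, q) a = a"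
proof -
  have "internal_direct_sum (J \<times> J) (\<lambda>k. A (fst k) (snd k))"
    using pa unfolding partial_algebra_def by (simp add: case_prod_unfold)
  from direct_sum_projections[OF this]
  have "\<exists>\<pi>. decomposition (J \<times> J) \<pi> \<and> (\<forall>k\<in>J \<times> J. \<forall>a. \<pi> k a \<in> A (fst k) (snd k)) \<and>
     (\<forall>k\<in>J \<times> J. \<forall>l\<in>J \<times> J. \<forall>a\<in>A (fst l) (snd l). \<pi> k a = (if k = l then a else 0))"
    by (metis (no_types, lifting))
  from someI_ex[OF this, folded proj_def]
  show "decomposition (J \<times> J) proj" "p \<in> J \<Longrightarrow> q \<in> J \<Longrightarrow> proj (p, q) a \<in> A p q"
    "p \<in> J \<Longrightarrow> q \<in> J \<Longrightarrow> a \<in> A p q \<Longrightarrow> proj (p, q) a = a"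
    by force+
qed

lemma homogeneous_eqI:
  assumes "clinear f" "clinear g" "\<And>p q a. p \<in> J \<Longrightarrow> q \<in> J \<Longrightarrow> a \<in> A p q \<Longrightarrow> f a = g a"
  shows "f a = g a"
proof (rule decomposition_eqI[OF proj(1) assms(1,2)])
  fix k a assume "k \<in> J \<times> J"
  then obtain p q where k: "k = (p, q)" "p \<in> J" "q \<in> J" by blast
  show "f (proj k a) = g (proj k a)" unfolding k(1) by (rule assms(3)[OF k(2,3) proj(2)[OF k(2,3)]])
qed

lemma homogeneous_into:
  assumes "clinear f" "csubspace V" "\<And>p q a. p \<in> J \<Longrightarrow> q \<in> J \<Longrightarrow> a \<in> A p q \<Longrightarrow> f a \<in> V"
  shows "f a \<in> V"
proof -
  have "a \<in> f -` V"
  proof (rule decomposition_into[OF proj(1) cvec_pair.linear_subspace_vimage[OF assms(1,2)]])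
    fix k assume "k \<in> J \<times> J"
    then obtain p q where k: "k = (p, q)" "p \<in> J" "q \<in> J" by blast
    show "proj k a \<in> f -` V" unfolding k(1) using assms(3)[OF k(2,3) proj(2)[OF k(2,3)]] by simp
  qed
  thus ?thesis by simp
qed

lemma product_zero: "p \<in> J \<Longrightarrow> q \<in> J \<Longrightarrow> p' \<in> J \<Longrightarrow> q' \<in> J \<Longrightarrow> a \<in> A p q \<Longrightarrow> b \<in> A p' q' \<Longrightarrow> q \<noteq> p' \<Longrightarrow> a * b = 0"
  by (rule pa[unfolded partial_algebra_def, THEN conjunct2, THEN conjunct1, rule_format])

lemma component_subspace: "p \<in> J \<Longrightarrow> q \<in> J \<Longrightarrow> csubspace (A p q)"
  using pa[unfolded partial_algebra_def internal_direct_sum_def, THEN conjunct1, THEN conjunct1,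
      rule_format, of "(p, q)"]
  by simp

text \<open>One construction for base units (\<open>p = r\<close>), upper units
  (\<open>fst p = r\<close>) and lower units (\<open>snd p = r\<close>). Products of units become
  conjunctions of predicates and strict sums of base units become disjunctions.\<close>

definition unit :: "('j \<Rightarrow> bool) \<Rightarrow> 'a multiplier" where
  "unit Q = Abs_multiplier (mask (J \<times> J) proj (Q \<circ> fst), mask (J \<times> J) proj (Q \<circ> snd))"

lemma mask_homogeneous:
  "p \<in> J \<Longrightarrow> q \<in> J \<Longrightarrow> a \<in> A p q \<Longrightarrow> mask (J \<times> J) proj Q a = (if Q (p, q) then a else 0)"
  using mask_single[OF proj(1), of "(p, q)" Q a] by (simp add: proj(3))

text \<open>The pair in the definition of \<open>unit\<close> must first be shown to be a
  multiplier. For homogeneous factors, either the inner indices differ and the product is zero, or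
  they agree and both sides test \<open>Q\<close> at the same index.\<close>

lemma unit_mask: "unit Q \<rhd> a = mask (J \<times> J) proj (Q \<circ> fst) a" "a \<lhd> unit Q = mask (J \<times> J) proj (Q \<circ> snd) a"
proof -
  have lin: "clinear (mask (J \<times> J) proj Q)" for Q by (rule clinear_mask[OF proj(1)])
  have "a * mask (J \<times> J) proj (Q \<circ> fst) b = mask (J \<times> J) proj (Q \<circ> snd) a * b" for a b
  proof (rule homogeneous_eqI[of "\<lambda>a. a * mask (J \<times> J) proj (Q \<circ> fst) b"
      "\<lambda>a. mask (J \<times> J) proj (Q \<circ> snd) a * b"])
    fix p q a assume a: "p \<in> J" "q \<in> J" "a \<in> A p q"
    show "a * mask (J \<times> J) proj (Q \<circ> fst) b = mask (J \<times> J) proj (Q \<circ> snd) a * b"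
    proof (rule homogeneous_eqI[of "\<lambda>b. a * mask (J \<times> J) proj (Q \<circ> fst) b"])
      fix p' q' b assume b: "p' \<in> J" "q' \<in> J" "b \<in> A p' q'"
      show "a * mask (J \<times> J) proj (Q \<circ> fst) b = mask (J \<times> J) proj (Q \<circ> snd) a * b"
        using a b product_zero[OF a(1,2) b(1,2) a(3) b(3)]
            by (cases "q = p'") (simp_all add: mask_homogeneous)
    qed (rule clinear_compose[OF clinear_mult_left lin] clinear_mult_left)+
  qed (rule clinear_mult_right clinear_compose[OF clinear_mult_right lin])+
  hence "Rep_multiplier (unit Q) = (mask (J \<times> J) proj (Q \<circ> fst), mask (J \<times> J) proj (Q \<circ> snd))"
    unfolding unit_def using lin by (intro Abs_multiplier_inverse) simp
  thus "unit Q \<rhd> a = mask (J \<times> J) proj (Q \<circ> fst) a" "a \<lhd> unit Q = mask (J \<times> J) proj (Q \<circ> snd) a"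
    by (simp_all add: mult_left.rep_eq mult_right.rep_eq)
qed

lemma unit_homogeneous:
  assumes "p \<in> J" "q \<in> J" "a \<in> A p q"
  shows "unit Q \<rhd> a = (if Q p then a else 0)" "a \<lhd> unit Q = (if Q q then a else 0)"
  by (simp_all add: unit_mask mask_homogeneous[OF assms])

lemma homogeneous_multiplier_eqI:
  assumes "\<And>p q a. p \<in> J \<Longrightarrow> q \<in> J \<Longrightarrow> a \<in> A p q \<Longrightarrow> m \<rhd> a = n \<rhd> a \<and> a \<lhd> m = a \<lhd> n"
  shows "m = n"
  by (rule multiplier_eqI; rule homogeneous_eqI[OF mult_left_linear mult_left_linear]
      homogeneous_eqI[OF mult_right_linear mult_right_linear])
    (use assms in blast)+

lemma unit_times: "unit Q * unit Q' = unit (\<lambda>p. Q p \<and> Q' p)"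
  by (rule homogeneous_multiplier_eqI) (simp add: unit_homogeneous mult_left_0 mult_right_0)

lemma base_unit: "base_unit J A r = unit (\<lambda>p. p = r)"
  unfolding base_unit_def
  by (rule the_equality) (auto simp: unit_homogeneous intro!: homogeneous_multiplier_eqI)

lemma unit_decompositions:
  assumes "\<And>p. p \<in> J \<Longrightarrow> \<kappa> p \<in> I"
  shows "decomposition I (\<lambda>r a. unit (\<lambda>p. \<kappa> p = r) \<rhd> a)" "decomposition I (\<lambda>r a. a \<lhd> unit (\<lambda>p. \<kappa> p = r))"
  using decomposition_mask[OF proj(1), of "\<kappa> \<circ> fst" I] decomposition_mask[OF proj(1), of "\<kappa> \<circ> snd" I]
      assms
  by (auto simp: unit_mask comp_def)

text \<open>\<open>\<iota>\<close> enumerates the indices satisfying \<open>Q\<close>. On a given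
  \<open>a\<close> only those \<open>t\<close> matter for which \<open>\<iota> t\<close> is the row
  or column index of a nonzero component; there are finitely many of them, so the partial sums are
  eventually constant on \<open>a\<close>.\<close>

lemma strict_sum_units:
  assumes \<iota>: "inj_on \<iota> S" and Q: "\<And>p. p \<in> J \<Longrightarrow> Q p \<Longrightarrow> p \<in> \<iota> ` S" "\<And>t. t \<in> S \<Longrightarrow> Q (\<iota> t)"
  shows "strict_sum (\<lambda>t. unit (\<lambda>p. p = \<iota> t)) S = unit Q"
proof (rule strict_sum_eqI)
  have sum: "(\<Sum>t\<in>F. unit (\<lambda>p. p = \<iota> t)) = unit (\<lambda>p. p \<in> \<iota> ` F)" if "finite F" "F \<subseteq> S" for F
    using that
  proof (induction F rule: finite_induct)
    case empty
    show ?case by (rule homogeneous_multiplier_eqI) (simp add: unit_homogeneous)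
  next
    case (insert t F)
    hence "\<iota> t \<notin> \<iota> ` F" using inj_onD[OF \<iota>] by blast
    thus ?case using insert by (auto intro!: homogeneous_multiplier_eqI simp: unit_homogeneous)
  qed
  show "strictly_tendsto (sum (\<lambda>t. unit (\<lambda>p. p = \<iota> t))) (unit Q) (finite_subsets_at_top S)"
    unfolding strictly_tendsto_def eventually_finite_subsets_at_top
  proof
    fix a
    let ?K = "{k \<in> J \<times> J. proj k a \<noteq> 0}"
    let ?X = "{t \<in> S. \<iota> t \<in> fst ` ?K \<union> snd ` ?K}"
    have "finite (\<iota> ` ?X)"
      by (rule finite_subset[of _ "fst ` ?K \<union> snd ` ?K"])
          (use decomposition_finite[OF proj(1), of a] in auto)
    moreover have "inj_on \<iota> ?X" using \<iota> by (rule inj_on_subset) blast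
    ultimately have X: "finite ?X" by (rule finite_imageD)
    have "sum (\<lambda>t. unit (\<lambda>p. p = \<iota> t)) F \<rhd> a = unit Q \<rhd> a \<and> a \<lhd> sum (\<lambda>t. unit (\<lambda>p. p = \<iota> t)) F
        = a \<lhd> unit Q"
      if F: "finite F" "?X \<subseteq> F" "F \<subseteq> S" for F
    proof -
      have mem: "x \<in> \<iota> ` F \<longleftrightarrow> Q x" if x: "x \<in> J" "x \<in> fst ` ?K \<union> snd ` ?K" for x
      proof
        assume "x \<in> \<iota> ` F"
        thus "Q x" using F(3) Q(2) by blast
      next
        assume "Q x"
        then obtain t where "t \<in> S" "x = \<iota> t" using Q(1)[OF x(1)] by blast
        thus "x \<in> \<iota> ` F" using x(2) F(2) by blast
      qed
      have "fst k \<in> \<iota> ` F \<longleftrightarrow> Q (fst k)" "snd k \<in> \<iota> ` F \<longleftrightarrow> Q (snd k)" if "k \<in> J \<times> J" "proj k a \<noteq> 0" for k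
        by (rule mem; use that in auto)+
      note mem = this
      have "mask (J \<times> J) proj ((\<lambda>p. p \<in> \<iota> ` F) \<circ> fst) a = mask (J \<times> J) proj (Q \<circ> fst) a"
        "mask (J \<times> J) proj ((\<lambda>p. p \<in> \<iota> ` F) \<circ> snd) a = mask (J \<times> J) proj (Q \<circ> snd) a"
        unfolding comp_apply comp_def by (rule mask_cong[OF proj(1)], rule mem, assumption, assumption)+
      thus ?thesis unfolding sum[OF F(1,3)] unit_mask by (rule conjI)
    qed
    thus "\<exists>X. finite X \<and> X \<subseteq> S \<and> (\<forall>F. finite F \<and> X \<subseteq> F \<and> F \<subseteq> S \<longrightarrow>
        sum (\<lambda>t. unit (\<lambda>p. p = \<iota> t)) F \<rhd> a = unit Q \<rhd> a \<and> a \<lhd> sum (\<lambda>t. unit (\<lambda>p. p = \<iota> t)) F = a \<lhd> unit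
            Q)"
      using X by (intro exI[of _ ?X]) auto
  qed
qed

end

section \<open>Partial multiplier Hopf algebras\<close>

locale partial_multiplier_Hopf_algebra =
  fixes I :: "'i set" and A :: "('i, 'a::complex_algebra) bigrading" and \<Delta> :: "'a comult"
  assumes Hopf: "regular_partial_multiplier_Hopf_algebra I A \<Delta>"
begin

lemma bialgebra: "regular_partial_multiplier_bialgebra I A \<Delta>"
  using Hopf unfolding regular_partial_multiplier_Hopf_algebra_def by (rule conjunct1)

lemmas bialgebra_facts = bialgebra[unfolded regular_partial_multiplier_bialgebra_def]

sublocale partial_algebra_units "I \<times> I" A
  by unfold_locales (use bialgebra_facts in blast)

abbreviation "J \<equiv> I \<times> I"
abbreviation "base r \<equiv> unit (\<lambda>p. p = r)"
abbreviation "U r \<equiv> unit (\<lambda>p. fst p = r)"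
abbreviation "L r \<equiv> unit (\<lambda>p. snd p = r)"
abbreviation "B \<equiv> partial_tensor I A A"
abbreviation "E \<equiv> canonical_idempotent I A A"

lemma upper_unit: "r \<in> I \<Longrightarrow> upper_unit I A r = U r"
  and lower_unit: "r \<in> I \<Longrightarrow> lower_unit I A r = L r"
  unfolding upper_unit_def lower_unit_def base_unit by (rule strict_sum_units; auto simp: inj_on_def)+

lemma decompositions: "decomposition I (\<lambda>r a. U r \<rhd> a)" "decomposition I (\<lambda>r a. a \<lhd> U r)"
  "decomposition I (\<lambda>r a. L r \<rhd> a)" "decomposition I (\<lambda>r a. a \<lhd> L r)"
  by (rule unit_decompositions; auto)+

lemma base_decompositions: "decomposition J (\<lambda>r a. base r \<rhd> a)" "decomposition J (\<lambda>r a. a \<lhd> base r)"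
  by (rule unit_decompositions[of "\<lambda>p. p"]; simp)+

lemma base_in:
  assumes "r \<in> J"
  shows "base r \<rhd> a \<in> row J A r" "a \<lhd> base r \<in> col J A r"
proof -
  have zero: "0 \<in> row J A r" "0 \<in> col J A r"
    unfolding row_def col_def by (rule cvec.span_zero)+
  have single: "a \<in> row J A r" if "q \<in> J" "a \<in> A r q" for a q
    unfolding row_def using that by (intro cvec.span_base) blast
  show "base r \<rhd> a \<in> row J A r"
    by (rule homogeneous_into[OF mult_left_linear])
        (use zero(1) single in \<open>auto simp: unit_homogeneous row_def\<close>)
  have single: "a \<in> col J A r" if "q \<in> J" "a \<in> A q r" for a q
    unfolding col_def using that by (intro cvec.span_base) blast
  show "a \<lhd> base r \<in> col J A r"
    by (rule homogeneous_into[OF mult_right_linear])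
        (use zero(2) single in \<open>auto simp: unit_homogeneous col_def\<close>)
qed

lemma row_fixed:
  assumes "r \<in> J" "a \<in> row J A r"
  shows "base r \<rhd> a = a"
proof (rule clinear_eq_on_span[OF mult_left_linear clinear_ident _ assms(2)[unfolded row_def]])
  fix x assume "x \<in> (\<Union>s\<in>J. A r s)"
  then obtain q where "q \<in> J" "x \<in> A r q" by blast
  thus "base r \<rhd> x = x" using unit_homogeneous(1)[OF assms(1)] by simp
qed

lemma col_fixed:
  assumes "r \<in> J" "a \<in> col J A r"
  shows "a \<lhd> base r = a"
proof (rule clinear_eq_on_span[OF mult_right_linear clinear_ident _ assms(2)[unfolded col_def]])
  fix x assume "x \<in> (\<Union>s\<in>J. A s r)"
  then obtain q where "q \<in> J" "x \<in> A q r" by blast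
  thus "x \<lhd> base r = x" using unit_homogeneous(2)[OF _ assms(1)] by simp
qed

text \<open>The hypotheses concern single columns and rows. If \<open>b * c = 0\<close> for all
  \<open>c\<close>, then also \<open>(b \<lhd> base r) * c = 0\<close>, because the unit can be
  moved onto \<open>c\<close>. This piece lies in one column, hence vanishes, and \<open>b\<close>
  is the sum of its pieces.\<close>

lemma nondegenerate: "nondegenerate_algebra TYPE('a)"
proof -
  have left: "left_nondegenerate (col J A r)" and right: "right_nondegenerate (row J A r)" if "r \<in> J"
      for r
    using bialgebra_facts that unfolding nondegenerate_partial_algebra_def by blast+
  have "b = 0" if b: "\<And>c. b * c = 0" for b :: 'a
  proof -
    have "b \<in> {0}"
    proof (rule decomposition_into[OF base_decompositions(2) cvec.subspace_single_0])
      fix r assume r: "r \<in> J"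
      have "(b \<lhd> base r) * c = 0" for c
        by (simp add: b flip: mult_left_right)
      hence "b \<lhd> base r = 0"
        using left[OF r] base_in(2)[OF r] unfolding left_nondegenerate_def by blast
      thus "b \<lhd> base r \<in> {0}" by simp
    qed
    thus ?thesis by simp
  qed
  moreover have "b = 0" if b: "\<And>c. c * b = 0" for b :: 'a
  proof -
    have "b \<in> {0}"
    proof (rule decomposition_into[OF base_decompositions(1) cvec.subspace_single_0])
      fix r assume r: "r \<in> J"
      have "c * (base r \<rhd> b) = 0" for c
        by (simp add: b mult_left_right)
      hence "base r \<rhd> b = 0"
        using right[OF r] base_in(1)[OF r] unfolding right_nondegenerate_def by blast
      thus "base r \<rhd> b \<in> {0}" by simp
    qed
    thus ?thesis by simp
  qed
  ultimately show ?thesis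
    unfolding nondegenerate_algebra_def left_nondegenerate_def right_nondegenerate_def by blast
qed

lemmas N2 = nondegenerate_tensor[OF nondegenerate nondegenerate]

text \<open>The row at \<open>p\<close> is spanned by products \<open>v * w\<close> of its own
  elements, and \<open>w = base p \<rhd> w\<close> allows \<open>v\<close> to be cut down to
  \<open>v \<lhd> base p\<close> in \<open>A p p\<close>. An outer factor with equal row and column
  index is what later keeps a pair of such factors inside the balanced tensor product.\<close>

lemma component_factorization:
  assumes p: "p \<in> J" and q: "q \<in> J" and a: "a \<in> A p q"
  shows "a \<in> cspan {v * w | v w. v \<in> A p p \<and> w \<in> UNIV}" "a \<in> cspan {w * v | v w. v \<in> A q q \<and> w \<in> UNIV}"
proof -
  have "set_product (row J A p) (row J A p) = row J A p" "set_product (col J A q) (col J A q) = col J A q"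
    using bialgebra_facts p q unfolding idempotent_partial_algebra_def idempotent_algebra_def by blast+
  moreover have "a \<in> row J A p" "a \<in> col J A q"
    unfolding row_def col_def using assms by (blast intro: cvec.span_base)+
  ultimately have a_span: "a \<in> cspan {v * w | v w. v \<in> row J A p \<and> w \<in> row J A p}"
    "a \<in> cspan {w * v | w v. w \<in> col J A q \<and> v \<in> col J A q}"
    unfolding set_product_def by blast+
  have in_corner: "v \<lhd> base p \<in> A p p" if v: "v \<in> row J A p" for v
  proof (rule clinear_span_into[OF mult_right_linear component_subspace[OF p p] _ v[unfolded row_def]])
    fix x assume "x \<in> (\<Union>s\<in>J. A p s)"
    then obtain s where "s \<in> J" "x \<in> A p s" by blast
    thus "x \<lhd> base p \<in> A p p"
      using unit_homogeneous(2)[OF p, of s x] cvec.subspace_0[OF component_subspace[OF p p]] by auto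
  qed
  show "a \<in> cspan {v * w | v w. v \<in> A p p \<and> w \<in> UNIV}"
  proof (rule subsetD[OF cvec.span_minimal[OF _ cvec.subspace_span] a_span(1)], clarify)
    fix v w assume "v \<in> row J A p" "w \<in> row J A p"
    hence "v * w = (v \<lhd> base p) * w" "v \<lhd> base p \<in> A p p"
      using row_fixed[OF p] in_corner by (simp_all flip: mult_left_right)
    thus "v * w \<in> cspan {v * w | v w. v \<in> A p p \<and> w \<in> UNIV}" by (blast intro: cvec.span_base)
  qed
  have in_corner: "base q \<rhd> v \<in> A q q" if v: "v \<in> col J A q" for v
  proof (rule clinear_span_into[OF mult_left_linear component_subspace[OF q q] _ v[unfolded col_def]])
    fix x assume "x \<in> (\<Union>s\<in>J. A s q)"
    then obtain s where "s \<in> J" "x \<in> A s q" by blast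
    thus "base q \<rhd> x \<in> A q q"
      using unit_homogeneous(1)[OF _ q, of s x] cvec.subspace_0[OF component_subspace[OF q q]] by auto
  qed
  show "a \<in> cspan {w * v | v w. v \<in> A q q \<and> w \<in> UNIV}"
  proof (rule subsetD[OF cvec.span_minimal[OF _ cvec.subspace_span] a_span(2)], clarify)
    fix w v assume "w \<in> col J A q" "v \<in> col J A q"
    hence "w * v = w * (base q \<rhd> v)" "base q \<rhd> v \<in> A q q"
      using col_fixed[OF q] in_corner by (simp_all add: mult_left_right)
    thus "w * v \<in> cspan {w * v | v w. v \<in> A q q \<and> w \<in> UNIV}" by (blast intro: cvec.span_base)
  qed
qed

lemma idempotent: "idempotent_algebra (UNIV :: 'a set)"
proof -
  have "a \<in> cspan {v * w | v w. v \<in> UNIV \<and> w \<in> UNIV}" for a :: 'a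
  proof (rule homogeneous_into[OF clinear_ident cvec.subspace_span])
    fix p q and a assume "p \<in> J" "q \<in> J" "a \<in> A p q"
    from component_factorization(1)[OF this] show "a \<in> cspan {v * w | v w. v \<in> UNIV \<and> w \<in> UNIV}"
      using cvec.span_mono[of "{v * w | v w. v \<in> A p p \<and> w \<in> UNIV}" "{v * w | v w. v \<in> UNIV \<and>
          w \<in> UNIV}"] by blast
  qed
  thus ?thesis unfolding idempotent_algebra_def set_product_def by blast
qed

lemma homogeneous_tensor_eqI:
  fixes F G :: "('a, 'a) tensor \<Rightarrow> 'b::complex_vector"
  assumes F: "clinear F" and G: "clinear G"
    and eq: "\<And>p q p' q' a b. p \<in> J \<Longrightarrow> q \<in> J \<Longrightarrow> p' \<in> J \<Longrightarrow> q' \<in> J \<Longrightarrow> a \<in> A p q \<Longrightarrow> b \<in> A p' q' \<Longrightarrow> F (a \<otimes> b)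
        = G (a \<otimes> b)"
  shows "F x = G x"
proof (induction x rule: tensor_induct)
  case (pure a b)
  show ?case
  proof (rule homogeneous_eqI[OF clinear_compose[OF F clinear_pure_tensor(1)]
      clinear_compose[OF G clinear_pure_tensor(1)]])
    fix p q a assume a: "p \<in> J" "q \<in> J" "a \<in> A p q"
    show "F (a \<otimes> b) = G (a \<otimes> b)"
      by (rule homogeneous_eqI[OF clinear_compose[OF F clinear_pure_tensor(2)]
          clinear_compose[OF G clinear_pure_tensor(2)]])
        (rule eq[OF a(1,2) _ _ a(3)])
  qed
qed (simp add: clinear_add[OF F] clinear_add[OF G])

lemma homogeneous_tensor_into:
  fixes F :: "('a, 'a) tensor \<Rightarrow> 'b::complex_vector"
  assumes F: "clinear F" and V: "csubspace V"
    and into: "\<And>p q p' q' a b. p \<in> J \<Longrightarrow> q \<in> J \<Longrightarrow> p' \<in> J \<Longrightarrow> q' \<in> J \<Longrightarrow> a \<in> A p q \<Longrightarrow> b \<in> A p' q' \<Longrightarrow> F (a \<otimes> b) \<in> V"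
  shows "F x \<in> V"
proof (induction x rule: tensor_induct)
  case (pure a b)
  show ?case
  proof (rule homogeneous_into[OF clinear_compose[OF F clinear_pure_tensor(1)] V])
    fix p q a assume a: "p \<in> J" "q \<in> J" "a \<in> A p q"
    show "F (a \<otimes> b) \<in> V"
      by (rule homogeneous_into[OF clinear_compose[OF F clinear_pure_tensor(2)] V])
          (rule into[OF a(1,2) _ _ a(3)])
  qed
qed (simp add: clinear_add[OF F] cvec.subspace_add[OF V])

section \<open>The canonical idempotent as a multiplier\<close>

abbreviation "E_left \<equiv> diag I (\<lambda>r a. L r \<rhd> a) (\<lambda>r a. U r \<rhd> a)"
abbreviation "E_right \<equiv> diag I (\<lambda>r a. a \<lhd> L r) (\<lambda>r a. a \<lhd> U r)"

lemmas E_linear = clinear_diag[OF decompositions(3,1)] clinear_diag[OF decompositions(4,2)]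

lemma diag_homogeneous:
  assumes "p \<in> J" "q \<in> J" "p' \<in> J" "q' \<in> J" "a \<in> A p q" "b \<in> A p' q'"
  shows "E_left (a \<otimes> b) = (if snd p = fst p' then a \<otimes> b else 0)" "E_right (a \<otimes> b)
      = (if snd q = fst q' then a \<otimes> b else 0)"
proof -
  have "snd p \<in> I" "snd q \<in> I" using assms(1,2) by auto
  from diag_left[OF decompositions(3,1) this(1), of a b] diag_left[OF decompositions(4,2) this(2), of a b]
  show "E_left (a \<otimes> b) = (if snd p = fst p' then a \<otimes> b else 0)" "E_right (a \<otimes> b)
      = (if snd q = fst q' then a \<otimes> b else 0)"
    using unit_homogeneous[OF assms(1,2,5)] unit_homogeneous[OF assms(3,4,6)] by (auto split: if_splits)
qed

text \<open>\<open>E\<close> is given as a strict limit by a definite description, so a multiplier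
  with these actions is built first and then recognised as the limit. For the multiplier law, a
  product of homogeneous tensors vanishes unless the column indices of the first are the row indices
  of the second, and then the matching conditions tested by \<open>E_right\<close> and
  \<open>E_left\<close> coincide.\<close>

lemma canonical_idempotent_actions: "E \<rhd> x = E_left x" "x \<lhd> E = E_right x"
proof -
  have "x * E_left y = E_right x * y" for x y
  proof (rule homogeneous_tensor_eqI[of "\<lambda>x. x * E_left y" "\<lambda>x. E_right x * y"])
    fix p q p' q' a b assume a: "p \<in> J" "q \<in> J" "p' \<in> J" "q' \<in> J" "a \<in> A p q" "b \<in> A p' q'"
    show "(a \<otimes> b) * E_left y = E_right (a \<otimes> b) * y"
    proof (rule homogeneous_tensor_eqI[of "\<lambda>y. (a \<otimes> b) * E_left y"])
      fix r s r' s' c d assume c: "r \<in> J" "s \<in> J" "r' \<in> J" "s' \<in> J" "c \<in> A r s" "d \<in> A r' s'"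
      have "a * c = 0 \<or> q = r" "b * d = 0 \<or> q' = r'"
        using product_zero[OF a(1,2) c(1,2) a(5) c(5)] product_zero[OF a(3,4) c(3,4) a(6) c(6)] by auto
      thus "(a \<otimes> b) * E_left (c \<otimes> d) = E_right (a \<otimes> b) * (c \<otimes> d)"
        by (auto simp: diag_homogeneous[OF a] diag_homogeneous[OF c] pure_times_pure)
    qed (rule clinear_compose[OF clinear_mult_left E_linear(1)] clinear_mult_left)+
  qed (rule clinear_mult_right clinear_compose[OF clinear_mult_right E_linear(2)])+
  hence Rep: "Rep_multiplier (Abs_multiplier (E_left, E_right)) = (E_left, E_right)"
    using E_linear by (intro Abs_multiplier_inverse) simp
  define E' where "E' = Abs_multiplier (E_left, E_right)"
  have E': "E' \<rhd> x = E_left x" "x \<lhd> E' = E_right x" for x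
    unfolding E'_def mult_left.rep_eq[of "Abs_multiplier _"] mult_right.rep_eq[of _ "Abs_multiplier _"]
        Rep by simp_all
  have "E = E'"
    unfolding canonical_idempotent_def
  proof (rule strict_sum_eqI)
    let ?u = "\<lambda>t. lower_unit I A t \<otimes>\<^sub>m upper_unit I A t"
    show "strictly_tendsto (sum ?u) E' (finite_subsets_at_top I)"
      unfolding strictly_tendsto_def
    proof
      fix x
      show "\<forall>\<^sub>F F in finite_subsets_at_top I. sum ?u F \<rhd> x = E' \<rhd> x \<and> x \<lhd> sum ?u F = x \<lhd> E'"
      proof (induction x rule: tensor_induct)
        case (pure a b)
        \<comment> \<open>For \<open>r\<close> outside \<open>?X\<close> the unit \<open>L r\<close>
          kills \<open>a\<close> from both sides, so partial sums over sets containing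
          \<open>?X\<close> agree with both \<open>diag\<close> sums.\<close>
        let ?X = "{r \<in> I. L r \<rhd> a \<noteq> 0} \<union> {r \<in> I. a \<lhd> L r \<noteq> 0}"
        have "finite ?X" using decomposition_finite[OF decompositions(3)]
            decomposition_finite[OF decompositions(4)] by blast
        moreover have "sum ?u F \<rhd> (a \<otimes> b) = E' \<rhd> (a \<otimes> b) \<and> (a \<otimes> b) \<lhd> sum ?u F = (a \<otimes> b) \<lhd> E'"
          if F: "finite F" "?X \<subseteq> F" "F \<subseteq> I" for F
        proof -
          have u: "sum ?u F = (\<Sum>t\<in>F. L t \<otimes>\<^sub>m U t)"
            by (rule sum.cong) (use F(3) upper_unit lower_unit in auto)
          have "E_left (a \<otimes> b) = (\<Sum>t\<in>F. (L t \<rhd> a) \<otimes> (U t \<rhd> b))" "E_right (a \<otimes> b)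
              = (\<Sum>t\<in>F. (a \<lhd> L t) \<otimes> (b \<lhd> U t))"
            by (rule diag_pure[OF decompositions(3,1) F(1,3)] diag_pure[OF decompositions(4,2) F(1,3)],
                use F(2) in blast)+
          thus ?thesis unfolding u E' by (simp add: sum_multiplier_actions mult_tensor_pure)
        qed
        ultimately show ?case unfolding eventually_finite_subsets_at_top by (intro exI[of _ ?X]) blast
      next
        case (add x y)
        thus ?case by eventually_elim (simp add: mult_left_add mult_right_add)
      qed
    qed
  qed
  thus "E \<rhd> x = E_left x" "x \<lhd> E = E_right x" by (simp_all add: E')
qed

lemmas E_homogeneous = diag_homogeneous[folded canonical_idempotent_actions]

section \<open>The coproduct and the grading\<close>

lemma comult_facts: "clinear \<Delta>" "\<And>a b. \<Delta> (a * b) = \<Delta> a * \<Delta> b" "\<And>a. E * \<Delta> a = \<Delta> a" "\<And>a. \<Delta> a * E = \<Delta> a"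
  "\<And>r. r \<in> J \<Longrightarrow> cspan {b \<lhd> \<Delta> a | a b. a \<in> col J A r \<and> b \<in> col J B r} = col J B r"
  "\<And>r. r \<in> J \<Longrightarrow> cspan {\<Delta> a \<rhd> b | a b. a \<in> row J A r \<and> b \<in> row J B r} = row J B r"
proof -
  have "partial_morphism J A B E \<Delta>"
    using bialgebra_facts unfolding regular_partial_comultiplication_def by blast
  note m = this[unfolded partial_morphism_def]
  show "clinear \<Delta>" using m by (rule conjunct1)
  show "\<Delta> (a * b) = \<Delta> a * \<Delta> b" for a b using m by blast
  show "E * \<Delta> a = \<Delta> a" "\<Delta> a * E = \<Delta> a" for a using m by blast+
  show "cspan {b \<lhd> \<Delta> a | a b. a \<in> col J A r \<and> b \<in> col J B r} = col J B r"
    "cspan {\<Delta> a \<rhd> b | a b. a \<in> row J A r \<and> b \<in> row J B r} = row J B r" if "r \<in> J" for r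
    using m[THEN conjunct2, THEN conjunct2, THEN conjunct2, rule_format, OF that]
        by (rule conjunct1, rule conjunct2)
qed

text \<open>On the components of \<open>B\<close> this acts as the base unit at \<open>q\<close>:
  the upper index of a component is read off in the first leg, the lower index in the
  second.\<close>

abbreviation "W q \<equiv> U (fst q) \<otimes>\<^sub>m L (snd q)"

lemma partial_tensor_eqI:
  fixes F G :: "('a, 'a) tensor \<Rightarrow> 'b::complex_vector"
  assumes F: "clinear F" and G: "clinear G" and x: "x \<in> B p q"
    and eq: "\<And>a b t u. t \<in> I \<Longrightarrow> u \<in> I \<Longrightarrow> a \<in> A (fst p, t) (fst q, u) \<Longrightarrow> b \<in> A (t, snd p) (u, snd q) \<Longrightarrow>
        F (a \<otimes> b) = G (a \<otimes> b)"
  shows "F x = G x"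
proof -
  have "x \<in> cspan {a \<otimes> b | a b t u. t \<in> I \<and> u \<in> I \<and> a \<in> A (fst p, t) (fst q, u) \<and>
      b \<in> A (t, snd p) (u, snd q)}"
    using x unfolding partial_tensor_def by (simp add: case_prod_unfold)
  thus ?thesis by (rule clinear_eq_on_span[OF F G, rotated]) (use eq in blast)
qed

lemma partial_tensor_actions:
  assumes p: "p \<in> J" and q: "q \<in> J" and x: "x \<in> B p q" and r: "r \<in> J"
  shows "W r \<rhd> x = (if r = p then x else 0)" "x \<lhd> W r = (if r = q then x else 0)" "E \<rhd> x = x" "x \<lhd> E = x"
proof -
  have lin: "clinear (\<lambda>x. if P then x else 0 :: ('a, 'a) tensor)" for P by (simp add: clinear_iff)
  have mem: "(fst p, t) \<in> J" "(t, snd p) \<in> J" "(fst q, t) \<in> J" "(t, snd q) \<in> J" if "t \<in> I" for t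
    using p q that by auto
  have pure: "W r \<rhd> (a \<otimes> b) = (if r = p then a \<otimes> b else 0)" "(a \<otimes> b) \<lhd> W r = (if r = q then a \<otimes> b else 0)"
    "E \<rhd> (a \<otimes> b) = a \<otimes> b" "(a \<otimes> b) \<lhd> E = a \<otimes> b"
    if "t \<in> I" "u \<in> I" "a \<in> A (fst p, t) (fst q, u)" "b \<in> A (t, snd p) (u, snd q)" for a b t u
    using E_homogeneous[OF mem(1)[OF that(1)] mem(3)[OF that(2)] mem(2)[OF that(1)] mem(4)[OF that(2)]
        that(3,4)]
      unit_homogeneous[OF mem(1)[OF that(1)] mem(3)[OF that(2)] that(3)]
      unit_homogeneous[OF mem(2)[OF that(1)] mem(4)[OF that(2)] that(4)]
    by (auto simp: mult_tensor_pure prod_eq_iff)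
  show "W r \<rhd> x = (if r = p then x else 0)"
      by (rule partial_tensor_eqI[OF mult_left_linear lin x]) (rule pure)
  show "x \<lhd> W r = (if r = q then x else 0)"
      by (rule partial_tensor_eqI[OF mult_right_linear lin x]) (rule pure)
  show "E \<rhd> x = x" by (rule partial_tensor_eqI[OF mult_left_linear clinear_ident x]) (rule pure)
  show "x \<lhd> E = x" by (rule partial_tensor_eqI[OF mult_right_linear clinear_ident x]) (rule pure)
qed

lemma partial_tensor_memI:
  assumes "a \<in> A p q" "b \<in> A p' q'" "snd p = fst p'" "snd q = fst q'" "p \<in> J" "q \<in> J"
  shows "a \<otimes> b \<in> B (fst p, snd p') (fst q, snd q')"
proof -
  have "\<exists>t u. t \<in> I \<and> u \<in> I \<and> a \<in> A (fst p, t) (fst q, u) \<and> b \<in> A (t, snd p') (u, snd q')"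
    using assms by (intro exI[of _ "snd p"] exI[of _ "snd q"]) auto
  thus ?thesis unfolding partial_tensor_def by (auto intro!: cvec.span_base)
qed

text \<open>A homogeneous \<open>a \<otimes> b\<close> survives \<open>E\<close> only if its inner
  indices match. Then \<open>component_factorization\<close> splits off factors \<open>v\<close> in
  \<open>A p p\<close> and \<open>v'\<close> in \<open>A p' p'\<close>. Since each has equal row and
  column index, the matching holds on both sides and \<open>v \<otimes> v'\<close> lies in a
  diagonal component of \<open>B\<close>.\<close>

lemma E_local_components:
  "E \<rhd> z \<in> cspan {c * w | c w p q. p \<in> J \<and> q \<in> J \<and> c \<in> B p q}" (is "_ \<in> cspan ?X")
  "z \<lhd> E \<in> cspan {w * c | c w p q. p \<in> J \<and> q \<in> J \<and> c \<in> B p q}" (is "_ \<in> cspan ?Y")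
proof -
  show "E \<rhd> z \<in> cspan ?X"
  proof (rule homogeneous_tensor_into[OF mult_left_linear cvec.subspace_span])
    fix p q p' q' a b assume ab: "p \<in> J" "q \<in> J" "p' \<in> J" "q' \<in> J" "a \<in> A p q" "b \<in> A p' q'"
    show "E \<rhd> (a \<otimes> b) \<in> cspan ?X"
    proof (cases "snd p = fst p'")
      case True
      let ?S = "{v * w | v w. v \<in> A p p \<and> w \<in> UNIV}" and ?T = "{v * w | v w. v \<in> A p' p' \<and> w \<in> UNIV}"
      have "{a \<otimes> b | a b. a \<in> ?S \<and> b \<in> ?T} \<subseteq> ?X"
      proof clarify
        fix v w v' w' assume v: "v \<in> A p p" "v' \<in> A p' p'"
        have "v \<otimes> v' \<in> B (fst p, snd p') (fst p, snd p')" "(fst p, snd p') \<in> J"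
          using partial_tensor_memI[OF v True True ab(1,1)] ab by auto
        thus "\<exists>c u p q. (v * w) \<otimes> (v' * w') = c * u \<and> p \<in> J \<and> q \<in> J \<and> c \<in> B p q"
          using pure_times_pure[of v v' w w'] by metis
      qed
      from cvec.span_mono[OF this] have "a \<otimes> b \<in> cspan ?X"
        using tensor_subspace_span[OF component_factorization(1)[OF ab(1,2,5)]
            component_factorization(1)[OF ab(3,4,6)]] by blast
      thus ?thesis by (simp add: E_homogeneous[OF ab] True)
    next
      case False
      thus ?thesis using cvec.span_zero by (simp add: E_homogeneous[OF ab])
    qed
  qed
  show "z \<lhd> E \<in> cspan ?Y"
  proof (rule homogeneous_tensor_into[OF mult_right_linear cvec.subspace_span])
    fix p q p' q' a b assume ab: "p \<in> J" "q \<in> J" "p' \<in> J" "q' \<in> J" "a \<in> A p q" "b \<in> A p' q'"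
    show "(a \<otimes> b) \<lhd> E \<in> cspan ?Y"
    proof (cases "snd q = fst q'")
      case True
      let ?S = "{w * v | v w. v \<in> A q q \<and> w \<in> UNIV}" and ?T = "{w * v | v w. v \<in> A q' q' \<and> w \<in> UNIV}"
      have "{a \<otimes> b | a b. a \<in> ?S \<and> b \<in> ?T} \<subseteq> ?Y"
      proof clarify
        fix v w v' w' assume v: "v \<in> A q q" "v' \<in> A q' q'"
        have "v \<otimes> v' \<in> B (fst q, snd q') (fst q, snd q')" "(fst q, snd q') \<in> J"
          using partial_tensor_memI[OF v True True ab(2,2)] ab by auto
        thus "\<exists>c u p q. (w * v) \<otimes> (w' * v') = u * c \<and> p \<in> J \<and> q \<in> J \<and> c \<in> B p q"
          using pure_times_pure[of w w' v v'] by metis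
      qed
      from cvec.span_mono[OF this] have "a \<otimes> b \<in> cspan ?Y"
        using tensor_subspace_span[OF component_factorization(2)[OF ab(1,2,5)]
            component_factorization(2)[OF ab(3,4,6)]] by blast
      thus ?thesis by (simp add: E_homogeneous[OF ab] True)
    next
      case False
      thus ?thesis using cvec.span_zero by (simp add: E_homogeneous[OF ab])
    qed
  qed
qed

lemma component_row: "p \<in> J \<Longrightarrow> q \<in> J \<Longrightarrow> c \<in> B p q \<Longrightarrow> c \<in> row J B p"
  and component_col: "p \<in> J \<Longrightarrow> q \<in> J \<Longrightarrow> c \<in> B p q \<Longrightarrow> c \<in> col J B q"
  unfolding row_def col_def by (blast intro: cvec.span_base)+

lemma W_E: "W q * E = E * W q"
proof (rule multiplier_left_eqI[OF N2], rule homogeneous_tensor_eqI[OF mult_left_linear mult_left_linear])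
  fix r s r' s' a b assume ab: "r \<in> J" "s \<in> J" "r' \<in> J" "s' \<in> J" "a \<in> A r s" "b \<in> A r' s'"
  show "(W q * E) \<rhd> (a \<otimes> b) = (E * W q) \<rhd> (a \<otimes> b)"
    using E_homogeneous(1)[OF ab] unit_homogeneous(1)[OF ab(1,2,5)] unit_homogeneous(1)[OF ab(3,4,6)]
    by (auto simp: mult_tensor_pure mult_left_0)
qed

text \<open>For \<open>r \<noteq> q\<close> the row of \<open>B\<close> at \<open>r\<close> is
  spanned by vectors \<open>\<Delta> a' \<rhd> b'\<close> with \<open>a'\<close> in the row of
  \<open>A\<close> at \<open>r\<close>. For these \<open>a * a' = 0\<close>, so
  \<open>\<Delta> a\<close> annihilates that row. Only the row at \<open>q\<close> remains, where
  \<open>W q\<close> is the identity. Columns give the statement for \<open>p\<close>.\<close>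

lemma comult_W:
  assumes p: "p \<in> J" and q: "q \<in> J" and a: "a \<in> A p q"
  shows "\<Delta> a * W q = \<Delta> a" "W p * \<Delta> a = \<Delta> a"
proof -
  have left: "\<Delta> a \<rhd> b = 0" if r: "r \<in> J" "r \<noteq> q" and b: "b \<in> row J B r" for b r
  proof (rule clinear_eq_on_span[OF mult_left_linear, where g = "\<lambda>_. 0"])
    show "b \<in> cspan {\<Delta> a \<rhd> b | a b. a \<in> row J A r \<and> b \<in> row J B r}" using comult_facts(6)[OF r(1)] b
        by simp
    fix y assume "y \<in> {\<Delta> a \<rhd> b | a b. a \<in> row J A r \<and> b \<in> row J B r}"
    then obtain a' b' where y: "y = \<Delta> a' \<rhd> b'" and a': "a' \<in> row J A r" by blast
    have "a * a' = a * (base r \<rhd> a')" by (simp only: row_fixed[OF r(1) a'])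
    also have "\<dots> = 0" using r(2) unit_homogeneous(2)[OF p q a] by (simp add: mult_left_right)
    finally have "\<Delta> a * \<Delta> a' = 0" by (simp add: clinear_0[OF comult_facts(1)] flip: comult_facts(2))
    thus "\<Delta> a \<rhd> y = 0" unfolding y by (metis multiplier_actions(1,5))
  qed (simp add: clinear_iff)
  have right: "b \<lhd> \<Delta> a = 0" if r: "r \<in> J" "r \<noteq> p" and b: "b \<in> col J B r" for b r
  proof (rule clinear_eq_on_span[OF mult_right_linear, where g = "\<lambda>_. 0"])
    show "b \<in> cspan {b \<lhd> \<Delta> a | a b. a \<in> col J A r \<and> b \<in> col J B r}" using comult_facts(5)[OF r(1)] b
        by simp
    fix y assume "y \<in> {b \<lhd> \<Delta> a | a b. a \<in> col J A r \<and> b \<in> col J B r}"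
    then obtain a' b' where y: "y = b' \<lhd> \<Delta> a'" and a': "a' \<in> col J A r" by blast
    have "a' * a = (a' \<lhd> base r) * a" by (simp only: col_fixed[OF r(1) a'])
    also have "\<dots> = 0" using r(2) unit_homogeneous(1)[OF p q a] by (simp flip: mult_left_right)
    finally have "\<Delta> a' * \<Delta> a = 0" by (simp add: clinear_0[OF comult_facts(1)] flip: comult_facts(2))
    thus "y \<lhd> \<Delta> a = 0" unfolding y by (metis multiplier_actions(2,6))
  qed (simp add: clinear_iff)
  show "\<Delta> a * W q = \<Delta> a"
  proof (rule multiplier_left_eqI[OF N2])
    fix z
    \<comment> \<open>Components of \<open>B\<close> generate only the range of \<open>E\<close>.
      This suffices, since \<open>\<Delta> a\<close> absorbs \<open>E\<close> and \<open>E\<close>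
      commutes with \<open>W q\<close>.\<close>
    have "(\<Delta> a * W q) \<rhd> E \<rhd> z = \<Delta> a \<rhd> E \<rhd> z"
    proof (rule clinear_eq_on_span[OF mult_left_linear mult_left_linear _ E_local_components(1)])
      fix y assume "y \<in> {c * w | c w p q. p \<in> J \<and> q \<in> J \<and> c \<in> B p q}"
      then obtain c w p' q' where y: "y = c * w" and c: "p' \<in> J" "q' \<in> J" "c \<in> B p' q'" by blast
      have "\<Delta> a \<rhd> W q \<rhd> c = \<Delta> a \<rhd> c"
        using partial_tensor_actions(1)[OF c q] left[OF c(1) _ component_row[OF c]]
            by (auto simp: mult_left_0)
      thus "(\<Delta> a * W q) \<rhd> y = \<Delta> a \<rhd> y" unfolding y by (simp add: mult_left_times[OF N2])
    qed
    moreover have "\<Delta> a * W q * E = \<Delta> a * W q"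
      by (simp only: mult.assoc W_E) (simp only: mult.assoc[symmetric] comult_facts(4))
    hence "(\<Delta> a * W q) \<rhd> E \<rhd> z = (\<Delta> a * W q) \<rhd> z" by (simp only: multiplier_actions(1)[symmetric])
    moreover have "\<Delta> a \<rhd> E \<rhd> z = \<Delta> a \<rhd> z" by (simp only: multiplier_actions(1)[symmetric] comult_facts(4))
    ultimately show "(\<Delta> a * W q) \<rhd> z = \<Delta> a \<rhd> z" by (simp only:)
  qed
  show "W p * \<Delta> a = \<Delta> a"
  proof (rule multiplier_right_eqI[OF N2])
    fix z
    have "z \<lhd> E \<lhd> (W p * \<Delta> a) = z \<lhd> E \<lhd> \<Delta> a"
    proof (rule clinear_eq_on_span[OF mult_right_linear mult_right_linear _ E_local_components(2)])
      fix y assume "y \<in> {w * c | c w p q. p \<in> J \<and> q \<in> J \<and> c \<in> B p q}"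
      then obtain c w p' q' where y: "y = w * c" and c: "p' \<in> J" "q' \<in> J" "c \<in> B p' q'" by blast
      have "c \<lhd> W p \<lhd> \<Delta> a = c \<lhd> \<Delta> a"
        using partial_tensor_actions(2)[OF c p] right[OF c(2) _ component_col[OF c]]
            by (auto simp: mult_right_0)
      thus "y \<lhd> (W p * \<Delta> a) = y \<lhd> \<Delta> a" unfolding y by (simp add: mult_right_times[OF N2])
    qed
    moreover have "E * (W p * \<Delta> a) = W p * \<Delta> a"
      by (simp only: mult.assoc[symmetric] W_E[symmetric]) (simp only: mult.assoc comult_facts(3))
    hence "z \<lhd> E \<lhd> (W p * \<Delta> a) = z \<lhd> (W p * \<Delta> a)" by (simp only: multiplier_actions(2)[symmetric])
    moreover have "z \<lhd> E \<lhd> \<Delta> a = z \<lhd> \<Delta> a" by (simp only: multiplier_actions(2)[symmetric] comult_facts(3))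
    ultimately show "z \<lhd> (W p * \<Delta> a) = z \<lhd> \<Delta> a" by (simp only:)
  qed
qed

text \<open>For homogeneous \<open>a\<close>, \<open>\<Delta> a\<close> carries the factors
  \<open>W p\<close> and \<open>W q\<close> by \<open>comult_W\<close>. A unit \<open>U r\<close> in
  the first leg or \<open>L r\<close> in the second fixes or kills such a factor under the same
  condition on the index under which the corresponding unit fixes or kills \<open>a\<close>.\<close>

lemma comult_units:
  "\<Delta> (U r \<rhd> a) = (U r \<otimes>\<^sub>m 1) * \<Delta> a" "\<Delta> (a \<lhd> U r) = \<Delta> a * (U r \<otimes>\<^sub>m 1)"
  "\<Delta> (L r \<rhd> a) = (1 \<otimes>\<^sub>m L r) * \<Delta> a" "\<Delta> (a \<lhd> L r) = \<Delta> a * (1 \<otimes>\<^sub>m L r)"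
proof -
  have zero: "unit (\<lambda>p. False) = 0"
    by (rule homogeneous_multiplier_eqI) (simp add: unit_homogeneous)
  have units: "(U r \<otimes>\<^sub>m 1) * W p = (if fst p = r then W p else 0)" "W p * (U r \<otimes>\<^sub>m 1)
      = (if fst p = r then W p else 0)"
    "(1 \<otimes>\<^sub>m L r) * W p = (if snd p = r then W p else 0)" "W p * (1 \<otimes>\<^sub>m L r)
        = (if snd p = r then W p else 0)" for p
    by (auto simp: mult_tensor_mult unit_times zero cong: conj_cong)
  note D = clinear_compose[OF comult_facts(1)]
  note mult = clinear_compose[OF clinear_mult_left comult_facts(1)]
      clinear_compose[OF clinear_mult_right comult_facts(1)]
  show "\<Delta> (U r \<rhd> a) = (U r \<otimes>\<^sub>m 1) * \<Delta> a"
  proof (rule homogeneous_eqI[OF D[OF mult_left_linear] mult(1)])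
    fix p q a assume a: "p \<in> J" "q \<in> J" "a \<in> A p q"
    have "(U r \<otimes>\<^sub>m 1) * (W p * \<Delta> a) = (if fst p = r then W p * \<Delta> a else 0)"
        by (simp add: units flip: mult.assoc)
    thus "\<Delta> (U r \<rhd> a) = (U r \<otimes>\<^sub>m 1) * \<Delta> a" unfolding comult_W[OF a]
        by (simp add: unit_homogeneous[OF a] clinear_0[OF comult_facts(1)])
  qed
  show "\<Delta> (a \<lhd> U r) = \<Delta> a * (U r \<otimes>\<^sub>m 1)"
  proof (rule homogeneous_eqI[OF D[OF mult_right_linear] mult(2)])
    fix p q a assume a: "p \<in> J" "q \<in> J" "a \<in> A p q"
    have "\<Delta> a * W q * (U r \<otimes>\<^sub>m 1) = (if fst q = r then \<Delta> a * W q else 0)" by (simp add: units mult.assoc)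
    thus "\<Delta> (a \<lhd> U r) = \<Delta> a * (U r \<otimes>\<^sub>m 1)" unfolding comult_W[OF a]
        by (simp add: unit_homogeneous[OF a] clinear_0[OF comult_facts(1)])
  qed
  show "\<Delta> (L r \<rhd> a) = (1 \<otimes>\<^sub>m L r) * \<Delta> a"
  proof (rule homogeneous_eqI[OF D[OF mult_left_linear] mult(1)])
    fix p q a assume a: "p \<in> J" "q \<in> J" "a \<in> A p q"
    have "(1 \<otimes>\<^sub>m L r) * (W p * \<Delta> a) = (if snd p = r then W p * \<Delta> a else 0)"
        by (simp add: units flip: mult.assoc)
    thus "\<Delta> (L r \<rhd> a) = (1 \<otimes>\<^sub>m L r) * \<Delta> a" unfolding comult_W[OF a]
        by (simp add: unit_homogeneous[OF a] clinear_0[OF comult_facts(1)])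
  qed
  show "\<Delta> (a \<lhd> L r) = \<Delta> a * (1 \<otimes>\<^sub>m L r)"
  proof (rule homogeneous_eqI[OF D[OF mult_right_linear] mult(2)])
    fix p q a assume a: "p \<in> J" "q \<in> J" "a \<in> A p q"
    have "\<Delta> a * W q * (1 \<otimes>\<^sub>m L r) = (if snd q = r then \<Delta> a * W q else 0)" by (simp add: units mult.assoc)
    thus "\<Delta> (a \<lhd> L r) = \<Delta> a * (1 \<otimes>\<^sub>m L r)" unfolding comult_W[OF a]
        by (simp add: unit_homogeneous[OF a] clinear_0[OF comult_facts(1)])
  qed
qed

lemma well_defined: "canon_well_defined \<Delta>"
  using bialgebra_facts unfolding regular_partial_comultiplication_def canon_well_defined_def by blast

lemmas canon_facts = nondegenerate comult_facts(1) well_defined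

lemma diagonal_ranges:
  "diagonal_tensor I (right_lower I A) (left_lower I A) = range (diag I (\<lambda>r a. a \<lhd> L r) (\<lambda>r a. L r \<rhd> a))"
  "diagonal_tensor I (right_upper I A) (left_upper I A) = range (diag I (\<lambda>r a. a \<lhd> U r) (\<lambda>r a. U r \<rhd> a))"
  "diagonal_tensor I (left_lower I A) (right_lower I A) = range (diag I (\<lambda>r a. L r \<rhd> a) (\<lambda>r a. a \<lhd> L r))"
  "diagonal_tensor I (left_upper I A) (right_upper I A) = range (diag I (\<lambda>r a. U r \<rhd> a) (\<lambda>r a. a \<lhd> U r))"
  "diagonal_tensor I (left_lower I A) (left_upper I A) = range (\<lambda>x. E \<rhd> x)"
  "diagonal_tensor I (right_lower I A) (right_upper I A) = range (\<lambda>x. x \<lhd> E)"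
proof -
  have cong: "diagonal_tensor I V W = diagonal_tensor I V' W'"
    if "\<And>r. r \<in> I \<Longrightarrow> V r = V' r" "\<And>r. r \<in> I \<Longrightarrow> W r = W' r" for V W V' W' :: "'i \<Rightarrow> 'a set"
    unfolding diagonal_tensor_def using that by (metis (no_types, lifting) SUP_cong)
  show "diagonal_tensor I (right_lower I A) (left_lower I A)
      = range (diag I (\<lambda>r a. a \<lhd> L r) (\<lambda>r a. L r \<rhd> a))"
    unfolding range_diag[OF decompositions(4,3)]
        by (rule cong; simp add: right_lower_def left_lower_def lower_unit)
  show "diagonal_tensor I (right_upper I A) (left_upper I A)
      = range (diag I (\<lambda>r a. a \<lhd> U r) (\<lambda>r a. U r \<rhd> a))"
    unfolding range_diag[OF decompositions(2,1)]
        by (rule cong; simp add: right_upper_def left_upper_def upper_unit)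
  show "diagonal_tensor I (left_lower I A) (right_lower I A)
      = range (diag I (\<lambda>r a. L r \<rhd> a) (\<lambda>r a. a \<lhd> L r))"
    unfolding range_diag[OF decompositions(3,4)]
        by (rule cong; simp add: right_lower_def left_lower_def lower_unit)
  show "diagonal_tensor I (left_upper I A) (right_upper I A)
      = range (diag I (\<lambda>r a. U r \<rhd> a) (\<lambda>r a. a \<lhd> U r))"
    unfolding range_diag[OF decompositions(1,2)]
        by (rule cong; simp add: right_upper_def left_upper_def upper_unit)
  show "diagonal_tensor I (left_lower I A) (left_upper I A) = range (\<lambda>x. E \<rhd> x)"
    unfolding canonical_idempotent_actions range_diag[OF decompositions(3,1)]
    by (rule cong; simp add: left_lower_def left_upper_def lower_unit upper_unit)
  show "diagonal_tensor I (right_lower I A) (right_upper I A) = range (\<lambda>x. x \<lhd> E)"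
    unfolding canonical_idempotent_actions range_diag[OF decompositions(4,2)]
    by (rule cong; simp add: right_lower_def right_upper_def lower_unit upper_unit)
qed

text \<open>The last two are the hypotheses on the opposite coproduct conjugated by the flip, which
  interchanges the factors of the diagonal tensors.\<close>

lemma canon_bij:
  "bij_betw (canon1 \<Delta>) (range (diag I (\<lambda>r a. a \<lhd> L r) (\<lambda>r a. L r \<rhd> a))) (range (\<lambda>x. E \<rhd> x))"
  "bij_betw (canon2 \<Delta>) (range (diag I (\<lambda>r a. a \<lhd> U r) (\<lambda>r a. U r \<rhd> a))) (range (\<lambda>x. x \<lhd> E))"
  "bij_betw (canon3 \<Delta>) (range (diag I (\<lambda>r a. L r \<rhd> a) (\<lambda>r a. a \<lhd> L r))) (range (\<lambda>x. x \<lhd> E))"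
  "bij_betw (canon4 \<Delta>) (range (diag I (\<lambda>r a. U r \<rhd> a) (\<lambda>r a. a \<lhd> U r))) (range (\<lambda>x. E \<rhd> x))"
  using Hopf unfolding regular_partial_multiplier_Hopf_algebra_def canon_opposite[OF canon_facts]
      diagonal_ranges[symmetric]
  by (blast intro: bij_betw_flip)+

text \<open>The range of \<open>E\<close> is generated by components of \<open>B\<close>. Each
  component lies in a row and in a column of \<open>B\<close>, and the morphism condition spans
  these by values of \<open>\<Delta>\<close>.\<close>

lemma comult_span:
  "E \<rhd> z \<in> cspan {\<Delta> a \<rhd> w | a w. True}" "z \<lhd> E \<in> cspan {w \<lhd> \<Delta> a | a w. True}"
proof -
  have "{c * w | c w p q. p \<in> J \<and> q \<in> J \<and> c \<in> B p q} \<subseteq> cspan {\<Delta> a \<rhd> w | a w. True}"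
  proof clarify
    fix c w p1 p2 q1 q2 assume "p1 \<in> I" "p2 \<in> I" "q1 \<in> I" "q2 \<in> I" and c: "c \<in> B (p1, p2) (q1, q2)"
    hence J: "(p1, p2) \<in> J" "(q1, q2) \<in> J" by auto
    have "c \<in> cspan {\<Delta> a \<rhd> b | a b. a \<in> row J A (p1, p2) \<and> b \<in> row J B (p1, p2)}"
      using component_row[OF J c] comult_facts(6)[OF J(1)] by simp
    thus "c * w \<in> cspan {\<Delta> a \<rhd> w | a w. True}"
      by (rule clinear_span_into[OF clinear_mult_right cvec.subspace_span, rotated])
        (auto simp: mult_left_times[OF N2, symmetric] intro!: cvec.span_base, blast)
  qed
  from cvec.span_minimal[OF this cvec.subspace_span] show "E \<rhd> z \<in> cspan {\<Delta> a \<rhd> w | a w. True}"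
    using E_local_components(1) by blast
  have "{w * c | c w p q. p \<in> J \<and> q \<in> J \<and> c \<in> B p q} \<subseteq> cspan {w \<lhd> \<Delta> a | a w. True}"
  proof clarify
    fix c w p1 p2 q1 q2 assume "p1 \<in> I" "p2 \<in> I" "q1 \<in> I" "q2 \<in> I" and c: "c \<in> B (p1, p2) (q1, q2)"
    hence J: "(p1, p2) \<in> J" "(q1, q2) \<in> J" by auto
    have "c \<in> cspan {b \<lhd> \<Delta> a | a b. a \<in> col J A (q1, q2) \<and> b \<in> col J B (q1, q2)}"
      using component_col[OF J c] comult_facts(5)[OF J(2)] by simp
    thus "w * c \<in> cspan {w \<lhd> \<Delta> a | a w. True}"
      by (rule clinear_span_into[OF clinear_mult_left cvec.subspace_span, rotated])
        (auto simp: mult_right_times[OF N2, symmetric] intro!: cvec.span_base, blast)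
  qed
  from cvec.span_minimal[OF this cvec.subspace_span] show "z \<lhd> E \<in> cspan {w \<lhd> \<Delta> a | a w. True}"
    using E_local_components(2) by blast
qed

lemma E_local:
  "E \<rhd> z \<in> cspan {c * w | c w. c \<in> corner E}" "z \<lhd> E \<in> cspan {w * c | c w. c \<in> corner E}"
proof -
  have fixed: "c \<in> corner E" if "p \<in> J" "q \<in> J" "c \<in> B p q" for c p q
    using partial_tensor_actions(3,4)[OF that that(1)] by (simp add: corner_def)
  have "{c * w | c w p q. p \<in> J \<and> q \<in> J \<and> c \<in> B p q} \<subseteq> {c * w | c w. c \<in> corner E}"
    using fixed by blast
  from cvec.span_mono[OF this] show "E \<rhd> z \<in> cspan {c * w | c w. c \<in> corner E}"
    using E_local_components(1) by blast
  have "{w * c | c w p q. p \<in> J \<and> q \<in> J \<and> c \<in> B p q} \<subseteq> {w * c | c w. c \<in> corner E}"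
    using fixed by blast
  from cvec.span_mono[OF this] show "z \<lhd> E \<in> cspan {w * c | c w. c \<in> corner E}"
    using E_local_components(2) by blast
qed

text \<open>Compressing a homogeneous tensor by \<open>E\<close> from both sides keeps it if its
  inner row indices and its inner column indices match, and kills it otherwise; the tensors kept
  generate the carrier. Coassociativity, stated on the carrier, thus becomes a statement on the
  corner.\<close>

lemma carrier: "partial_tensor_carrier I A A = corner E"
proof
  have "csubspace (corner E)"
    by (rule cvec.subspaceI) (auto simp: corner_def mult_left_0 mult_right_0 mult_left_add
        mult_right_add mult_left_scaleC mult_right_scaleC)
  moreover have "(\<Union>p\<in>J. \<Union>q\<in>J. B p q) \<subseteq> corner E"
    using partial_tensor_actions(3,4) unfolding corner_def by blast
  ultimately show "partial_tensor_carrier I A A \<subseteq> corner E"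
    unfolding partial_tensor_carrier_def by (intro cvec.span_minimal)
  have in_carrier: "(E \<rhd> x) \<lhd> E \<in> partial_tensor_carrier I A A" for x
  proof (rule homogeneous_tensor_into[OF clinear_compose[OF mult_right_linear mult_left_linear]])
    show "csubspace (partial_tensor_carrier I A A)" unfolding partial_tensor_carrier_def
        by (rule cvec.subspace_span)
    hence zero: "0 \<in> partial_tensor_carrier I A A" by (rule cvec.subspace_0)
    fix p q p' q' a b assume ab: "p \<in> J" "q \<in> J" "p' \<in> J" "q' \<in> J" "a \<in> A p q" "b \<in> A p' q'"
    show "(E \<rhd> (a \<otimes> b)) \<lhd> E \<in> partial_tensor_carrier I A A"
    proof (cases "snd p = fst p' \<and> snd q = fst q'")
      case True
      have "a \<otimes> b \<in> B (fst p, snd p') (fst q, snd q')" "(fst p, snd p') \<in> J" "(fst q, snd q') \<in> J"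
        using partial_tensor_memI[OF ab(5,6) _ _ ab(1,2)] True ab by auto
      hence "a \<otimes> b \<in> partial_tensor_carrier I A A"
        unfolding partial_tensor_carrier_def by (intro cvec.span_base) blast
      thus ?thesis using True by (simp add: E_homogeneous[OF ab])
    next
      case False
      thus ?thesis using zero by (auto simp: E_homogeneous[OF ab] mult_right_0)
    qed
  qed
  show "corner E \<subseteq> partial_tensor_carrier I A A"
  proof
    fix x assume "x \<in> corner E"
    hence "(E \<rhd> x) \<lhd> E = x" by (simp add: corner_def)
    thus "x \<in> partial_tensor_carrier I A A" using in_carrier[of x] by (simp only:)
  qed
qed

lemma coassoc:
  "multiplier_extension (corner E) (comult_id \<Delta>) (leg12 E * leg23 E) (\<Delta> a) =
    multiplier_extension (corner E) (id_comult \<Delta>) (leg12 E * leg23 E) (\<Delta> a)"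
  using bialgebra_facts unfolding regular_partial_comultiplication_def Let_def carrier by blast

section \<open>Properties of the counit\<close>

context
  fixes \<epsilon>
  assumes counit: "partial_counit I A \<Delta> \<epsilon>"
begin

lemmas counit_facts = counit[unfolded partial_counit_def]

lemma counit_linear: "clinear \<epsilon>"
  using counit_facts by (rule conjunct1)

lemma counit_zero: "p \<in> J \<Longrightarrow> q \<in> J \<Longrightarrow> a \<in> A p q \<Longrightarrow> fst p \<noteq> snd p \<or> fst q \<noteq> snd q \<Longrightarrow> \<epsilon> a = 0"
  using counit_facts[THEN conjunct2, THEN conjunct1, rule_format, of "fst p" "snd p" "fst q" "snd q" a]
      by auto

lemma counit_mult: "p \<in> J \<Longrightarrow> q \<in> J \<Longrightarrow> s \<in> J \<Longrightarrow> a \<in> A p q \<Longrightarrow> b \<in> A q s \<Longrightarrow> \<epsilon> (a * b) = \<epsilon> a * \<epsilon> b"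
proof -
  assume *: "p \<in> J" "q \<in> J" "s \<in> J" "a \<in> A p q" "b \<in> A q s"
  have "a \<in> col J A q" "b \<in> row J A q"
    unfolding col_def row_def using * by (blast intro: cvec.span_base)+
  thus ?thesis
    using counit_facts[THEN conjunct2, THEN conjunct2, THEN conjunct2, THEN conjunct1, rule_format, of
        "fst q" "snd q" a b] *
    by auto
qed

text \<open>Multiplicativity is assumed only across a common base unit, whereas \<open>L r\<close>
  and \<open>U r\<close> collect many of them. If the inner indices \<open>q\<close> and
  \<open>p'\<close> differ but share the coordinate \<open>r\<close>, the product is zero and at
  least one of them is off the diagonal, so the counit kills \<open>x\<close> or \<open>y\<close> as
  well.\<close>

lemma counit_times:
  "\<epsilon> (x * (L r \<rhd> y)) = \<epsilon> (x \<lhd> L r) * \<epsilon> (L r \<rhd> y)" "\<epsilon> (x * (U r \<rhd> y)) = \<epsilon> (x \<lhd> U r) * \<epsilon> (U r \<rhd> y)"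
proof -
  have *: "\<epsilon> (x * (unit (\<lambda>p. k p = r) \<rhd> y)) = \<epsilon> (x \<lhd> unit (\<lambda>p. k p = r)) * \<epsilon> (unit (\<lambda>p. k p = r) \<rhd> y)"
    if k: "k = fst \<or> k = snd" for k
  proof -
    let ?u = "unit (\<lambda>p. k p = r)"
    have lin: "clinear (\<lambda>x. \<epsilon> x * c)" "clinear (\<lambda>x. c * \<epsilon> x)" for c
      using clinear_add[OF counit_linear] clinear_scaleC[OF counit_linear]
      by (auto simp: clinear_iff scaleC_complex_def distrib_left distrib_right)
    show ?thesis
    proof (rule homogeneous_eqI[of "\<lambda>x. \<epsilon> (x * (?u \<rhd> y))" "\<lambda>x. \<epsilon> (x \<lhd> ?u) * \<epsilon> (?u \<rhd> y)"])
      fix p q x assume x: "p \<in> J" "q \<in> J" "x \<in> A p q"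
      show "\<epsilon> (x * (?u \<rhd> y)) = \<epsilon> (x \<lhd> ?u) * \<epsilon> (?u \<rhd> y)"
      proof (rule homogeneous_eqI[of "\<lambda>y. \<epsilon> (x * (?u \<rhd> y))" "\<lambda>y. \<epsilon> (x \<lhd> ?u) * \<epsilon> (?u \<rhd> y)"])
        fix p' q' y assume y: "p' \<in> J" "q' \<in> J" "y \<in> A p' q'"
        have "x * y = 0" if "q \<noteq> p'" using product_zero[OF x(1,2) y(1,2) x(3) y(3) that] .
        moreover have "\<epsilon> x * \<epsilon> y = 0" if "q \<noteq> p'" "k q = r" "k p' = r"
        proof -
          have "fst q \<noteq> snd q \<or> fst p' \<noteq> snd p'" using that k by (auto simp: prod_eq_iff)
          thus ?thesis using counit_zero[OF x] counit_zero[OF y] by auto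
        qed
        moreover have "\<epsilon> (x * y) = \<epsilon> x * \<epsilon> y" if "q = p'"
          using counit_mult[OF x(1,2) y(2) x(3)] y(3) that by simp
        ultimately show "\<epsilon> (x * (?u \<rhd> y)) = \<epsilon> (x \<lhd> ?u) * \<epsilon> (?u \<rhd> y)"
          by (cases "q = p'") (auto simp: unit_homogeneous[OF x] unit_homogeneous[OF y]
              clinear_0[OF counit_linear])
      qed (rule clinear_compose[OF counit_linear clinear_compose[OF clinear_mult_left mult_left_linear]]
          clinear_compose[OF lin(2) mult_left_linear])+
    qed (rule clinear_compose[OF counit_linear clinear_mult_right]
        clinear_compose[OF lin(1) mult_right_linear])+
  qed
  show "\<epsilon> (x * (L r \<rhd> y)) = \<epsilon> (x \<lhd> L r) * \<epsilon> (L r \<rhd> y)" "\<epsilon> (x * (U r \<rhd> y)) = \<epsilon> (x \<lhd> U r) * \<epsilon> (U r \<rhd> y)"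
    by (rule *; simp)+
qed

text \<open>The counit sees only components whose row and column indices are diagonal pairs, and on
  these the upper and lower units act alike.\<close>

lemma counit_units: "\<epsilon> (L r \<rhd> x) = \<epsilon> (U r \<rhd> x)" "\<epsilon> (x \<lhd> L r) = \<epsilon> (x \<lhd> U r)"
proof -
  note lin = clinear_compose[OF counit_linear mult_left_linear]
      clinear_compose[OF counit_linear mult_right_linear]
  show "\<epsilon> (L r \<rhd> x) = \<epsilon> (U r \<rhd> x)"
  proof (rule homogeneous_eqI[OF lin(1,1)])
    fix p q a assume a: "p \<in> J" "q \<in> J" "a \<in> A p q"
    show "\<epsilon> (L r \<rhd> a) = \<epsilon> (U r \<rhd> a)"
      using counit_zero[OF a] by (auto simp: unit_homogeneous[OF a] clinear_0[OF counit_linear])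
  qed
  show "\<epsilon> (x \<lhd> L r) = \<epsilon> (x \<lhd> U r)"
  proof (rule homogeneous_eqI[OF lin(2,2)])
    fix p q a assume a: "p \<in> J" "q \<in> J" "a \<in> A p q"
    show "\<epsilon> (a \<lhd> L r) = \<epsilon> (a \<lhd> U r)"
      using counit_zero[OF a] by (auto simp: unit_homogeneous[OF a] clinear_0[OF counit_linear])
  qed
qed

lemma counit_nonzero: "r \<in> I \<Longrightarrow> \<exists>x. \<epsilon> (L r \<rhd> x) \<noteq> 0" "r \<in> I \<Longrightarrow> \<exists>x. \<epsilon> (x \<lhd> L r) \<noteq> 0"
  using counit_facts[THEN conjunct2, THEN conjunct2, THEN conjunct1, rule_format, of r]
  unfolding right_lower_def left_lower_def by (auto simp: lower_unit)

lemma counit_canon: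
  "slice_left \<epsilon> (canon1 \<Delta> (a \<otimes> b)) = a * b" "slice_right \<epsilon> (canon2 \<Delta> (a \<otimes> b)) = a * b"
  "slice_left \<epsilon> (canon3 \<Delta> (a \<otimes> b)) = b * a" "slice_right \<epsilon> (canon4 \<Delta> (a \<otimes> b)) = b * a"
  using counit_facts[THEN conjunct2, THEN conjunct2, THEN conjunct2, THEN conjunct2]
  unfolding canon1_pure[OF canon_facts, symmetric] canon2_pure[OF canon_facts, symmetric]
    canon3_pure[OF canon_facts, symmetric] canon4_pure[OF canon_facts, symmetric] to_alg_of_alg[OF N2]
  by blast+

lemma coassociative: "coassociative_graded_comultiplication I U L \<Delta> E \<epsilon>"
proof (rule coassociative_graded_comultiplication.intro)
  show "graded_comultiplication I U L \<Delta> E \<epsilon>"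
    by (rule graded_comultiplication.intro)
      (rule nondegenerate decompositions canonical_idempotent_actions comult_facts well_defined
          comult_units
        counit_linear counit_times counit_units counit_nonzero counit_canon canon_bij | assumption)+
  have "L r * U s = U s * L r" for r s by (simp add: unit_times conj_commute)
  thus "coassociative_graded_comultiplication_axioms I U L \<Delta> E"
    by (intro coassociative_graded_comultiplication_axioms.intro idempotent comult_span E_local coassoc)
qed

end

theorem weak_multiplier_Hopf_algebra: "regular_weak_multiplier_Hopf_algebra \<Delta>"
proof -
  obtain \<epsilon> where "partial_counit I A \<Delta> \<epsilon>" using bialgebra_facts by blast
  then interpret coassociative_graded_comultiplication I U L \<Delta> E \<epsilon> by (rule coassociative)
  show ?thesis by (rule weak_Hopf_algebra)
qed

end

theorem proposition1p26:
  fixes I :: "'i set"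
    and A :: "'i \<times> 'i \<Rightarrow> 'i \<times> 'i \<Rightarrow> 'a::complex_algebra set"
    and \<Delta> :: "'a \<Rightarrow> ('a, 'a) tensor multiplier"
  assumes "regular_partial_multiplier_Hopf_algebra I A \<Delta>"
  shows "regular_weak_multiplier_Hopf_algebra \<Delta>"
proof -
  interpret partial_multiplier_Hopf_algebra I A \<Delta> using assms by unfold_locales
  show ?thesis by (rule weak_multiplier_Hopf_algebra)
qed

end
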